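(* Let $M^2$ be a smooth surface with a torsion-free affine connection $\nabla$ and let $x:(M^2,\nabla)\to(\mathbb{R}^4,D)$ be an affine immersion with transversal bundle $\sigma$. Assume that $(x,\sigma)$ is 1-degenerate and parallel ($\nabla h=0$). Then $x$ is a ruled surface, and there is an open dense subset of $M^2$ such that around each of its points there are local coordinates $(u,v)$ in which, after applying an affine transformation of $\mathbb{R}^4$ if necessary, $x$ and $\sigma=\mathrm{span}(\xi_1,\xi_2)$ have one of the following forms. Primes denote $d/du$ on functions of $u$; $\varphi_{11}^1,\varphi_{11}^2,\varphi_{21}^2$ denote the functions of $(u,v)$ given in each case. **I.1.** $x(u,v)=\gamma'(u)+v\,\gamma(u)$, where $\gamma$ is a smooth $\mathbb{R}^4$-valued curve with $G:=\det(\gamma,\gamma',\gamma'',\gamma''')\neq 0$. With $L:=\ln|G|$ and functions $a,b,c$ of $u$ defined by $\gamma^{(4)}=L'\gamma'''+a\gamma''+b\gamma'+c\gamma$, $$\xi_1=\gamma'-\varphi_{21}^2\gamma,\qquad \xi_2=\gamma'''+(v-\varphi_{11}^1)\gamma''-v\varphi_{11}^1\gamma'-\varphi_{11}^2\gamma,$$ $$\varphi_{11}^1=\tfrac13(L'+v),\qquad \varphi_{11}^2=\tfrac13\bigl(b-va+v^2(L'+v)\bigr),\qquad \varphi_{21}^2=-\tfrac16(L'+4v).$$ **I.2.** $x(u,v)=(\varepsilon\gamma(u)+\gamma''(u))+v\,\gamma'(u)$, where $\varepsilon\in\{1,-1\}$ and $\gamma$ is a smooth $\mathbb{R}^4$-valued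 curve with $G:=\det(\gamma,\gamma',\gamma'',\gamma''')\neq0$. With $L:=\ln|G|$, functions $a,b,c$ of $u$ defined by $\gamma^{(4)}=L'\gamma'''+a\gamma''+b\gamma'+c\gamma$, $c$ nowhere zero, and $(\ln c)':=c'/c$, $(\ln c+L)':=c'/c+L'$, $$\xi_1=\gamma''-\varphi_{21}^2\gamma',\qquad \xi_2=(L'+v-\varphi_{11}^1)\gamma'''+(a+\varepsilon-v\varphi_{11}^1)\gamma''+(b-\varepsilon\varphi_{11}^1-\varphi_{11}^2)\gamma'+c\gamma,$$ $$\varphi_{11}^1=\tfrac13\bigl((\ln c+L)'+v\bigr),\qquad \varphi_{21}^2=-\tfrac16\bigl((\ln c+L)'+4v\bigr),$$ $$\varphi_{11}^2=\tfrac13\Bigl\{b+a'-\varepsilon L'-(a+\varepsilon)(\ln c)'+v\bigl(-L''+L'(\ln c)'-a-2\varepsilon\bigr)+v^2(\ln c+L)'+v^3\Bigr\}.$$ **II.** $x(u,v)=\alpha(u)+v\,\beta(u)$, where $\alpha,\beta$ are smooth $\mathbb{R}^4$-valued curves with $\beta''=-\beta$ and $\Delta:=\det(\alpha'',\alpha',\beta',\beta)\neq0$. With $L:=\ln|\Delta|$ and functions $a,b,c$ of $u$ defined by $\alpha'''=L'\alpha''+a\alpha'+b\beta'+c\beta$, $$\xi_1=\beta'-\varphi_{21}^2\beta,\qquad \xi_2=\alpha''-\varphi_{11}^1\alpha'-v\varphi_{11}^1\beta'-(v+\varphi_{11}^2)\beta,$$ $$\varphi_{11}^1=\tfrac13L',\qquad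 \varphi_{11}^2=\tfrac13(b-va-v),\qquad \varphi_{21}^2=-\tfrac16L'.$$
   Context: All objects are smooth; $D$ is the standard flat connection of $\mathbb{R}^4$ and $\det$ the standard determinant on $\mathbb{R}^4$. Results are local and valid on a suitable open dense subset of $M^2$. **Affine immersion.** An immersion $x:(M^2,\nabla)\to(\mathbb{R}^4,D)$, with $\nabla$ a torsion-free affine connection, is an affine immersion with transversal bundle $\sigma$ if $\sigma$ is a rank-2 bundle along $x$ with $\mathbb{R}^4=x_*(T_pM)\oplus\sigma_p$ for all $p$ and $h(X,Y):=D_Xx_*(Y)-x_*(\nabla_XY)\in\sigma$ for all tangent vector fields $X,Y$. The symmetric $\sigma$-valued bilinear form $h$ is the second fundamental form. For a section $\xi$ of $\sigma$ write $D_X\xi=-x_*(A_\xi X)+\nabla^\perp_X\xi$ with $\nabla^\perp_X\xi\in\sigma$; $\nabla^\perp$ is the normal connection. Put $(\nabla_Xh)(Y,Z)=\nabla^\perp_Xh(Y,Z)-h(\nabla_XY,Z)-h(Y,\nabla_XZ)$. The immersion is parallel if $\nabla h=0$. **1-degenerate.** For a local frame $\{X_1,X_2\}$ of $TM^2$, define the symmetric bilinear form $$h_{\{X_1,X_2\}}(X,Y)=\tfrac12\bigl(\det(X_1,X_2,D_{X_1}X,D_{X_2}Y)+\det(X_1,X_2,D_{X_1}Y,D_{X_2}X)\bigr),$$ where tangent fields are identified with their images under $x_*$. Its rank does not depend on the frame. The surface is 1-degenerate if this rank is 1 everywhere. **Ruled surface.** $x$ is ruled if locally it can be parametrized as $x(u,v)=\alpha(u)+v\beta(u)$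 with curves $\alpha,\beta$ in $\mathbb{R}^4$. *)

theory Defs
  imports "HOL-Analysis.Analysis"
begin

section \<open>Smooth maps, derivatives of curves, determinant\<close>

primrec Ck_on :: "nat \<Rightarrow> 'a::real_normed_vector set \<Rightarrow> ('a \<Rightarrow> 'b::real_normed_vector) \<Rightarrow> bool" where
  "Ck_on 0 U f \<longleftrightarrow> continuous_on U f"
| "Ck_on (Suc k) U f \<longleftrightarrow>
     (\<forall>z\<in>U. f differentiable (at z)) \<and> (\<forall>v. Ck_on k U (\<lambda>z. frechet_derivative f (at z) v))"

text \<open>Only used for open sets \<open>U\<close> and finite-dimensional domains; values outside \<open>U\<close> are irrelevant.\<close>
definition smooth_on :: "'a::real_normed_vector set \<Rightarrow> ('a \<Rightarrow> 'b::real_normed_vector) \<Rightarrow> bool" where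
  "smooth_on U f \<longleftrightarrow> (\<forall>k. Ck_on k U f)"

definition der :: "nat \<Rightarrow> (real \<Rightarrow> 'a::real_normed_vector) \<Rightarrow> real \<Rightarrow> 'a" where
  "der k c = ((\<lambda>f u. vector_derivative f (at u)) ^^ k) c"

definition det4 :: "real^4 \<Rightarrow> real^4 \<Rightarrow> real^4 \<Rightarrow> real^4 \<Rightarrow> real" where
  "det4 p q r s = det (vector [p, q, r, s] :: real^4^4)"


section \<open>Smooth surfaces\<close>

text \<open>A chart is given by its local parametrization: a pair \<open>(W, \<psi>)\<close> of an open set \<open>W\<close> of the
  coordinate plane and a homeomorphism \<open>\<psi>\<close> of \<open>W\<close> onto an open subset of the surface.\<close>
type_synonym plane = "real \<times> real"
type_synonym 'm chart = "plane set \<times> (plane \<Rightarrow> 'm)"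

definition image_of :: "'m chart \<Rightarrow> 'm set" where
  "image_of \<kappa> = snd \<kappa> ` fst \<kappa>"

definition is_chart :: "'m::topological_space chart \<Rightarrow> bool" where
  "is_chart \<kappa> \<longleftrightarrow> open (fst \<kappa>) \<and> open (image_of \<kappa>) \<and>
     homeomorphism (fst \<kappa>) (image_of \<kappa>) (snd \<kappa>) (inv_into (fst \<kappa>) (snd \<kappa>))"

definition overlap :: "'m chart \<Rightarrow> 'm chart \<Rightarrow> plane set" where
  "overlap \<kappa> \<kappa>' = {q \<in> fst \<kappa>. snd \<kappa> q \<in> image_of \<kappa>'}"

definition transition :: "'m chart \<Rightarrow> 'm chart \<Rightarrow> plane \<Rightarrow> plane" where
  "transition \<kappa> \<kappa>' q = inv_into (fst \<kappa>') (snd \<kappa>') (snd \<kappa> q)"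

definition compatible :: "'m chart \<Rightarrow> 'm chart \<Rightarrow> bool" where
  "compatible \<kappa> \<kappa>' \<longleftrightarrow> smooth_on (overlap \<kappa> \<kappa>') (transition \<kappa> \<kappa>') \<and>
     smooth_on (overlap \<kappa>' \<kappa>) (transition \<kappa>' \<kappa>)"

definition points :: "'m chart set \<Rightarrow> 'm set" where
  "points \<A> = (\<Union>\<kappa>\<in>\<A>. image_of \<kappa>)"

text \<open>The surface is the set \<open>points \<A>\<close>, an open subset of the ambient Hausdorff, second countable
  space \<open>'m\<close>, with the smooth structure generated by the atlas \<open>\<A>\<close>.\<close>
definition smooth_surface :: "'m::{t2_space,second_countable_topology} chart set \<Rightarrow> bool" where
  "smooth_surface \<A> \<longleftrightarrow> (\<forall>\<kappa>\<in>\<A>. is_chart \<kappa>) \<and> (\<forall>\<kappa>\<in>\<A>. \<forall>\<kappa>'\<in>\<A>. compatible \<kappa> \<kappa>')"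

text \<open>Members of the maximal atlas.\<close>
definition local_coordinates :: "'m::{t2_space,second_countable_topology} chart set \<Rightarrow> 'm chart \<Rightarrow> bool" where
  "local_coordinates \<A> \<kappa> \<longleftrightarrow>
     is_chart \<kappa> \<and> image_of \<kappa> \<subseteq> points \<A> \<and> (\<forall>\<kappa>'\<in>\<A>. compatible \<kappa> \<kappa>')"


section \<open>Affine connections\<close>

text \<open>Vector fields on an open subset \<open>V\<close> of a chart domain are their component functions
  \<open>plane \<Rightarrow> plane\<close>, smooth on \<open>V\<close>.  \<open>dirder X \<xi>\<close> is the flat derivative \<open>D_X \<xi>\<close>.\<close>
definition dirder :: "(plane \<Rightarrow> plane) \<Rightarrow> (plane \<Rightarrow> 'b::real_normed_vector) \<Rightarrow> plane \<Rightarrow> 'b" where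
  "dirder X \<xi> q = frechet_derivative \<xi> (at q) (X q)"

text \<open>\<open>\<Gamma> q a b\<close> collects the Christoffel symbols at \<open>q\<close>: its components are
  \<open>\<Sum>i j. \<Gamma>\<^sub>i\<^sub>j\<^sup>k a\<^sub>i b\<^sub>j\<close>.\<close>
type_synonym christoffel = "plane \<Rightarrow> plane \<Rightarrow> plane \<Rightarrow> plane"

definition cov :: "christoffel \<Rightarrow> (plane \<Rightarrow> plane) \<Rightarrow> (plane \<Rightarrow> plane) \<Rightarrow> plane \<Rightarrow> plane" where
  "cov \<Gamma> X Y q = dirder X Y q + \<Gamma> q (X q) (Y q)"

text \<open>The transformation law says exactly that the covariant derivatives computed in two charts
  correspond under the differential of the transition map.\<close>
definition affine_connection ::
  "'m chart set \<Rightarrow> ('m chart \<Rightarrow> christoffel) \<Rightarrow> bool" where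
  "affine_connection \<A> nabla \<longleftrightarrow>
     (\<forall>\<kappa>\<in>\<A>. (\<forall>q\<in>fst \<kappa>. bilinear (nabla \<kappa> q)) \<and> (\<forall>a b. smooth_on (fst \<kappa>) (\<lambda>q. nabla \<kappa> q a b))) \<and>
     (\<forall>\<kappa>\<in>\<A>. \<forall>\<kappa>'\<in>\<A>. \<forall>q\<in>overlap \<kappa> \<kappa>'. \<forall>a b.
        (let \<tau> = transition \<kappa> \<kappa>'; d\<tau> = (\<lambda>z. frechet_derivative \<tau> (at z)) in
           d\<tau> q (nabla \<kappa> q a b) =
             frechet_derivative (\<lambda>z. d\<tau> z b) (at q) a + nabla \<kappa>' (\<tau> q) (d\<tau> q a) (d\<tau> q b)))"

definition torsion_free ::
  "'m chart set \<Rightarrow> ('m chart \<Rightarrow> christoffel) \<Rightarrow> bool" where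
  "torsion_free \<A> nabla \<longleftrightarrow>
     (\<forall>\<kappa>\<in>\<A>. \<forall>V X Y. open V \<and> V \<subseteq> fst \<kappa> \<and> smooth_on V X \<and> smooth_on V Y \<longrightarrow>
        (\<forall>q\<in>V. cov (nabla \<kappa>) X Y q - cov (nabla \<kappa>) Y X q = dirder X Y q - dirder Y X q))"


section \<open>Affine immersions of surfaces in 4-space\<close>

text \<open>In what follows \<open>f\<close> is an immersion, \<open>\<Gamma>\<close> a connection and \<open>S\<close> a transversal bundle,
  all expressed in one chart.\<close>

definition push :: "(plane \<Rightarrow> real^4) \<Rightarrow> (plane \<Rightarrow> plane) \<Rightarrow> plane \<Rightarrow> real^4" where
  "push f X q = frechet_derivative f (at q) (X q)"

definition tangent_plane :: "(plane \<Rightarrow> real^4) \<Rightarrow> plane \<Rightarrow> (real^4) set" where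
  "tangent_plane f q = range (frechet_derivative f (at q))"

definition second_form ::
  "(plane \<Rightarrow> real^4) \<Rightarrow> christoffel \<Rightarrow> (plane \<Rightarrow> plane) \<Rightarrow> (plane \<Rightarrow> plane) \<Rightarrow> plane \<Rightarrow> real^4" where
  "second_form f \<Gamma> X Y q = dirder X (push f Y) q - push f (cov \<Gamma> X Y) q"

definition sigma_part ::
  "(plane \<Rightarrow> real^4) \<Rightarrow> (plane \<Rightarrow> (real^4) set) \<Rightarrow> plane \<Rightarrow> real^4 \<Rightarrow> real^4" where
  "sigma_part f S q w = (THE s. s \<in> S q \<and> w - s \<in> tangent_plane f q)"

definition normal_connection ::
  "(plane \<Rightarrow> real^4) \<Rightarrow> (plane \<Rightarrow> (real^4) set) \<Rightarrow> (plane \<Rightarrow> plane) \<Rightarrow> (plane \<Rightarrow> real^4) \<Rightarrow>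
     plane \<Rightarrow> real^4" where
  "normal_connection f S X \<xi> q = sigma_part f S q (dirder X \<xi> q)"

definition nabla_second_form ::
  "(plane \<Rightarrow> real^4) \<Rightarrow> christoffel \<Rightarrow> (plane \<Rightarrow> (real^4) set) \<Rightarrow>
     (plane \<Rightarrow> plane) \<Rightarrow> (plane \<Rightarrow> plane) \<Rightarrow> (plane \<Rightarrow> plane) \<Rightarrow> plane \<Rightarrow> real^4" where
  "nabla_second_form f \<Gamma> S X Y Z q =
     normal_connection f S X (second_form f \<Gamma> Y Z) q
     - second_form f \<Gamma> (cov \<Gamma> X Y) Z q - second_form f \<Gamma> Y (cov \<Gamma> X Z) q"

definition smooth_immersion ::
  "'m chart set \<Rightarrow> ('m \<Rightarrow> real^4) \<Rightarrow> bool" where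
  "smooth_immersion \<A> x \<longleftrightarrow> (\<forall>\<kappa>\<in>\<A>. smooth_on (fst \<kappa>) (x \<circ> snd \<kappa>) \<and>
     (\<forall>q\<in>fst \<kappa>. inj (frechet_derivative (x \<circ> snd \<kappa>) (at q))))"

definition rank2_bundle_along ::
  "'m chart set \<Rightarrow> ('m \<Rightarrow> (real^4) set) \<Rightarrow> bool" where
  "rank2_bundle_along \<A> \<sigma> \<longleftrightarrow> (\<forall>\<kappa>\<in>\<A>. \<forall>q\<in>fst \<kappa>. \<exists>V s\<^sub>1 s\<^sub>2.
     open V \<and> q \<in> V \<and> V \<subseteq> fst \<kappa> \<and> smooth_on V s\<^sub>1 \<and> smooth_on V s\<^sub>2 \<and>
     (\<forall>z\<in>V. s\<^sub>1 z \<noteq> s\<^sub>2 z \<and> independent {s\<^sub>1 z, s\<^sub>2 z} \<and> \<sigma> (snd \<kappa> z) = span {s\<^sub>1 z, s\<^sub>2 z}))"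

definition affine_immersion ::
  "'m chart set \<Rightarrow> ('m chart \<Rightarrow> christoffel) \<Rightarrow> ('m \<Rightarrow> real^4) \<Rightarrow> ('m \<Rightarrow> (real^4) set) \<Rightarrow> bool" where
  "affine_immersion \<A> nabla x \<sigma> \<longleftrightarrow>
     smooth_immersion \<A> x \<and> rank2_bundle_along \<A> \<sigma> \<and>
     (\<forall>\<kappa>\<in>\<A>. \<forall>q\<in>fst \<kappa>.
        tangent_plane (x \<circ> snd \<kappa>) q \<inter> \<sigma> (snd \<kappa> q) = {0} \<and>
        {t + s |t s. t \<in> tangent_plane (x \<circ> snd \<kappa>) q \<and> s \<in> \<sigma> (snd \<kappa> q)} = UNIV) \<and>
     (\<forall>\<kappa>\<in>\<A>. \<forall>V X Y. open V \<and> V \<subseteq> fst \<kappa> \<and> smooth_on V X \<and> smooth_on V Y \<longrightarrow>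
        (\<forall>q\<in>V. second_form (x \<circ> snd \<kappa>) (nabla \<kappa>) X Y q \<in> \<sigma> (snd \<kappa> q)))"

definition parallel_immersion ::
  "'m chart set \<Rightarrow> ('m chart \<Rightarrow> christoffel) \<Rightarrow> ('m \<Rightarrow> real^4) \<Rightarrow> ('m \<Rightarrow> (real^4) set) \<Rightarrow> bool" where
  "parallel_immersion \<A> nabla x \<sigma> \<longleftrightarrow>
     (\<forall>\<kappa>\<in>\<A>. \<forall>V X Y Z. open V \<and> V \<subseteq> fst \<kappa> \<and> smooth_on V X \<and> smooth_on V Y \<and> smooth_on V Z \<longrightarrow>
        (\<forall>q\<in>V. nabla_second_form (x \<circ> snd \<kappa>) (nabla \<kappa>) (\<sigma> \<circ> snd \<kappa>) X Y Z q = 0))"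

definition frame_form ::
  "(plane \<Rightarrow> real^4) \<Rightarrow> (plane \<Rightarrow> plane) \<Rightarrow> (plane \<Rightarrow> plane) \<Rightarrow>
     (plane \<Rightarrow> plane) \<Rightarrow> (plane \<Rightarrow> plane) \<Rightarrow> plane \<Rightarrow> real" where
  "frame_form f X\<^sub>1 X\<^sub>2 X Y q = 1/2 *
     (det4 (push f X\<^sub>1 q) (push f X\<^sub>2 q) (dirder X\<^sub>1 (push f X) q) (dirder X\<^sub>2 (push f Y) q)
    + det4 (push f X\<^sub>1 q) (push f X\<^sub>2 q) (dirder X\<^sub>1 (push f Y) q) (dirder X\<^sub>2 (push f X) q))"

text \<open>The rank of a bilinear form is that of its matrix in the basis \<open>X\<^sub>1 q, X\<^sub>2 q\<close>.\<close>
definition one_degenerate :: "'m chart set \<Rightarrow> ('m \<Rightarrow> real^4) \<Rightarrow> bool" where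
  "one_degenerate \<A> x \<longleftrightarrow>
     (\<forall>\<kappa>\<in>\<A>. \<forall>V X\<^sub>1 X\<^sub>2. open V \<and> V \<subseteq> fst \<kappa> \<and> smooth_on V X\<^sub>1 \<and> smooth_on V X\<^sub>2 \<and>
        (\<forall>q\<in>V. X\<^sub>1 q \<noteq> X\<^sub>2 q \<and> independent {X\<^sub>1 q, X\<^sub>2 q}) \<longrightarrow>
        (\<forall>q\<in>V. let h = frame_form (x \<circ> snd \<kappa>) X\<^sub>1 X\<^sub>2 in
           rank (vector [vector [h X\<^sub>1 X\<^sub>1 q, h X\<^sub>1 X\<^sub>2 q],
                         vector [h X\<^sub>2 X\<^sub>1 q, h X\<^sub>2 X\<^sub>2 q]] :: real^2^2) = 1))"

definition ruled_surface ::
  "'m::{t2_space,second_countable_topology} chart set \<Rightarrow> ('m \<Rightarrow> real^4) \<Rightarrow> bool" where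
  "ruled_surface \<A> x \<longleftrightarrow>
     (\<forall>p\<in>points \<A>. \<exists>u\<^sub>0 u\<^sub>1 v\<^sub>0 v\<^sub>1 \<psi> \<alpha> \<beta>.
        local_coordinates \<A> ({u\<^sub>0<..<u\<^sub>1} \<times> {v\<^sub>0<..<v\<^sub>1}, \<psi>) \<and>
        p \<in> \<psi> ` ({u\<^sub>0<..<u\<^sub>1} \<times> {v\<^sub>0<..<v\<^sub>1}) \<and>
        smooth_on {u\<^sub>0<..<u\<^sub>1} \<alpha> \<and> smooth_on {u\<^sub>0<..<u\<^sub>1} \<beta> \<and>
        (\<forall>u\<in>{u\<^sub>0<..<u\<^sub>1}. \<forall>v\<in>{v\<^sub>0<..<v\<^sub>1}. x (\<psi> (u, v)) = \<alpha> u + v *\<^sub>R \<beta> u))"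


section \<open>The normal forms\<close>

text \<open>Here \<open>y\<close> is the immersion and \<open>S\<close> the transversal bundle in coordinates
  \<open>(u, v) \<in> I \<times> J\<close>, for open intervals \<open>I\<close> and \<open>J\<close>.\<close>

definition form_I1 ::
  "real set \<Rightarrow> real set \<Rightarrow> (plane \<Rightarrow> real^4) \<Rightarrow> (plane \<Rightarrow> (real^4) set) \<Rightarrow> bool" where
  "form_I1 I J y S \<longleftrightarrow> (\<exists>(\<gamma> :: real \<Rightarrow> real^4) (a :: real \<Rightarrow> real) b c.
     smooth_on I \<gamma> \<and> smooth_on I a \<and> smooth_on I b \<and> smooth_on I c \<and>
     (let G = (\<lambda>u. det4 (\<gamma> u) (der 1 \<gamma> u) (der 2 \<gamma> u) (der 3 \<gamma> u));
          L = (\<lambda>u. ln \<bar>G u\<bar>);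
          \<phi>11_1 = (\<lambda>u v. 1/3 * (der 1 L u + v));
          \<phi>11_2 = (\<lambda>u v. 1/3 * (b u - v * a u + v^2 * (der 1 L u + v)));
          \<phi>21_2 = (\<lambda>u v. - 1/6 * (der 1 L u + 4 * v))
      in
        (\<forall>u\<in>I. G u \<noteq> 0 \<and>
           der 4 \<gamma> u = der 1 L u *\<^sub>R der 3 \<gamma> u + a u *\<^sub>R der 2 \<gamma> u + b u *\<^sub>R der 1 \<gamma> u + c u *\<^sub>R \<gamma> u) \<and>
        (\<forall>u\<in>I. \<forall>v\<in>J.
           y (u, v) = der 1 \<gamma> u + v *\<^sub>R \<gamma> u \<and>
           S (u, v) = span
             {der 1 \<gamma> u - \<phi>21_2 u v *\<^sub>R \<gamma> u,
              der 3 \<gamma> u + (v - \<phi>11_1 u v) *\<^sub>R der 2 \<gamma> u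
                - (v * \<phi>11_1 u v) *\<^sub>R der 1 \<gamma> u - \<phi>11_2 u v *\<^sub>R \<gamma> u})))"

definition form_I2 ::
  "real set \<Rightarrow> real set \<Rightarrow> (plane \<Rightarrow> real^4) \<Rightarrow> (plane \<Rightarrow> (real^4) set) \<Rightarrow> bool" where
  "form_I2 I J y S \<longleftrightarrow> (\<exists>(\<epsilon> :: real) (\<gamma> :: real \<Rightarrow> real^4) (a :: real \<Rightarrow> real) b c.
     \<epsilon> \<in> {1, -1} \<and>
     smooth_on I \<gamma> \<and> smooth_on I a \<and> smooth_on I b \<and> smooth_on I c \<and>
     (let G = (\<lambda>u. det4 (\<gamma> u) (der 1 \<gamma> u) (der 2 \<gamma> u) (der 3 \<gamma> u));
          L = (\<lambda>u. ln \<bar>G u\<bar>);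
          lnc' = (\<lambda>u. der 1 c u / c u);
          lncL' = (\<lambda>u. der 1 c u / c u + der 1 L u);
          \<phi>11_1 = (\<lambda>u v. 1/3 * (lncL' u + v));
          \<phi>21_2 = (\<lambda>u v. - 1/6 * (lncL' u + 4 * v));
          \<phi>11_2 = (\<lambda>u v. 1/3 * (b u + der 1 a u - \<epsilon> * der 1 L u - (a u + \<epsilon>) * lnc' u
                     + v * (- der 2 L u + der 1 L u * lnc' u - a u - 2 * \<epsilon>)
                     + v^2 * lncL' u + v^3))
      in
        (\<forall>u\<in>I. G u \<noteq> 0 \<and> c u \<noteq> 0 \<and>
           der 4 \<gamma> u = der 1 L u *\<^sub>R der 3 \<gamma> u + a u *\<^sub>R der 2 \<gamma> u + b u *\<^sub>R der 1 \<gamma> u + c u *\<^sub>R \<gamma> u) \<and>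
        (\<forall>u\<in>I. \<forall>v\<in>J.
           y (u, v) = (\<epsilon> *\<^sub>R \<gamma> u + der 2 \<gamma> u) + v *\<^sub>R der 1 \<gamma> u \<and>
           S (u, v) = span
             {der 2 \<gamma> u - \<phi>21_2 u v *\<^sub>R der 1 \<gamma> u,
              (der 1 L u + v - \<phi>11_1 u v) *\<^sub>R der 3 \<gamma> u
                + (a u + \<epsilon> - v * \<phi>11_1 u v) *\<^sub>R der 2 \<gamma> u
                + (b u - \<epsilon> * \<phi>11_1 u v - \<phi>11_2 u v) *\<^sub>R der 1 \<gamma> u + c u *\<^sub>R \<gamma> u})))"

definition form_II ::
  "real set \<Rightarrow> real set \<Rightarrow> (plane \<Rightarrow> real^4) \<Rightarrow> (plane \<Rightarrow> (real^4) set) \<Rightarrow> bool" where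
  "form_II I J y S \<longleftrightarrow> (\<exists>(\<alpha> :: real \<Rightarrow> real^4) (\<beta> :: real \<Rightarrow> real^4) (a :: real \<Rightarrow> real) b c.
     smooth_on I \<alpha> \<and> smooth_on I \<beta> \<and> smooth_on I a \<and> smooth_on I b \<and> smooth_on I c \<and>
     (let \<Delta> = (\<lambda>u. det4 (der 2 \<alpha> u) (der 1 \<alpha> u) (der 1 \<beta> u) (\<beta> u));
          L = (\<lambda>u. ln \<bar>\<Delta> u\<bar>);
          \<phi>11_1 = (\<lambda>u v. 1/3 * der 1 L u);
          \<phi>11_2 = (\<lambda>u v. 1/3 * (b u - v * a u - v));
          \<phi>21_2 = (\<lambda>u v. - 1/6 * der 1 L u)
      in
        (\<forall>u\<in>I. \<Delta> u \<noteq> 0 \<and> der 2 \<beta> u = - \<beta> u \<and>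
           der 3 \<alpha> u = der 1 L u *\<^sub>R der 2 \<alpha> u + a u *\<^sub>R der 1 \<alpha> u + b u *\<^sub>R der 1 \<beta> u + c u *\<^sub>R \<beta> u) \<and>
        (\<forall>u\<in>I. \<forall>v\<in>J.
           y (u, v) = \<alpha> u + v *\<^sub>R \<beta> u \<and>
           S (u, v) = span
             {der 1 \<beta> u - \<phi>21_2 u v *\<^sub>R \<beta> u,
              der 2 \<alpha> u - \<phi>11_1 u v *\<^sub>R der 1 \<alpha> u
                - (v * \<phi>11_1 u v) *\<^sub>R der 1 \<beta> u - (v + \<phi>11_2 u v) *\<^sub>R \<beta> u})))"

end

theory Submission
  imports Defs
begin

text \<open>
  Since the form \<open>h\<^bsub>{X\<^sub>1,X\<^sub>2}\<^esub>\<close> has rank one, it has a smooth null direction \<open>Z\<close>, and two-dimensional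
  linear algebra in \<open>\<real>\<^sup>4\<close> modulo the tangent plane shows that \<open>Z\<close> is also asymptotic, \<open>h(Z,Z) = 0\<close>,
  while \<open>h(E,Z)\<close> does not vanish for \<open>E\<close> transversal to \<open>Z\<close>.  Differentiating \<open>h(Z,Z) = 0\<close> with
  \<open>\<nabla>h = 0\<close> gives \<open>h(\<nabla>\<^sub>X Z, Z) = 0\<close>, so \<open>\<nabla>\<^sub>X Z\<close> is a multiple of \<open>Z\<close> for every \<open>X\<close>
  (\<open>null_field\<close>, \<open>null_field_parallel\<close>).  Hence the direction of \<open>x\<^sub>* Z\<close> in projective space is constant
  exactly along \<open>Z\<close>.  An affine coordinate of this direction therefore serves as \<open>u\<close>, a coordinate of \<open>x\<close> as
  \<open>v\<close>, and in these coordinates \<open>x = \<alpha>(u) + v \<beta>(u)\<close> (\<open>ruled_coordinates\<close>); no flow has to be integrated.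

  In a ruled chart, \<open>\<nabla>h = 0\<close> becomes two congruences modulo the tangent plane,
  \<open>\<beta>'' = (2p + q) \<beta>'\<close> and \<open>x\<^sub>u\<^sub>u\<^sub>u = 3q x\<^sub>u\<^sub>u + 3r \<beta>'\<close>, where \<open>p, q, r\<close> are the remaining Christoffel symbols
  (\<open>ruled_structure_local\<close>).  They determine \<open>p, q, r\<close>, and thereby \<open>\<sigma>\<close>, from \<open>\<alpha>\<close> and \<open>\<beta>\<close>
  (\<open>ruled_structure_coeffs\<close>), and the first one says that
  \<open>\<beta>'' = f \<alpha>' + m \<beta>' + g \<beta>\<close> with functions \<open>f, m, g\<close> of \<open>u\<close> alone (\<open>ruled_chart_ode\<close>).

  What is left is to normalize this equation by the substitutions that preserve the rulings: a change of the
  parameter \<open>u\<close>, a rescaling of \<open>\<beta>\<close>, and adding a multiple of \<open>\<beta>\<close> to \<open>\<alpha>\<close> (\<open>ruled_chart_reparametrize\<close>).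
  Where \<open>f = 0\<close>, the curve \<open>\<beta>\<close> lies in a fixed plane and can be turned into a parametrized ellipse,
  \<open>\<beta>'' = -\<beta>\<close>, which is form II (\<open>normal_form_II\<close>).  Where \<open>f \<noteq> 0\<close>, one reaches \<open>\<beta>'' = \<alpha>' + K \<beta>\<close> without changing
  \<open>u\<close> (\<open>normalize_ruled_chart\<close>).  If \<open>K = 0\<close>, then \<open>\<alpha> = \<beta>'\<close> up to a translation, which is form I.1.  If
  \<open>K \<noteq> 0\<close>, then the new parameter \<open>\<integral>sqrt \<bar>K\<bar>\<close> turns \<open>K\<close> into its sign, which is \<open>-\<epsilon>\<close> in form I.2
  (\<open>normal_form_I2\<close>).  The points in whose neighbourhood \<open>f\<close>, and then \<open>K\<close>, either vanish identically
  or have no zero are dense.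
\<close>

section \<open>Calculus of smooth maps\<close>

lemma frechet_derivative_eqI:
  "(f has_derivative f') (at z) \<Longrightarrow> frechet_derivative f (at z) = f'"
  by (metis frechet_derivative_at)

lemma differentiable_imp_frechet:
  "f differentiable (at z) \<Longrightarrow> (f has_derivative frechet_derivative f (at z)) (at z)"
  by (simp add: frechet_derivative_works)

lemma frechet_derivative_cong_open:
  assumes "open U" "z \<in> U" "\<And>w. w \<in> U \<Longrightarrow> f w = g w"
  shows "frechet_derivative f (at z) = frechet_derivative g (at z)"
proof -
  have "(f has_derivative f') (at z) \<longleftrightarrow> (g has_derivative f') (at z)" for f'
    using has_derivative_transform_within_open[OF _ assms(1,2), of f f' UNIV g]
      has_derivative_transform_within_open[OF _ assms(1,2), of g f' UNIV f] assms(3) by metis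
  then show ?thesis by (simp add: frechet_derivative_def)
qed

lemma Ck_on_cong_imp:
  assumes "open U" "\<And>z. z \<in> U \<Longrightarrow> f z = g z" "Ck_on k U f"
  shows "Ck_on k U g"
  using assms(2,3)
proof (induction k arbitrary: f g)
  case 0
  then show ?case by (metis Ck_on.simps(1) continuous_on_cong)
next
  case (Suc k)
  have 1: "g differentiable (at z)" if "z \<in> U" for z
    using Suc.prems that has_derivative_transform_within_open[OF _ assms(1) that, of f _ UNIV g]
    unfolding differentiable_def by (metis Ck_on.simps(2) differentiable_def)
  have 2: "Ck_on k U (\<lambda>z. frechet_derivative g (at z) v)" for v
  proof (rule Suc.IH[of "\<lambda>z. frechet_derivative f (at z) v"])
    show "frechet_derivative f (at z) v = frechet_derivative g (at z) v" if "z \<in> U" for z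
      using frechet_derivative_cong_open[OF assms(1) that, of f g] Suc.prems(1) by simp
  qed (use Suc.prems in auto)
  show ?case using 1 2 by simp
qed

lemma Ck_on_Suc_imp: "Ck_on (Suc k) U f \<Longrightarrow> Ck_on k U f"
proof (induction k arbitrary: f)
  case 0
  then show ?case
    by (auto intro!: continuous_at_imp_continuous_on differentiable_imp_continuous_within)
next
  case (Suc k)
  then show ?case by (metis Ck_on.simps(2))
qed

lemma Ck_on_subset: "Ck_on k U f \<Longrightarrow> V \<subseteq> U \<Longrightarrow> Ck_on k V f"
  by (induction k arbitrary: f) (auto intro: continuous_on_subset)

lemma Ck_on_SucI:
  assumes "open U" "\<And>z. z \<in> U \<Longrightarrow> (f has_derivative f' z) (at z)"
    "\<And>v. Ck_on k U (\<lambda>z. f' z v)"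
  shows "Ck_on (Suc k) U f"
proof -
  have "Ck_on k U (\<lambda>z. frechet_derivative f (at z) v)" for v
    by (rule Ck_on_cong_imp[OF assms(1) _ assms(3)[of v]])
      (use frechet_derivative_eqI[OF assms(2)] in auto)
  then show ?thesis using assms(2) by (auto simp: differentiable_def)
qed

lemma Ck_on_const: "open U \<Longrightarrow> Ck_on k U (\<lambda>z. c)"
  by (induction k arbitrary: c) (auto intro!: Ck_on_SucI[where f'="\<lambda>_ _. 0"] simp del: Ck_on.simps(2))

lemma Ck_on_bounded_linear_compose:
  assumes "open U" "bounded_linear L"
  shows "Ck_on k U f \<Longrightarrow> Ck_on k U (\<lambda>z. L (f z))"
proof (induction k arbitrary: f)
  case 0
  then show ?case using assms by (auto intro: bounded_linear.continuous_on)
next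
  case (Suc k)
  show ?case
    by (rule Ck_on_SucI[OF assms(1), where f'="\<lambda>z v. L (frechet_derivative f (at z) v)"])
      (use Suc in \<open>auto intro!: bounded_linear.has_derivative[OF assms(2)] differentiable_imp_frechet\<close>)
qed

lemma Ck_on_add:
  assumes "open U"
  shows "Ck_on k U f \<Longrightarrow> Ck_on k U g \<Longrightarrow> Ck_on k U (\<lambda>z. f z + g z)"
proof (induction k arbitrary: f g)
  case 0
  then show ?case by (auto intro: continuous_intros)
next
  case (Suc k)
  show ?case
    by (rule Ck_on_SucI[OF assms(1), where
          f'="\<lambda>z v. frechet_derivative f (at z) v + frechet_derivative g (at z) v"])
      (use Suc in \<open>auto intro!: derivative_intros differentiable_imp_frechet\<close>)
qed

lemma Ck_on_bilinear:
  assumes "open U" "bounded_bilinear B"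
  shows "Ck_on k U f \<Longrightarrow> Ck_on k U g \<Longrightarrow> Ck_on k U (\<lambda>z. B (f z) (g z))"
proof (induction k arbitrary: f g)
  case 0
  then show ?case using bounded_bilinear.continuous_on[OF assms(2)] by simp
next
  case (Suc k)
  note fg = Ck_on_Suc_imp[OF Suc.prems(1)] Ck_on_Suc_imp[OF Suc.prems(2)]
  show ?case
    by (rule Ck_on_SucI[OF assms(1), where
          f'="\<lambda>z v. B (f z) (frechet_derivative g (at z) v) + B (frechet_derivative f (at z) v) (g z)"])
      (use Suc fg in \<open>auto intro!: bounded_bilinear.FDERIV[OF assms(2)] differentiable_imp_frechet
          Ck_on_add[OF assms(1)]\<close>)
qed

lemma Ck_on_sum:
  assumes "open U" "\<And>i. i \<in> A \<Longrightarrow> Ck_on k U (f i)"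
  shows "Ck_on k U (\<lambda>z. \<Sum>i\<in>A. f i z)"
  using assms(2)
  by (induction A rule: infinite_finite_induct) (auto intro!: Ck_on_const Ck_on_add assms(1))

lemma linear_euclidean_expand:
  fixes L :: "'a::euclidean_space \<Rightarrow> 'b::real_vector"
  assumes "linear L"
  shows "L x = (\<Sum>i\<in>Basis. (x \<bullet> i) *\<^sub>R L i)"
proof -
  have "L x = L (\<Sum>i\<in>Basis. (x \<bullet> i) *\<^sub>R i)" by (simp add: euclidean_representation)
  also have "\<dots> = (\<Sum>i\<in>Basis. (x \<bullet> i) *\<^sub>R L i)"
    by (simp add: linear_sum[OF assms] linear_cmul[OF assms])
  finally show ?thesis .
qed

text \<open>The derivative of \<open>g \<circ> f\<close> is expanded in the basis of the middle space, because a composition \<open>g'(f z) (f' z v)\<close>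
  in which the vector varies with \<open>z\<close> is not of the form that the recursion of \<^const>\<open>Ck_on\<close> speaks about.\<close>
lemma Ck_on_compose:
  fixes f :: "'a::real_normed_vector \<Rightarrow> 'b::euclidean_space"
  assumes "open U" "open V" "f ` U \<subseteq> V"
  shows "Ck_on k U f \<Longrightarrow> Ck_on k V g \<Longrightarrow> Ck_on k U (\<lambda>z. g (f z))"
proof (induction k arbitrary: g)
  case 0
  then show ?case using assms continuous_on_compose2[of V g U f] by auto
next
  case (Suc k)
  let ?f' = "\<lambda>z v. \<Sum>i\<in>Basis. (frechet_derivative f (at z) v \<bullet> i) *\<^sub>R frechet_derivative g (at (f z)) i"
  have 1: "((\<lambda>z. g (f z)) has_derivative ?f' z) (at z)" if z: "z \<in> U" for z
  proof -
    have f: "(f has_derivative frechet_derivative f (at z)) (at z)"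
      using Suc.prems(1) z by (auto intro: differentiable_imp_frechet)
    have "f z \<in> V" using assms(3) z by auto
    then have g: "(g has_derivative frechet_derivative g (at (f z))) (at (f z))"
      using Suc.prems(2) by (auto intro: differentiable_imp_frechet)
    have "frechet_derivative g (at (f z)) (frechet_derivative f (at z) v) = ?f' z v" for v
      by (rule linear_euclidean_expand) (use g in \<open>auto intro: has_derivative_linear\<close>)
    then show ?thesis using has_derivative_compose[OF f g] by simp
  qed
  have 2: "Ck_on k U (\<lambda>z. frechet_derivative g (at (f z)) i)" for i
    by (rule Suc.IH) (use Suc.prems in \<open>auto dest: Ck_on_Suc_imp simp del: Ck_on.simps\<close>, use Suc.prems in simp)
  show ?case
    by (rule Ck_on_SucI[OF assms(1), where f'="?f'"])
      (use 1 2 Suc.prems(1) in \<open>auto intro!: Ck_on_sum assms(1)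
        Ck_on_bilinear[OF assms(1) bounded_bilinear_scaleR]
        Ck_on_bounded_linear_compose[OF assms(1) bounded_linear_inner_left]\<close>)
qed

named_theorems smooth_intros

lemma smooth_on_cong:
  assumes "open U" "\<And>z. z \<in> U \<Longrightarrow> f z = g z" "smooth_on U f"
  shows "smooth_on U g"
  using assms Ck_on_cong_imp unfolding smooth_on_def by metis

lemma smooth_on_subset: "smooth_on U f \<Longrightarrow> V \<subseteq> U \<Longrightarrow> smooth_on V f"
  unfolding smooth_on_def by (metis Ck_on_subset)

lemma smooth_on_const [smooth_intros]: "open U \<Longrightarrow> smooth_on U (\<lambda>z. c)"
  by (simp add: smooth_on_def Ck_on_const)

lemma smooth_on_imp_differentiable: "smooth_on U f \<Longrightarrow> z \<in> U \<Longrightarrow> f differentiable (at z)"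
  unfolding smooth_on_def by (metis Ck_on.simps(2))

lemma smooth_on_has_derivative:
  "smooth_on U f \<Longrightarrow> z \<in> U \<Longrightarrow> (f has_derivative frechet_derivative f (at z)) (at z)"
  by (simp add: smooth_on_imp_differentiable differentiable_imp_frechet)

lemma smooth_on_continuous: "smooth_on U f \<Longrightarrow> continuous_on U f"
  unfolding smooth_on_def by (metis Ck_on.simps(1))

lemma smooth_on_frechet: "smooth_on U f \<Longrightarrow> smooth_on U (\<lambda>z. frechet_derivative f (at z) v)"
  unfolding smooth_on_def by (metis Ck_on.simps(2))

lemma smooth_onI:
  assumes "open U" "\<And>z. z \<in> U \<Longrightarrow> (f has_derivative f' z) (at z)"
    "\<And>v. smooth_on U (\<lambda>z. f' z v)"
  shows "smooth_on U f"
proof -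
  have "Ck_on k U f" for k
    using Ck_on_Suc_imp[OF Ck_on_SucI[OF assms(1,2)]] assms(3) unfolding smooth_on_def by blast
  then show ?thesis by (simp add: smooth_on_def)
qed

lemma smooth_on_bounded_linear_compose:
  "open U \<Longrightarrow> bounded_linear L \<Longrightarrow> smooth_on U f \<Longrightarrow> smooth_on U (\<lambda>z. L (f z))"
  by (simp add: smooth_on_def Ck_on_bounded_linear_compose)

lemma smooth_on_id [smooth_intros]: "open U \<Longrightarrow> smooth_on U (\<lambda>z. z)"
  by (rule smooth_onI[where f'="\<lambda>z v. v"]) (auto intro: smooth_on_const)

lemma smooth_on_add [smooth_intros]:
  "open U \<Longrightarrow> smooth_on U f \<Longrightarrow> smooth_on U g \<Longrightarrow> smooth_on U (\<lambda>z. f z + g z)"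
  by (simp add: smooth_on_def Ck_on_add)

lemma smooth_on_bilinear:
  "open U \<Longrightarrow> bounded_bilinear B \<Longrightarrow> smooth_on U f \<Longrightarrow> smooth_on U g \<Longrightarrow> smooth_on U (\<lambda>z. B (f z) (g z))"
  by (simp add: smooth_on_def Ck_on_bilinear)

lemma smooth_on_sum [smooth_intros]:
  "open U \<Longrightarrow> (\<And>i. i \<in> A \<Longrightarrow> smooth_on U (f i)) \<Longrightarrow> smooth_on U (\<lambda>z. \<Sum>i\<in>A. f i z)"
  by (simp add: smooth_on_def Ck_on_sum)

lemma smooth_on_compose:
  fixes f :: "'a::real_normed_vector \<Rightarrow> 'b::euclidean_space"
  assumes "smooth_on V g" "smooth_on U f" "open U" "open V" "f ` U \<subseteq> V"
  shows "smooth_on U (\<lambda>z. g (f z))"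
  using assms(1,2) Ck_on_compose[OF assms(3,4,5)] unfolding smooth_on_def by blast

lemmas smooth_on_scaleR [smooth_intros] = smooth_on_bilinear[OF _ bounded_bilinear_scaleR]
lemmas smooth_on_inner [smooth_intros] = smooth_on_bilinear[OF _ bounded_bilinear_inner]
lemma smooth_on_mult [smooth_intros]:
  fixes f g :: "_ \<Rightarrow> real"
  shows "open U \<Longrightarrow> smooth_on U f \<Longrightarrow> smooth_on U g \<Longrightarrow> smooth_on U (\<lambda>z. f z * g z)"
  by (rule smooth_on_bilinear[OF _ bounded_bilinear_mult])
lemmas smooth_on_minus [smooth_intros] = smooth_on_bounded_linear_compose[OF _ bounded_linear_minus[OF bounded_linear_ident]]
lemmas smooth_on_nth [smooth_intros] = smooth_on_bounded_linear_compose[OF _ bounded_linear_vec_nth]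
lemmas smooth_on_fst [smooth_intros] = smooth_on_bounded_linear_compose[OF _ bounded_linear_fst]
lemmas smooth_on_snd [smooth_intros] = smooth_on_bounded_linear_compose[OF _ bounded_linear_snd]

lemma smooth_on_diff [smooth_intros]:
  assumes "open U" "smooth_on U f" "smooth_on U g" shows "smooth_on U (\<lambda>z. f z - g z)"
  using smooth_on_add[OF assms(1,2) smooth_on_minus[OF assms(1,3)]] by simp

lemma smooth_on_Pair [smooth_intros]:
  assumes "open U" "smooth_on U f" "smooth_on U g"
  shows "smooth_on U (\<lambda>z. (f z, g z))"
proof (rule smooth_onI[OF assms(1), where
      f'="\<lambda>z v. (frechet_derivative f (at z) v, frechet_derivative g (at z) v)"])
  have split: "(\<lambda>z. (p z, q z)) = (\<lambda>z. (p z, 0) + (0, q z))"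
    for p :: "'a \<Rightarrow> 'b" and q :: "'a \<Rightarrow> 'c" by simp
  fix v show "smooth_on U (\<lambda>z. (frechet_derivative f (at z) v, frechet_derivative g (at z) v))"
    unfolding split[of "\<lambda>z. frechet_derivative f (at z) v"]
    by (intro smooth_on_add assms smooth_on_frechet
        smooth_on_bounded_linear_compose[where L="\<lambda>x. (x,0)"]
        smooth_on_bounded_linear_compose[where L="\<lambda>x. (0,x)"] bounded_linear_Pair
        bounded_linear_ident bounded_linear_zero)
qed (use assms in \<open>auto intro!: has_derivative_Pair smooth_on_has_derivative\<close>)

lemma smooth_on_frechet_field [smooth_intros]:
  fixes X :: "'a::euclidean_space \<Rightarrow> 'a"
  assumes "open U" "smooth_on U f" "smooth_on U X"
  shows "smooth_on U (\<lambda>z. frechet_derivative f (at z) (X z))"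
proof (rule smooth_on_cong[OF assms(1)])
  show "smooth_on U (\<lambda>z. \<Sum>i\<in>Basis. (X z \<bullet> i) *\<^sub>R frechet_derivative f (at z) i)"
    by (intro smooth_intros assms smooth_on_frechet)
  show "(\<Sum>i\<in>Basis. (X z \<bullet> i) *\<^sub>R frechet_derivative f (at z) i) = frechet_derivative f (at z) (X z)"
    if "z \<in> U" for z
    using linear_euclidean_expand[of "frechet_derivative f (at z)"]
      has_derivative_linear[OF smooth_on_has_derivative[OF assms(2) that]] by metis
qed

lemma Ck_on_inverse_real: "Ck_on k {x::real. x \<noteq> 0} inverse"
proof (induction k)
  case 0
  then show ?case by (auto intro!: continuous_intros)
next
  case (Suc k)
  have o: "open {x::real. x \<noteq> 0}" by (simp add: open_Collect_neq)
  have "Ck_on k {x::real. x \<noteq> 0} (\<lambda>z. - (inverse z * v * inverse z))" for v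
    by (intro Ck_on_bounded_linear_compose[OF o bounded_linear_minus[OF bounded_linear_ident]]
        Ck_on_bilinear[OF o bounded_bilinear_mult] Suc Ck_on_const[OF o])
  then show ?case
    by (intro Ck_on_SucI[OF o, where f'="\<lambda>x v. - (inverse x * v * inverse x)"] has_derivative_inverse') auto
qed

lemma smooth_on_inverse [smooth_intros]:
  fixes f :: "'a::real_normed_vector \<Rightarrow> real"
  assumes "open U" "smooth_on U f" "\<And>z. z \<in> U \<Longrightarrow> f z \<noteq> 0"
  shows "smooth_on U (\<lambda>z. inverse (f z))"
proof (rule smooth_on_compose[of "{x. x \<noteq> 0}" inverse])
  show "smooth_on {x::real. x \<noteq> 0} inverse" by (simp add: smooth_on_def Ck_on_inverse_real)
  show "open {x::real. x \<noteq> 0}" by (simp add: open_Collect_neq)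
qed (use assms in auto)

lemma smooth_on_divide [smooth_intros]:
  fixes f g :: "'a::real_normed_vector \<Rightarrow> real"
  assumes "open U" "smooth_on U f" "smooth_on U g" "\<And>z. z \<in> U \<Longrightarrow> g z \<noteq> 0"
  shows "smooth_on U (\<lambda>z. f z / g z)"
  using smooth_on_mult[OF assms(1,2) smooth_on_inverse[OF assms(1,3,4)]] by (simp add: divide_inverse)

lemma smooth_on_power [smooth_intros]:
  fixes f :: "'a::real_normed_vector \<Rightarrow> real"
  assumes "open U" "smooth_on U f"
  shows "smooth_on U (\<lambda>z. f z ^ n)"
  by (induction n) (auto intro!: smooth_intros assms)

lemma Ck_on_sqrt: "Ck_on k {0<..} sqrt"
proof (induction k)
  case 0
  then show ?case by (auto intro!: continuous_intros)
next
  case (Suc k)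
  have o: "open {0::real<..}" by simp
  have n: "Ck_on k {x::real. x \<noteq> 0} inverse" by (rule Ck_on_inverse_real)
  have "Ck_on k {0<..} (\<lambda>z. inverse (sqrt z))"
    by (rule Ck_on_compose[OF o _ _ Suc n]) (auto simp: open_Collect_neq)
  then have 1: "Ck_on k {0<..} (\<lambda>z. (inverse (sqrt z) * (1/2)) * v)" for v
    by (intro Ck_on_bilinear[OF o bounded_bilinear_mult] Ck_on_const[OF o])
  have 2: "(sqrt has_derivative (*) (inverse (sqrt z) * (1/2))) (at z)" if "z \<in> {0<..}" for z
    using DERIV_real_sqrt[of z] that by (simp add: has_field_derivative_def)
  show ?case by (rule Ck_on_SucI[OF o 2 1])
qed

lemma smooth_on_sqrt [smooth_intros]:
  fixes f :: "'a::real_normed_vector \<Rightarrow> real"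
  assumes "open U" "smooth_on U f" "\<And>z. z \<in> U \<Longrightarrow> 0 < f z"
  shows "smooth_on U (\<lambda>z. sqrt (f z))"
  by (rule smooth_on_compose[of "{0<..}" sqrt]) (use assms in \<open>auto simp: smooth_on_def Ck_on_sqrt\<close>)

lemma smooth_on_arctan [smooth_intros]:
  fixes f :: "'a::real_normed_vector \<Rightarrow> real"
  assumes "open U" "smooth_on U f"
  shows "smooth_on U (\<lambda>z. arctan (f z))"
proof (rule smooth_on_compose[of UNIV arctan])
  have nz: "1 + x\<^sup>2 \<noteq> 0" for x :: real by (metis add_pos_nonneg less_irrefl zero_le_power2 zero_less_one)
  show "smooth_on UNIV arctan"
  proof (rule smooth_onI[where f'="\<lambda>x v. inverse (1 + x\<^sup>2) * v"])
    show "(arctan has_derivative (*) (inverse (1 + z\<^sup>2))) (at z)" for z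
      using DERIV_arctan[of z] by (simp add: has_field_derivative_def)
    show "smooth_on UNIV (\<lambda>z. inverse (1 + z\<^sup>2) * v)" for v :: real
      by (intro smooth_intros) (auto simp: nz)
  qed simp
qed (use assms in auto)

section \<open>Symmetry of the second derivative\<close>

definition D2 :: "('a::real_normed_vector \<Rightarrow> 'b::real_normed_vector) \<Rightarrow> 'a \<Rightarrow> 'a \<Rightarrow> 'a \<Rightarrow> 'b" where
  "D2 f q a b = frechet_derivative (\<lambda>z. frechet_derivative f (at z) b) (at q) a"

text \<open>The second difference over a small parallelogram is symmetric in \<open>a\<close> and \<open>b\<close>; two applications of the
  mean value theorem turn it into a value of the second derivative in either order, which is the source of symmetry.\<close>
lemma second_difference_mean_value:
  fixes f :: "'a::real_normed_vector \<Rightarrow> real"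
  assumes "smooth_on U f" "0 < h"
    and inU: "\<And>s t. 0 \<le> s \<Longrightarrow> s \<le> h \<Longrightarrow> 0 \<le> t \<Longrightarrow> t \<le> h \<Longrightarrow> q + s *\<^sub>R a + t *\<^sub>R b \<in> U"
  shows "\<exists>s t. 0 < s \<and> s < h \<and> 0 < t \<and> t < h \<and>
    f (q + h *\<^sub>R a + h *\<^sub>R b) - f (q + h *\<^sub>R a) - f (q + h *\<^sub>R b) + f q = h * h * D2 f (q + s *\<^sub>R a + t *\<^sub>R b) b a"
proof -
  have line: "((\<lambda>s. g (p + s *\<^sub>R d)) has_real_derivative frechet_derivative g (at (p + s *\<^sub>R d)) d) (at s)"
    if "smooth_on U g" "p + s *\<^sub>R d \<in> U" for g :: "'a \<Rightarrow> real" and p d s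
  proof -
    have g: "(g has_derivative frechet_derivative g (at (p + s *\<^sub>R d))) (at (p + s *\<^sub>R d))"
      using that by (rule smooth_on_has_derivative)
    have "((\<lambda>s. g (p + s *\<^sub>R d)) has_derivative (\<lambda>t. frechet_derivative g (at (p + s *\<^sub>R d)) (t *\<^sub>R d))) (at s)"
      by (rule has_derivative_compose[where g=g and f="\<lambda>s. p + s *\<^sub>R d", OF _ g])
        (auto intro!: derivative_eq_intros)
    then show ?thesis
      using linear_cmul[OF has_derivative_linear[OF g]]
      by (simp add: has_field_derivative_def mult.commute[of _ "frechet_derivative g (at (p + s *\<^sub>R d)) d"])
  qed
  let ?g = "\<lambda>z. frechet_derivative f (at z) a"
  have "\<exists>s>0. s < h \<and> (f ((q + h *\<^sub>R b) + h *\<^sub>R a) - f (q + h *\<^sub>R a)) - (f ((q + h *\<^sub>R b) + 0 *\<^sub>R a) - f (q + 0 *\<^sub>R a))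
      = (h - 0) * (?g ((q + h *\<^sub>R b) + s *\<^sub>R a) - ?g (q + s *\<^sub>R a))"
  proof (rule MVT2[OF \<open>0 < h\<close>])
    fix s assume "0 \<le> s" "s \<le> h"
    then show "((\<lambda>s. f ((q + h *\<^sub>R b) + s *\<^sub>R a) - f (q + s *\<^sub>R a)) has_real_derivative
        ?g ((q + h *\<^sub>R b) + s *\<^sub>R a) - ?g (q + s *\<^sub>R a)) (at s)"
      using inU[of s 0] inU[of s h] \<open>0 < h\<close>
      by (intro DERIV_diff line assms) (simp_all add: add.assoc add.commute[of "h *\<^sub>R b"])
  qed
  then obtain s where s: "0 < s" "s < h"
    "f (q + h *\<^sub>R a + h *\<^sub>R b) - f (q + h *\<^sub>R a) - f (q + h *\<^sub>R b) + f q
      = h * (?g ((q + s *\<^sub>R a) + h *\<^sub>R b) - ?g ((q + s *\<^sub>R a) + 0 *\<^sub>R b))"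
    by (auto simp: algebra_simps)
  have "\<exists>t>0. t < h \<and> ?g ((q + s *\<^sub>R a) + h *\<^sub>R b) - ?g ((q + s *\<^sub>R a) + 0 *\<^sub>R b)
      = (h - 0) * D2 f (q + s *\<^sub>R a + t *\<^sub>R b) b a"
    unfolding D2_def
    by (rule MVT2[OF \<open>0 < h\<close>]) (use s inU[of s] in \<open>auto intro!: line smooth_on_frechet[OF assms(1)]\<close>)
  then show ?thesis using s by (metis diff_zero mult.assoc)
qed

lemma D2_symmetric_real:
  fixes f :: "'a::real_normed_vector \<Rightarrow> real"
  assumes "open U" "smooth_on U f" "q \<in> U"
  shows "D2 f q a b = D2 f q b a"
proof (rule ccontr)
  assume ne: "D2 f q a b \<noteq> D2 f q b a"
  \<comment> \<open>By continuity, both second derivatives move by less than half of their distance on a small ball.\<close>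
  define e where "e = \<bar>D2 f q a b - D2 f q b a\<bar> / 2"
  have e: "0 < e" using ne by (simp add: e_def)
  have cont: "\<exists>d>0. \<forall>z. dist z q < d \<longrightarrow> \<bar>D2 f z a b - D2 f q a b\<bar> < e" for a b
  proof -
    have "continuous_on U (\<lambda>z. D2 f z a b)"
      unfolding D2_def by (intro smooth_on_continuous smooth_on_frechet assms)
    then have "continuous (at q) (\<lambda>z. D2 f z a b)"
      using assms continuous_on_eq_continuous_at by blast
    then show ?thesis using e unfolding continuous_at_eps_delta by (simp add: dist_real_def)
  qed
  obtain d1 where d1: "0 < d1" "\<And>z. dist z q < d1 \<Longrightarrow> \<bar>D2 f z a b - D2 f q a b\<bar> < e" using cont by metis
  obtain d2 where d2: "0 < d2" "\<And>z. dist z q < d2 \<Longrightarrow> \<bar>D2 f z b a - D2 f q b a\<bar> < e" using cont by metis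
  obtain d3 where d3: "0 < (d3::real)" "ball q d3 \<subseteq> U" using assms open_contains_ball by metis
  define d where "d = min d1 (min d2 d3)"
  define h where "h = d / (norm a + norm b + 1)"
  have pos: "0 < norm a + norm b + 1" by (smt (verit) norm_ge_zero)
  have dpos: "0 < d" using d1(1) d2(1) assms(3) d3 by (simp add: d_def)
  have h: "0 < h" using dpos pos by (simp add: h_def)
  have close: "dist (q + s *\<^sub>R a + t *\<^sub>R b) q < d" if ab: "norm a + norm b + 1 = d / h" and that: "0 \<le> s" "s \<le> h" "0 \<le> t" "t \<le> h"
    for s t and a b :: 'a
  proof -
    have "dist (q + s *\<^sub>R a + t *\<^sub>R b) q = norm (s *\<^sub>R a + t *\<^sub>R b)" by (simp add: dist_norm)
    also have "\<dots> \<le> s * norm a + t * norm b"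
      using norm_triangle_ineq[of "s *\<^sub>R a" "t *\<^sub>R b"] that by simp
    also have "\<dots> \<le> h * norm a + h * norm b" using that by (intro add_mono mult_right_mono) auto
    also have "\<dots> < h * (norm a + norm b + 1)" using h by (simp add: algebra_simps)
    also have "\<dots> = d" unfolding ab using h by (metis less_irrefl nonzero_mult_div_cancel_left times_divide_eq_right)
    finally show ?thesis .
  qed
  have dh: "norm a + norm b + 1 = d / h" using dpos pos by (simp add: h_def)
  have dh': "norm b + norm a + 1 = d / h" using dh by simp
  have inU: "q + s *\<^sub>R a + t *\<^sub>R b \<in> U" if "0 \<le> s" "s \<le> h" "0 \<le> t" "t \<le> h"
    "norm a + norm b + 1 = d / h" for s t and a b :: 'a
    using close[OF that(5) that(1-4)] d3 by (force simp: d_def dist_commute)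
  obtain s t where st: "0 < s" "s < h" "0 < t" "t < h"
    "f (q + h *\<^sub>R a + h *\<^sub>R b) - f (q + h *\<^sub>R a) - f (q + h *\<^sub>R b) + f q = h * h * D2 f (q + s *\<^sub>R a + t *\<^sub>R b) b a"
    using second_difference_mean_value[OF assms(2) h inU[OF _ _ _ _ dh]] by blast
  obtain s' t' where st': "0 < s'" "s' < h" "0 < t'" "t' < h"
    "f (q + h *\<^sub>R b + h *\<^sub>R a) - f (q + h *\<^sub>R b) - f (q + h *\<^sub>R a) + f q = h * h * D2 f (q + s' *\<^sub>R b + t' *\<^sub>R a) a b"
    using second_difference_mean_value[OF assms(2) h inU[OF _ _ _ _ dh']] by blast
  have "q + h *\<^sub>R b + h *\<^sub>R a = q + h *\<^sub>R a + h *\<^sub>R b" by simp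
  from st'(5)[unfolded this]
  have "h * h * D2 f (q + s *\<^sub>R a + t *\<^sub>R b) b a = h * h * D2 f (q + s' *\<^sub>R b + t' *\<^sub>R a) a b"
    using st(5) by linarith
  then have "D2 f (q + s *\<^sub>R a + t *\<^sub>R b) b a = D2 f (q + s' *\<^sub>R b + t' *\<^sub>R a) a b" using h by simp
  moreover have "dist (q + s *\<^sub>R a + t *\<^sub>R b) q < d2" "dist (q + s' *\<^sub>R b + t' *\<^sub>R a) q < d1"
    using close[OF dh, of s t] close[OF dh', of s' t'] st st' by (auto simp: d_def)
  ultimately show False
    using d1(2)[of "q + s' *\<^sub>R b + t' *\<^sub>R a"] d2(2)[of "q + s *\<^sub>R a + t *\<^sub>R b"]
    unfolding e_def by (simp add: abs_if split: if_splits)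
qed

lemma D2_symmetric:
  fixes f :: "'a::real_normed_vector \<Rightarrow> 'b::euclidean_space"
  assumes "open U" "smooth_on U f" "q \<in> U"
  shows "D2 f q a b = D2 f q b a"
proof (rule euclidean_eqI)
  fix i :: 'b assume "i \<in> Basis"
  have L: "bounded_linear (\<lambda>x::'b. x \<bullet> i)" by (rule bounded_linear_inner_left)
  have fd: "frechet_derivative (\<lambda>z. g z \<bullet> i) (at z) v = frechet_derivative g (at z) v \<bullet> i"
    if "smooth_on U g" "z \<in> U" for g :: "'a \<Rightarrow> 'b" and z v
    using frechet_derivative_eqI[OF bounded_linear.has_derivative[OF L smooth_on_has_derivative[OF that]]] by simp
  have "D2 (\<lambda>z. f z \<bullet> i) q a b = D2 f q a b \<bullet> i" for a b
  proof -
    have "D2 (\<lambda>z. f z \<bullet> i) q a b = frechet_derivative (\<lambda>z. frechet_derivative f (at z) b \<bullet> i) (at q) a"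
      unfolding D2_def
      using frechet_derivative_cong_open[OF assms(1,3), of "\<lambda>z. frechet_derivative (\<lambda>z. f z \<bullet> i) (at z) b"
          "\<lambda>z. frechet_derivative f (at z) b \<bullet> i"] fd[OF assms(2)] by simp
    then show ?thesis using fd[OF smooth_on_frechet[OF assms(2)] assms(3)] by (simp add: D2_def)
  qed
  then show "D2 f q a b \<bullet> i = D2 f q b a \<bullet> i"
    using D2_symmetric_real[OF assms(1) smooth_on_bounded_linear_compose[OF assms(1) L assms(2)] assms(3)] by metis
qed

section \<open>Curves\<close>

lemma der_0 [simp]: "der 0 c = c" by (simp add: der_def)

lemma der_Suc: "der (Suc k) c u = vector_derivative (der k c) (at u)"
  by (simp add: der_def)

lemma der_1: "der 1 c u = vector_derivative c (at u)"
  by (simp add: der_def)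

lemma der_1_eqI: "(c has_vector_derivative d) (at u) \<Longrightarrow> der 1 c u = d"
  unfolding der_1 by (rule vector_derivative_at)

lemma smooth_on_has_vector_derivative:
  assumes "smooth_on I c" "u \<in> I"
  shows "(c has_vector_derivative der 1 c u) (at u)"
  using smooth_on_imp_differentiable[OF assms]
  unfolding der_1 by (simp add: vector_derivative_works[symmetric])

lemma smooth_on_curveI:
  assumes "open I" "\<And>u. u \<in> I \<Longrightarrow> (c has_vector_derivative c' u) (at u)" "smooth_on I c'"
  shows "smooth_on I c"
  by (rule smooth_onI[OF assms(1), where f'="\<lambda>u v. v *\<^sub>R c' u"])
    (use assms in \<open>auto simp: has_vector_derivative_def[symmetric] intro!: smooth_intros\<close>)

lemma smooth_on_der [smooth_intros]:
  assumes "open I" "smooth_on I c"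
  shows "smooth_on I (der k c)"
proof (induction k)
  case (Suc k)
  show ?case
  proof (rule smooth_on_cong[OF assms(1) _ smooth_on_frechet[OF Suc, of 1]])
    fix u assume "u \<in> I"
    then have "(der k c has_derivative (\<lambda>v. v *\<^sub>R der 1 (der k c) u)) (at u)"
      using smooth_on_has_vector_derivative[OF Suc] by (simp add: has_vector_derivative_def)
    then show "frechet_derivative (der k c) (at u) 1 = der (Suc k) c u"
      by (simp add: frechet_derivative_eqI der_1 der_Suc)
  qed
qed (use assms in simp)

lemma smooth_on_der_has_vector_derivative:
  assumes "open I" "smooth_on I c" "u \<in> I"
  shows "(der k c has_vector_derivative der (Suc k) c u) (at u)"
  using smooth_on_has_vector_derivative[OF smooth_on_der[OF assms(1,2)] assms(3)]
  by (simp add: der_1 der_Suc)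

text \<open>Needed because \<^const>\<open>der\<close> takes iterated derivatives of total functions: equality on an open set suffices.\<close>
lemma der_cong_open:
  assumes "open I" "\<And>u. u \<in> I \<Longrightarrow> c u = d u"
  shows "u \<in> I \<Longrightarrow> der k c u = der k d u"
proof (induction k arbitrary: u)
  case (Suc k)
  have "(der k c has_vector_derivative f) (at u) \<longleftrightarrow> (der k d has_vector_derivative f) (at u)" for f
    using Suc.IH has_vector_derivative_transform_within_open[OF _ assms(1) Suc.prems] by metis
  then show ?case by (simp add: der_Suc vector_derivative_def)
qed (use assms in simp)

lemma smooth_antiderivative:
  fixes f :: "real \<Rightarrow> real"
  assumes "open I" "smooth_on I f" "u0 \<in> I"
  obtains a b F where "u0 \<in> {a<..<b}" "{a<..<b} \<subseteq> I" "smooth_on {a<..<b} F"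
    "\<And>u. u \<in> {a<..<b} \<Longrightarrow> (F has_vector_derivative f u) (at u)"
proof -
  obtain e where e: "0 < e" "cball u0 e \<subseteq> I" using assms open_contains_cball by metis
  then have sub: "{u0 - e..u0 + e} \<subseteq> I" by (simp add: cball_eq_atLeastAtMost)
  have "continuous_on {u0 - e..u0 + e} f"
    using smooth_on_continuous[OF assms(2)] sub continuous_on_subset by blast
  then obtain F where F: "\<And>u. u \<in> {u0 - e..u0 + e} \<Longrightarrow> (F has_vector_derivative f u) (at u within {u0 - e..u0 + e})"
    using antiderivative_continuous by blast
  have F': "(F has_vector_derivative f u) (at u)" if "u \<in> {u0 - e<..<u0 + e}" for u
  proof -
    have "u \<in> interior {u0 - e..u0 + e}" using that by simp
    then show ?thesis using F[of u] that at_within_interior[of u "{u0 - e..u0 + e}"] by auto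
  qed
  have "smooth_on {u0 - e<..<u0 + e} F"
    by (rule smooth_on_curveI[OF _ F']) (use sub in \<open>auto intro!: smooth_on_subset[OF assms(2)]\<close>)
  then show ?thesis using F' e(1) sub by (intro that[of "u0 - e" "u0 + e" F]) auto
qed

section \<open>Smooth local inverses\<close>

text \<open>A solution of the autonomous system \<open>g' = C \<circ> g\<close> inherits the smoothness of \<open>C\<close>; the
  derivative of an inverse function has this form.\<close>
lemma smooth_on_autonomous:
  fixes g :: "'a::real_normed_vector \<Rightarrow> 'b::euclidean_space"
  assumes "open V" "open U" "g ` V \<subseteq> U"
    and der: "\<And>y. y \<in> V \<Longrightarrow> (g has_derivative (\<lambda>v. C v (g y))) (at y)"
    and C: "\<And>v. smooth_on U (C v)"
  shows "smooth_on V g"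
proof -
  have "Ck_on k V g" for k
  proof (induction k)
    case 0
    show ?case using der by (auto intro!: continuous_at_imp_continuous_on has_derivative_continuous)
  next
    case (Suc k)
    show ?case
      by (rule Ck_on_SucI[OF assms(1) der])
        (use C in \<open>auto simp: smooth_on_def intro!: Ck_on_compose[OF assms(1-3) Suc]\<close>)
  qed
  then show ?thesis by (simp add: smooth_on_def)
qed

lemma local_inverse:
  fixes f :: "'a::euclidean_space \<Rightarrow> 'a"
  assumes "open U" "smooth_on U f" "q0 \<in> U" "inj (frechet_derivative f (at q0))"
  obtains U' V g where "open U'" "U' \<subseteq> U" "q0 \<in> U'" "open V" "homeomorphism U' V f g"
    "\<And>y. y \<in> V \<Longrightarrow> (g has_derivative inv (frechet_derivative f (at (g y)))) (at y)"
    "\<And>y. y \<in> V \<Longrightarrow> bij (frechet_derivative f (at (g y)))"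
proof -
  let ?f' = "\<lambda>x. Blinfun (frechet_derivative f (at x))"
  have bl: "bounded_linear (frechet_derivative f (at x))" if "x \<in> U" for x
    using smooth_on_has_derivative[OF assms(2) that] by (rule has_derivative_bounded_linear)
  have app: "blinfun_apply (?f' x) = frechet_derivative f (at x)" if "x \<in> U" for x
    using bounded_linear_Blinfun_apply[OF bl[OF that]] .
  have "continuous_on U (\<lambda>x. blinfun_apply (?f' x) i)" for i
    using smooth_on_continuous[OF smooth_on_frechet[OF assms(2)]] app by (simp cong: continuous_on_cong)
  then have cont: "continuous_on U ?f'" by (intro continuous_on_blinfun_componentwise)
  let ?L = "frechet_derivative f (at q0)"
  have lin: "linear ?L" using bl[OF assms(3)] by (rule bounded_linear.linear)
  have lini: "linear (inv ?L)" using lin assms(4) by (simp add: inj_linear_imp_inv_linear)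
  have inv: "Blinfun (inv ?L) o\<^sub>L ?f' q0 = id_blinfun"
    by (rule blinfun_eqI)
      (use lini assms(4) in \<open>simp add: app[OF assms(3)] bounded_linear_Blinfun_apply linear_conv_bounded_linear\<close>)
  obtain U' V g g' where *: "open U'" "U' \<subseteq> U" "q0 \<in> U'" "open V" "f q0 \<in> V" "homeomorphism U' V f g"
    "\<And>y. y \<in> V \<Longrightarrow> (g has_derivative (g' y)) (at y)"
    "\<And>y. y \<in> V \<Longrightarrow> g' y = inv (blinfun_apply (?f'(g y)))"
    "\<And>y. y \<in> V \<Longrightarrow> bij (blinfun_apply (?f'(g y)))"
    using inverse_function_theorem[OF assms(1) _ cont assms(3) inv, of f]
      smooth_on_has_derivative[OF assms(2)] app by (metis (no_types, lifting))
  have "g y \<in> U" if "y \<in> V" for y using * that by (auto simp: homeomorphism_def)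
  then show ?thesis using that[OF *(1-4,6)] *(7-9) app by metis
qed

lemma smooth_local_inverse_real:
  fixes s :: "real \<Rightarrow> real"
  assumes "open I" "smooth_on I s" "u0 \<in> I" "der 1 s u0 \<noteq> 0"
  obtains I' J S where "open I'" "I' \<subseteq> I" "u0 \<in> I'" "open J" "homeomorphism I' J s S" "smooth_on J S"
    "\<And>u. u \<in> I' \<Longrightarrow> der 1 s u \<noteq> 0"
    "\<And>t. t \<in> J \<Longrightarrow> (S has_vector_derivative inverse (der 1 s (S t))) (at t)"
proof -
  have fd: "frechet_derivative s (at u) = (\<lambda>v. v * der 1 s u)" if "u \<in> I" for u
    using smooth_on_has_vector_derivative[OF assms(2) that]
    by (simp add: has_vector_derivative_def frechet_derivative_eqI)
  have "inj (frechet_derivative s (at u0))" using assms(4) by (simp add: fd[OF assms(3)] inj_on_def)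
  then obtain I' J S where *: "open I'" "I' \<subseteq> I" "u0 \<in> I'" "open J" "homeomorphism I' J s S"
    "\<And>y. y \<in> J \<Longrightarrow> (S has_derivative inv (frechet_derivative s (at (S y)))) (at y)"
    "\<And>y. y \<in> J \<Longrightarrow> bij (frechet_derivative s (at (S y)))"
    using local_inverse[OF assms(1-3)] by blast
  have SJ: "S ` J = I'" "\<And>u. u \<in> I' \<Longrightarrow> S (s u) = u" "s ` I' = J" using *(5) by (auto simp: homeomorphism_def)
  have nz: "der 1 s u \<noteq> 0" if "u \<in> I'" for u
  proof
    assume 0: "der 1 s u = 0"
    have "bij (frechet_derivative s (at (S (s u))))" using *(7) SJ that by blast
    then have "bij (\<lambda>v::real. 0::real)" using SJ that fd 0 *(2) by (auto simp: subset_iff)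
    then have "inj (\<lambda>v::real. 0::real)" by (rule bij_is_inj)
    from injD[OF this, of 0 1] show False by simp
  qed
  have der: "(S has_derivative (\<lambda>v. v * inverse (der 1 s (S t)))) (at t)" if "t \<in> J" for t
  proof -
    have "S t \<in> I'" using that SJ by blast
    then have "inv (frechet_derivative s (at (S t))) = (\<lambda>v. v * inverse (der 1 s (S t)))"
      using nz fd *(2) by (intro inv_unique_comp) (auto simp: fun_eq_iff subset_iff)
    then show ?thesis using *(6)[OF that] by simp
  qed
  have "smooth_on J S"
    by (rule smooth_on_autonomous[where C="\<lambda>v u. v * inverse (der 1 s u)", OF *(4,1) _ der])
      (use SJ(1) in simp_all, intro smooth_intros *(1) smooth_on_subset[OF assms(2) *(2)], use nz in simp)
  then show ?thesis using that[OF *(1-5) _ nz] der by (simp add: has_vector_derivative_def)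
qed

text \<open>The inverse of the derivative is written out by Cramer's rule, so that it is visibly a smooth function
  and \<open>smooth_on_autonomous\<close> applies.\<close>
lemma smooth_local_inverse_plane:
  fixes f :: "plane \<Rightarrow> plane"
  assumes "open U" "smooth_on U f" "q0 \<in> U" "inj (frechet_derivative f (at q0))"
  obtains U' V g where "open U'" "U' \<subseteq> U" "q0 \<in> U'" "open V" "homeomorphism U' V f g" "smooth_on V g"
proof -
  obtain U' V g where *: "open U'" "U' \<subseteq> U" "q0 \<in> U'" "open V" "homeomorphism U' V f g"
    "\<And>y. y \<in> V \<Longrightarrow> (g has_derivative inv (frechet_derivative f (at (g y)))) (at y)"
    "\<And>y. y \<in> V \<Longrightarrow> bij (frechet_derivative f (at (g y)))"
    using local_inverse[OF assms] by blast
  have gV: "g ` V = U'" using *(5) by (auto simp: homeomorphism_def)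
  define D where "D z v = frechet_derivative f (at z) v" for z v
  have lin: "linear (D z)" if "z \<in> U" for z
    using smooth_on_has_derivative[OF assms(2) that] has_derivative_linear by (auto simp: D_def[abs_def])
  have Dexp: "D z (a, b) = a *\<^sub>R D z (1,0) + b *\<^sub>R D z (0,1)" if "z \<in> U" for z a b
    using linear_add[OF lin[OF that], of "(a,0)" "(0,b)"] linear_cmul[OF lin[OF that], of a "(1,0)"]
      linear_cmul[OF lin[OF that], of b "(0,1)"] by simp
  define J where "J z = fst (D z (1,0)) * snd (D z (0,1)) - fst (D z (0,1)) * snd (D z (1,0))" for z
  define C where "C v z = ((snd (D z (0,1)) * fst v - fst (D z (0,1)) * snd v) / J z,
      (fst (D z (1,0)) * snd v - snd (D z (1,0)) * fst v) / J z)" for v z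
  have Jnz: "J z \<noteq> 0" if z: "z \<in> U'" for z
  proof
    assume J0: "J z = 0"
    have zU: "z \<in> U" using z *(2) by auto
    have "inj (D z)" using *(7) gV z bij_is_inj by (fastforce simp: D_def[abs_def])
    then have ker: "w = 0" if "D z w = 0" for w
      using that linear_0[OF lin[OF zU]] injD by metis
    have "D z (snd (D z (0,1)), - snd (D z (1,0))) = 0" "D z (- fst (D z (0,1)), fst (D z (1,0))) = 0"
      by (subst Dexp[OF zU], use J0 in \<open>auto simp: J_def prod_eq_iff algebra_simps\<close>)+
    from this[THEN ker] have "D z (1,0) = 0" by (simp add: prod_eq_iff)
    from ker[OF this] show False by (simp add: prod_eq_iff)
  qed
  have DC: "D z (C v z) = v" if "z \<in> U'" for z v
  proof -
    have "z \<in> U" using that *(2) by auto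
    have cramer: "(d * x - b * y) / k * a + (a * y - c * x) / k * b = x"
      "(d * x - b * y) / k * c + (a * y - c * x) / k * d = y"
      if "k = a * d - b * c" "k \<noteq> 0" for a b c d x y k :: real
      using that(2) unfolding that(1) by (simp_all add: divide_simps, simp_all add: algebra_simps)
    have "D z (C v z) = fst (C v z) *\<^sub>R D z (1,0) + snd (C v z) *\<^sub>R D z (0,1)"
      using Dexp[OF \<open>z \<in> U\<close>] by (metis prod.collapse)
    then show ?thesis
      using cramer[OF J_def Jnz[OF that]] unfolding C_def by (simp add: prod_eq_iff)
  qed
  have der: "(g has_derivative (\<lambda>v. C v (g y))) (at y)" if "y \<in> V" for y
  proof -
    have "g y \<in> U'" using gV that by auto
    moreover have "inj (D (g y))" using *(7)[OF that] bij_is_inj by (simp add: D_def[abs_def])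
    ultimately have "inv (D (g y)) v = C v (g y)" for v using DC by (intro inv_f_eq) auto
    then have "inv (frechet_derivative f (at (g y))) = (\<lambda>v. C v (g y))" by (auto simp: D_def[abs_def])
    then show ?thesis using *(6)[OF that] by simp
  qed
  have sD: "smooth_on U' (\<lambda>z. D z v)" for v
    unfolding D_def by (intro smooth_on_frechet smooth_on_subset[OF assms(2) *(2)])
  have "smooth_on U' (C v)" for v
    unfolding C_def J_def by (intro smooth_intros sD *(1)) (use Jnz in \<open>simp_all add: J_def\<close>)
  then have "smooth_on V g" using smooth_on_autonomous[OF *(4,1) _ der] gV by auto
  then show ?thesis using that[OF *(1-5)] by blast
qed

section \<open>The determinant of four vectors\<close>

lemma vector_4 [simp]:
  "(vector [p, q, r, s] :: 'a::zero^4) $ 1 = p"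
  "(vector [p, q, r, s] :: 'a^4) $ 2 = q"
  "(vector [p, q, r, s] :: 'a^4) $ 3 = r"
  "(vector [p, q, r, s] :: 'a^4) $ 4 = s"
  unfolding vector_def by simp_all

lemma det_4:
  "det (A::real^4^4) =
    A$1$1 * (A$2$2 * (A$3$3 * A$4$4 - A$3$4 * A$4$3) - A$2$3 * (A$3$2 * A$4$4 - A$3$4 * A$4$2) + A$2$4 * (A$3$2 * A$4$3 - A$3$3 * A$4$2))
  - A$1$2 * (A$2$1 * (A$3$3 * A$4$4 - A$3$4 * A$4$3) - A$2$3 * (A$3$1 * A$4$4 - A$3$4 * A$4$1) + A$2$4 * (A$3$1 * A$4$3 - A$3$3 * A$4$1))
  + A$1$3 * (A$2$1 * (A$3$2 * A$4$4 - A$3$4 * A$4$2) - A$2$2 * (A$3$1 * A$4$4 - A$3$4 * A$4$1) + A$2$4 * (A$3$1 * A$4$2 - A$3$2 * A$4$1))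
  - A$1$4 * (A$2$1 * (A$3$2 * A$4$3 - A$3$3 * A$4$2) - A$2$2 * (A$3$1 * A$4$3 - A$3$3 * A$4$1) + A$2$3 * (A$3$1 * A$4$2 - A$3$2 * A$4$1))"
proof -
  have f1: "finite {2::4, 3, 4}" "1 \<notin> {2::4, 3, 4}" by auto
  have f2: "finite {3::4, 4}" "2 \<notin> {3::4, 4}" by auto
  have f3: "finite {4::4}" "3 \<notin> {4::4}" by auto
  show ?thesis
    unfolding det_def UNIV_4
    unfolding sum_over_permutations_insert[OF f1]
    unfolding sum_over_permutations_insert[OF f2]
    unfolding sum_over_permutations_insert[OF f3]
    unfolding permutes_sing
    by (simp add: sign_swap_id permutation_swap_id permutation_compose sign_compose sign_id swap_id_eq)
      (simp add: algebra_simps)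
qed

lemma det4_expand:
  "det4 p q r s =
    p$1 * (q$2 * (r$3 * s$4 - r$4 * s$3) - q$3 * (r$2 * s$4 - r$4 * s$2) + q$4 * (r$2 * s$3 - r$3 * s$2))
  - p$2 * (q$1 * (r$3 * s$4 - r$4 * s$3) - q$3 * (r$1 * s$4 - r$4 * s$1) + q$4 * (r$1 * s$3 - r$3 * s$1))
  + p$3 * (q$1 * (r$2 * s$4 - r$4 * s$2) - q$2 * (r$1 * s$4 - r$4 * s$1) + q$4 * (r$1 * s$2 - r$2 * s$1))
  - p$4 * (q$1 * (r$2 * s$3 - r$3 * s$2) - q$2 * (r$1 * s$3 - r$3 * s$1) + q$3 * (r$1 * s$2 - r$2 * s$1))"
  unfolding det4_def det_4 by simp

lemma det4_linear [simp]:
  "det4 (p + p') q r s = det4 p q r s + det4 p' q r s"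
  "det4 p (q + q') r s = det4 p q r s + det4 p q' r s"
  "det4 p q (r + r') s = det4 p q r s + det4 p q r' s"
  "det4 p q r (s + s') = det4 p q r s + det4 p q r s'"
  "det4 (k *\<^sub>R p) q r s = k * det4 p q r s"
  "det4 p (k *\<^sub>R q) r s = k * det4 p q r s"
  "det4 p q (k *\<^sub>R r) s = k * det4 p q r s"
  "det4 p q r (k *\<^sub>R s) = k * det4 p q r s"
  "det4 (- p) q r s = - det4 p q r s"
  "det4 p (- q) r s = - det4 p q r s"
  "det4 p q (- r) s = - det4 p q r s"
  "det4 p q r (- s) = - det4 p q r s"
  "det4 (p - p') q r s = det4 p q r s - det4 p' q r s"
  "det4 p (q - q') r s = det4 p q r s - det4 p q' r s"
  "det4 p q (r - r') s = det4 p q r s - det4 p q r' s"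
  "det4 p q r (s - s') = det4 p q r s - det4 p q r s'"
  "det4 0 q r s = 0" "det4 p 0 r s = 0" "det4 p q 0 s = 0" "det4 p q r 0 = 0"
  by (simp_all add: det4_expand algebra_simps)

lemma det4_repeated [simp]:
  "det4 p p r s = 0" "det4 p q p s = 0" "det4 p q r p = 0"
  "det4 p q q s = 0" "det4 p q r q = 0" "det4 p q r r = 0"
  by (simp_all add: det4_expand algebra_simps)

lemma det4_swap:
  "det4 q p r s = - det4 p q r s"
  "det4 p r q s = - det4 p q r s"
  "det4 p q s r = - det4 p q r s"
  by (simp_all add: det4_expand algebra_simps)

text \<open>Cramer's rule.\<close>
lemma det4_basis:
  assumes "det4 a b c d \<noteq> 0"
  shows "w = (det4 w b c d / det4 a b c d) *\<^sub>R a + (det4 a w c d / det4 a b c d) *\<^sub>R b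
    + (det4 a b w d / det4 a b c d) *\<^sub>R c + (det4 a b c w / det4 a b c d) *\<^sub>R d"
proof -
  let ?A = "vector [a, b, c, d] :: real^4^4"
  have "invertible (transpose ?A)"
    using assms by (simp add: det4_def invertible_det_nz det_transpose)
  then obtain x where x: "transpose ?A *v x = w"
    by (metis invertible_def matrix_vector_mul_assoc matrix_vector_mul_lid)
  have w: "w = x$1 *\<^sub>R a + x$2 *\<^sub>R b + x$3 *\<^sub>R c + x$4 *\<^sub>R d"
    unfolding x[symmetric]
    by (simp add: vec_eq_iff matrix_vector_mult_def transpose_def sum_4 mult.commute)
  have "det4 w b c d = x$1 * det4 a b c d" "det4 a w c d = x$2 * det4 a b c d"
    "det4 a b w d = x$3 * det4 a b c d" "det4 a b c w = x$4 * det4 a b c d"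
    unfolding w by simp_all
  then show ?thesis using assms w by simp
qed

lemma smooth_on_det4 [smooth_intros]:
  assumes "open U" "smooth_on U p" "smooth_on U q" "smooth_on U r" "smooth_on U s"
  shows "smooth_on U (\<lambda>z. det4 (p z) (q z) (r z) (s z))"
  unfolding det4_expand by (intro smooth_intros assms)

lemma has_vector_derivative_det4:
  assumes "(p has_vector_derivative p') (at u)" "(q has_vector_derivative q') (at u)"
    "(r has_vector_derivative r') (at u)" "(s has_vector_derivative s') (at u)"
  shows "((\<lambda>u. det4 (p u) (q u) (r u) (s u)) has_vector_derivative
    det4 p' (q u) (r u) (s u) + det4 (p u) q' (r u) (s u) + det4 (p u) (q u) r' (s u) + det4 (p u) (q u) (r u) s') (at u)"
proof -
  have c: "((\<lambda>u. c u $ i) has_vector_derivative c' $ i) (at u)"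
    if "(c has_vector_derivative c') (at u)" for c :: "real \<Rightarrow> real^4" and c' i
    using bounded_linear.has_vector_derivative[OF bounded_linear_vec_nth that] .
  show ?thesis unfolding det4_expand
    by (rule derivative_eq_intros c assms refl)+ (simp add: algebra_simps)
qed

section \<open>An affine immersion in one chart\<close>

lemma linear_plane_expand:
  fixes L :: "plane \<Rightarrow> 'b::real_vector"
  assumes "linear L"
  shows "L v = fst v *\<^sub>R L (1,0) + snd v *\<^sub>R L (0,1)"
proof -
  have "L v = L (fst v *\<^sub>R (1,0) + snd v *\<^sub>R (0,1))" by simp
  then show ?thesis by (simp only: linear_add[OF assms] linear_cmul[OF assms])
qed

text \<open>The surface in one chart: \<open>W\<close> is the chart domain, \<open>f\<close> the immersion, \<open>\<Gamma>\<close> the connection and \<open>S\<close> the transversal bundle.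
  Vector fields range over all smooth fields on open subsets, so that the fields of a different coordinate system can be
  inserted without transforming \<open>\<Gamma>\<close>.\<close>
locale parallel_patch =
  fixes W :: "plane set" and f :: "plane \<Rightarrow> real^4" and \<Gamma> :: christoffel and S :: "plane \<Rightarrow> (real^4) set"
  assumes open_W: "open W"
    and smooth_f: "smooth_on W f"
    and inj_f: "\<And>q. q \<in> W \<Longrightarrow> inj (frechet_derivative f (at q))"
    and bilinear_\<Gamma>: "\<And>q. q \<in> W \<Longrightarrow> bilinear (\<Gamma> q)"
    and smooth_\<Gamma>: "\<And>a b. smooth_on W (\<lambda>q. \<Gamma> q a b)"
    and sym_\<Gamma>: "\<And>q a b. q \<in> W \<Longrightarrow> \<Gamma> q a b = \<Gamma> q b a"
    and span_S: "\<And>q. q \<in> W \<Longrightarrow> \<exists>s\<^sub>1 s\<^sub>2. S q = span {s\<^sub>1, s\<^sub>2}"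
    and transversal: "\<And>q. q \<in> W \<Longrightarrow> tangent_plane f q \<inter> S q = {0}"
    and complement: "\<And>q. q \<in> W \<Longrightarrow> {t + s |t s. t \<in> tangent_plane f q \<and> s \<in> S q} = UNIV"
    and second_form_in: "\<And>V X Y q. open V \<Longrightarrow> V \<subseteq> W \<Longrightarrow> smooth_on V X \<Longrightarrow> smooth_on V Y \<Longrightarrow> q \<in> V \<Longrightarrow>
        second_form f \<Gamma> X Y q \<in> S q"
    and parallel: "\<And>V X Y Z q. open V \<Longrightarrow> V \<subseteq> W \<Longrightarrow> smooth_on V X \<Longrightarrow> smooth_on V Y \<Longrightarrow> smooth_on V Z \<Longrightarrow>
        q \<in> V \<Longrightarrow> nabla_second_form f \<Gamma> S X Y Z q = 0"
    and rank_one: "\<And>V X\<^sub>1 X\<^sub>2 q. open V \<Longrightarrow> V \<subseteq> W \<Longrightarrow> smooth_on V X\<^sub>1 \<Longrightarrow> smooth_on V X\<^sub>2 \<Longrightarrow>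
        (\<And>q. q \<in> V \<Longrightarrow> X\<^sub>1 q \<noteq> X\<^sub>2 q \<and> independent {X\<^sub>1 q, X\<^sub>2 q}) \<Longrightarrow> q \<in> V \<Longrightarrow>
        rank (vector [vector [frame_form f X\<^sub>1 X\<^sub>2 X\<^sub>1 X\<^sub>1 q, frame_form f X\<^sub>1 X\<^sub>2 X\<^sub>1 X\<^sub>2 q],
                      vector [frame_form f X\<^sub>1 X\<^sub>2 X\<^sub>2 X\<^sub>1 q, frame_form f X\<^sub>1 X\<^sub>2 X\<^sub>2 X\<^sub>2 q]] :: real^2^2) = 1"
begin

abbreviation df :: "plane \<Rightarrow> plane \<Rightarrow> real^4" where "df q \<equiv> frechet_derivative f (at q)"

text \<open>The second fundamental form as a tensor; \<open>second_form_eq\<close> identifies it with \<^const>\<open>second_form\<close>.\<close>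
definition II :: "plane \<Rightarrow> plane \<Rightarrow> plane \<Rightarrow> real^4" where
  "II q a b = D2 f q a b - df q (\<Gamma> q a b)"

lemma linear_df: "q \<in> W \<Longrightarrow> linear (df q)"
  using smooth_on_has_derivative[OF smooth_f] has_derivative_linear by blast

lemma subspace_tangent_plane: "q \<in> W \<Longrightarrow> subspace (tangent_plane f q)"
  unfolding tangent_plane_def using linear_df linear_subspace_image subspace_UNIV by blast

lemma df_in [simp]: "df q v \<in> tangent_plane f q"
  by (simp add: tangent_plane_def)

lemma subspace_S: "q \<in> W \<Longrightarrow> subspace (S q)"
  using span_S by (metis subspace_span)

lemma D2_linear_left: "q \<in> W \<Longrightarrow> linear (\<lambda>a. D2 f q a b)"
  unfolding D2_def
  using smooth_on_has_derivative[OF smooth_on_frechet[OF smooth_f]] has_derivative_linear by blast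

lemma D2_sym: "q \<in> W \<Longrightarrow> D2 f q a b = D2 f q b a"
  by (rule D2_symmetric[OF open_W smooth_f])

lemma II_sym: "q \<in> W \<Longrightarrow> II q a b = II q b a"
  by (simp add: II_def D2_sym sym_\<Gamma>)

lemma linear_\<Gamma>: "q \<in> W \<Longrightarrow> linear (\<Gamma> q a)" "q \<in> W \<Longrightarrow> linear (\<lambda>a. \<Gamma> q a b)"
  using bilinear_\<Gamma>[of q] unfolding bilinear_def by blast+

lemma II_linear_left: "q \<in> W \<Longrightarrow> linear (\<lambda>a. II q a b)"
  unfolding II_def
  by (intro linear_compose_sub D2_linear_left linear_compose[OF linear_\<Gamma>(2) linear_df, unfolded o_def])

lemma II_combo_left: "q \<in> W \<Longrightarrow> II q (k *\<^sub>R a + l *\<^sub>R b) c = k *\<^sub>R II q a c + l *\<^sub>R II q b c"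
  using linear_add[OF II_linear_left, of q "k *\<^sub>R a" "l *\<^sub>R b" c] linear_cmul[OF II_linear_left, of q _ _ c] by simp

lemma II_combo_right: "q \<in> W \<Longrightarrow> II q c (k *\<^sub>R a + l *\<^sub>R b) = k *\<^sub>R II q c a + l *\<^sub>R II q c b"
  using II_combo_left II_sym by metis

lemma df_combo: "q \<in> W \<Longrightarrow> df q (k *\<^sub>R a + l *\<^sub>R b) = k *\<^sub>R df q a + l *\<^sub>R df q b"
  using linear_df by (simp add: linear_add linear_cmul)

lemma df_inject: "q \<in> W \<Longrightarrow> df q a = df q b \<longleftrightarrow> a = b"
  using inj_f[of q] injD by metis

lemma has_derivative_push:
  assumes "open V" "V \<subseteq> W" "smooth_on V Y" "q \<in> V"
  shows "(push f Y has_derivative (\<lambda>v. D2 f q v (Y q) + df q (frechet_derivative Y (at q) v))) (at q)"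
proof -
  have qW: "q \<in> W" using assms by auto
  let ?P = "\<lambda>z. fst (Y z) *\<^sub>R df z (1,0) + snd (Y z) *\<^sub>R df z (0,1)"
  have Y: "(Y has_derivative frechet_derivative Y (at q)) (at q)"
    by (rule smooth_on_has_derivative[OF assms(3,4)])
  have F: "((\<lambda>z. df z b) has_derivative (\<lambda>a. D2 f q a b)) (at q)" for b
    unfolding D2_def by (rule smooth_on_has_derivative[OF smooth_on_frechet[OF smooth_f] qW])
  have "(?P has_derivative (\<lambda>v.
      (fst (Y q) *\<^sub>R D2 f q v (1,0) + fst (frechet_derivative Y (at q) v) *\<^sub>R df q (1,0))
    + (snd (Y q) *\<^sub>R D2 f q v (0,1) + snd (frechet_derivative Y (at q) v) *\<^sub>R df q (0,1)))) (at q)"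
    by (intro has_derivative_add has_derivative_scaleR has_derivative_fst has_derivative_snd Y F)
  moreover have "D2 f q v (Y q) = fst (Y q) *\<^sub>R D2 f q v (1,0) + snd (Y q) *\<^sub>R D2 f q v (0,1)" for v
    using linear_plane_expand[OF D2_linear_left[OF qW], of "Y q"] D2_sym[OF qW] by metis
  moreover have "df q (frechet_derivative Y (at q) v) = fst (frechet_derivative Y (at q) v) *\<^sub>R df q (1,0)
      + snd (frechet_derivative Y (at q) v) *\<^sub>R df q (0,1)" for v
    using linear_plane_expand[OF linear_df[OF qW]] .
  ultimately have "(?P has_derivative (\<lambda>v. D2 f q v (Y q) + df q (frechet_derivative Y (at q) v))) (at q)"
    by (elim has_derivative_eq_rhs) (simp add: fun_eq_iff)
  moreover have "?P z = push f Y z" if "z \<in> V" for z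
    unfolding push_def using linear_plane_expand[OF linear_df, of z "Y z"] that assms(2) by auto
  ultimately show ?thesis
    using has_derivative_transform_within_open[OF _ assms(1,4)] by blast
qed

lemma dirder_push:
  assumes "open V" "V \<subseteq> W" "smooth_on V Y" "q \<in> V"
  shows "dirder X (push f Y) q = D2 f q (X q) (Y q) + df q (dirder X Y q)"
  unfolding dirder_def using frechet_derivative_eqI[OF has_derivative_push[OF assms]] by simp

lemma second_form_eq:
  assumes "open V" "V \<subseteq> W" "smooth_on V Y" "q \<in> V"
  shows "second_form f \<Gamma> X Y q = II q (X q) (Y q)"
proof -
  have "q \<in> W" using assms by auto
  then show ?thesis
    unfolding second_form_def dirder_push[OF assms] push_def cov_def II_def
    by (simp add: linear_add[OF linear_df])
qed

lemma II_in: "q \<in> W \<Longrightarrow> II q a b \<in> S q"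
  using second_form_in[OF open_W order_refl, of "\<lambda>_. a" "\<lambda>_. b" q]
    second_form_eq[OF open_W order_refl, of "\<lambda>_. b" q "\<lambda>_. a"]
    smooth_on_const[OF open_W, of a] smooth_on_const[OF open_W, of b] by simp

lemma smooth_cov:
  assumes "open V" "V \<subseteq> W" "smooth_on V X" "smooth_on V Y"
  shows "smooth_on V (cov \<Gamma> X Y)"
proof (rule smooth_on_cong[OF assms(1)])
  show "smooth_on V (\<lambda>q. frechet_derivative Y (at q) (X q)
    + (fst (X q) *\<^sub>R (fst (Y q) *\<^sub>R \<Gamma> q (1,0) (1,0) + snd (Y q) *\<^sub>R \<Gamma> q (1,0) (0,1))
    + snd (X q) *\<^sub>R (fst (Y q) *\<^sub>R \<Gamma> q (0,1) (1,0) + snd (Y q) *\<^sub>R \<Gamma> q (0,1) (0,1))))"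
    by (intro smooth_intros assms smooth_on_subset[OF smooth_\<Gamma> assms(2)])
  fix q assume "q \<in> V"
  then have "q \<in> W" using assms by auto
  have "\<Gamma> q (X q) (Y q) = fst (X q) *\<^sub>R \<Gamma> q (1,0) (Y q) + snd (X q) *\<^sub>R \<Gamma> q (0,1) (Y q)"
    by (rule linear_plane_expand[OF linear_\<Gamma>(2)]) fact
  also have "\<dots> = (fst (X q) *\<^sub>R (fst (Y q) *\<^sub>R \<Gamma> q (1,0) (1,0) + snd (Y q) *\<^sub>R \<Gamma> q (1,0) (0,1))
    + snd (X q) *\<^sub>R (fst (Y q) *\<^sub>R \<Gamma> q (0,1) (1,0) + snd (Y q) *\<^sub>R \<Gamma> q (0,1) (0,1)))"
    using linear_plane_expand[OF linear_\<Gamma>(1)[OF \<open>q \<in> W\<close>], of _ "Y q"] by metis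
  finally show "frechet_derivative Y (at q) (X q)
    + (fst (X q) *\<^sub>R (fst (Y q) *\<^sub>R \<Gamma> q (1,0) (1,0) + snd (Y q) *\<^sub>R \<Gamma> q (1,0) (0,1))
    + snd (X q) *\<^sub>R (fst (Y q) *\<^sub>R \<Gamma> q (0,1) (1,0) + snd (Y q) *\<^sub>R \<Gamma> q (0,1) (0,1)))
    = cov \<Gamma> X Y q" by (simp add: cov_def dirder_def)
qed

lemma sigma_part:
  assumes "q \<in> W"
  shows "w - sigma_part f S q w \<in> tangent_plane f q"
proof -
  obtain t s where ts: "w = t + s" "t \<in> tangent_plane f q" "s \<in> S q"
    using complement[OF assms] by blast
  have "\<exists>!s. s \<in> S q \<and> w - s \<in> tangent_plane f q"
  proof (rule ex1I[of _ s])
    fix s' assume s': "s' \<in> S q \<and> w - s' \<in> tangent_plane f q"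
    have "(w - s) - (w - s') \<in> tangent_plane f q"
      using s' ts subspace_diff[OF subspace_tangent_plane[OF assms]] by (metis add_diff_cancel_right')
    moreover have "s' - s \<in> S q" using s' ts subspace_diff[OF subspace_S[OF assms]] by metis
    ultimately have "s' - s \<in> tangent_plane f q \<inter> S q" by simp
    then show "s' = s" using transversal[OF assms] by simp
  qed (use ts in simp)
  from theI'[OF this] show ?thesis by (simp add: sigma_part_def)
qed

text \<open>The equation \<open>\<nabla>h = 0\<close> modulo the tangent plane.  In this form the projection onto \<open>S\<close> along the tangent plane, which
  is defined by a description operator, has disappeared.\<close>
lemma parallel_mod_tangent:
  assumes V: "open V" "V \<subseteq> W" "smooth_on V X" "smooth_on V Y" "smooth_on V Z" "q \<in> V"
  shows "dirder X (second_form f \<Gamma> Y Z) q - II q (cov \<Gamma> X Y q) (Z q) - II q (Y q) (cov \<Gamma> X Z q)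
    \<in> tangent_plane f q"
proof -
  have "q \<in> W" using V by auto
  have "sigma_part f S q (dirder X (second_form f \<Gamma> Y Z) q) = II q (cov \<Gamma> X Y q) (Z q) + II q (Y q) (cov \<Gamma> X Z q)"
    using parallel[OF V] second_form_eq[OF V(1,2,5,6)]
      second_form_eq[OF V(1,2) smooth_cov[OF V(1-3) V(5)] V(6)]
    by (simp add: nabla_second_form_def normal_connection_def algebra_simps)
  then show ?thesis
    using sigma_part[OF \<open>q \<in> W\<close>, of "dirder X (second_form f \<Gamma> Y Z) q"] by (simp add: algebra_simps)
qed

end

section \<open>The null direction and the rulings\<close>

lemma independent_pairI:
  fixes a b :: "'a::real_vector"
  assumes "\<And>k l. k *\<^sub>R a + l *\<^sub>R b = 0 \<Longrightarrow> k = 0 \<and> l = 0"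
  shows "a \<noteq> b \<and> independent {a, b}"
proof -
  have "b \<noteq> 0" using assms[of 0 1] by auto
  have ne: "a \<noteq> k *\<^sub>R b" for k using assms[of 1 "-k"] by auto
  have "a \<notin> span {b}" using ne by (auto simp: span_singleton)
  then show ?thesis using ne[of 1] \<open>b \<noteq> 0\<close> by (simp add: independent_insert)
qed

lemma span_pair_eqI:
  fixes a b :: "'a::euclidean_space"
  assumes "a \<in> span {s\<^sub>1, s\<^sub>2}" "b \<in> span {s\<^sub>1, s\<^sub>2}"
    "\<And>k l. k *\<^sub>R a + l *\<^sub>R b = 0 \<Longrightarrow> k = 0 \<and> l = 0"
  shows "span {s\<^sub>1, s\<^sub>2} = span {a, b}"
proof -
  have ab: "a \<noteq> b" "independent {a, b}" using independent_pairI[OF assms(3)] by auto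
  have "dim {s\<^sub>1, s\<^sub>2} \<le> card {s\<^sub>1, s\<^sub>2}" by (intro dim_le_card) (auto intro: span_base)
  also have "\<dots> \<le> 2" by (simp add: card_insert_if)
  finally have "dim (span {s\<^sub>1, s\<^sub>2}) \<le> dim (span {a, b})"
    using ab dim_eq_card_independent[OF ab(2)] by (simp add: dim_span)
  moreover have "span {a, b} \<subseteq> span {s\<^sub>1, s\<^sub>2}"
    by (rule span_minimal) (use assms(1,2) in auto)
  ultimately have "span {a, b} = span {s\<^sub>1, s\<^sub>2}"
    by (intro subspace_dim_equal subspace_span)
  then show ?thesis by simp
qed

lemma rank_one_symmetric_2:
  fixes p q r :: real
  assumes "rank (vector [vector [p, q], vector [q, r]] :: real^2^2) = 1"
  shows "p * r = q\<^sup>2" "p \<noteq> 0 \<or> r \<noteq> 0"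
proof -
  let ?A = "vector [vector [p, q], vector [q, r]] :: real^2^2"
  have "det ?A = 0" using assms by (simp add: det_eq_0_rank)
  then show pr: "p * r = q\<^sup>2" by (simp add: det_2 power2_eq_square)
  show "p \<noteq> 0 \<or> r \<noteq> 0"
  proof (rule ccontr)
    assume "\<not> ?thesis"
    then have "p = 0" "r = 0" "q = 0" using pr by auto
    then have "?A = 0" by (simp add: vec_eq_iff forall_2)
    then show False using assms by simp
  qed
qed

text \<open>Modulo \<open>a, b\<close> the vectors \<open>x, y, z\<close> lie in a plane with the area form \<open>[\<cdot>,\<cdot>]\<close>, and \<open>p, 2q, r\<close> are \<open>[x,y]\<close>, \<open>[x,z]\<close>, \<open>[y,z]\<close>.
  If \<open>x, y, z\<close> are the values \<open>h(E,E)\<close>, \<open>h(E,F)\<close>, \<open>h(F,F)\<close> of a vector-valued form, then \<open>p, q, r\<close> is the associated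
  scalar form, \<open>-q E + p F\<close> is its null vector, and the combination below is the value of \<open>h\<close> on that vector.\<close>
lemma null_vector_mod:
  assumes "det4 a b x y = p" "det4 a b x z = 2 * q" "det4 a b y z = r" "p * r = q\<^sup>2" "p \<noteq> 0"
  shows "\<exists>k l. q\<^sup>2 *\<^sub>R x - (2 * q * p) *\<^sub>R y + p\<^sup>2 *\<^sub>R z = k *\<^sub>R a + l *\<^sub>R b"
proof -
  have D: "det4 a b x y \<noteq> 0" using assms by simp
  obtain k l where z: "z = k *\<^sub>R a + l *\<^sub>R b + (det4 a b z y / p) *\<^sub>R x + (2 * q / p) *\<^sub>R y"
    using det4_basis[OF D, of z] assms(1,2) by metis
  have "det4 a b z y = - r" using assms(3) det4_swap(3)[of a b z y] by simp
  then have "p\<^sup>2 *\<^sub>R z = (p\<^sup>2 * k) *\<^sub>R a + (p\<^sup>2 * l) *\<^sub>R b + (p\<^sup>2 * (- r / p)) *\<^sub>R x + (p\<^sup>2 * (2 * q / p)) *\<^sub>R y"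
    by (subst z) (simp add: algebra_simps)
  moreover have "p\<^sup>2 * (- r / p) = - q\<^sup>2" "p\<^sup>2 * (2 * q / p) = 2 * q * p"
    using assms(4,5) by (simp_all add: power2_eq_square field_simps)
  ultimately have "q\<^sup>2 *\<^sub>R x - (2 * q * p) *\<^sub>R y + p\<^sup>2 *\<^sub>R z = (p\<^sup>2 * k) *\<^sub>R a + (p\<^sup>2 * l) *\<^sub>R b" by simp
  then show ?thesis by blast
qed

lemma open_rectangle:
  fixes z :: plane
  assumes "open V" "z \<in> V"
  obtains u0 u1 v0 v1 where "z \<in> {u0<..<u1} \<times> {v0<..<v1}" "{u0<..<u1} \<times> {v0<..<v1} \<subseteq> V"
proof -
  obtain A B where AB: "open A" "open B" "z \<in> A \<times> B" "A \<times> B \<subseteq> V"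
    using open_prod_elim[OF assms] by metis
  obtain d where d: "d > 0" "ball (fst z) d \<subseteq> A" using AB open_contains_ball by (metis mem_Times_iff)
  obtain e where e: "e > 0" "ball (snd z) e \<subseteq> B" using AB open_contains_ball by (metis mem_Times_iff)
  show ?thesis
    using d e AB(4)
    by (intro that[of "fst z - d" "fst z + d" "snd z - e" "snd z + e"])
      (auto simp: ball_eq_greaterThanLessThan mem_Times_iff subset_iff)
qed

lemma open_nonzero:
  fixes g :: "'a::topological_space \<Rightarrow> 'b::t1_space"
  assumes "open U" "continuous_on U g"
  shows "open {q \<in> U. g q \<noteq> c}"
proof -
  have "open (g -` (- {c}) \<inter> U)"
    using continuous_on_open_vimage[OF assms(1)] assms(2) by (metis open_Compl closed_singleton)
  moreover have "g -` (- {c}) \<inter> U = {q \<in> U. g q \<noteq> c}" by auto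
  ultimately show ?thesis by simp
qed

lemma has_vector_derivative_snd:
  assumes "(G has_derivative G') (at (u, v))"
  shows "((\<lambda>v. G (u, v)) has_vector_derivative G' (0, 1)) (at (v::real))"
proof -
  have p: "((\<lambda>v. (u, v)) has_derivative (\<lambda>h. (0, h))) (at v)"
    by (rule has_derivative_Pair) (rule has_derivative_const has_derivative_ident)+
  have "((\<lambda>v. G (u, v)) has_derivative (\<lambda>h. G' (0, h))) (at v)"
    using has_derivative_compose[OF p assms] .
  moreover have "(\<lambda>h. G' (0, h)) = (\<lambda>h. h *\<^sub>R G' (0, 1))"
    by (rule ext, use linear_cmul[OF has_derivative_linear[OF assms], of _ "(0,1)"] in \<open>metis scaleR_Pair mult.right_neutral real_scaleR_def scaleR_zero_right\<close>)
  ultimately show ?thesis unfolding has_vector_derivative_def by metis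
qed

text \<open>Used to integrate \<open>c' = 0\<close>, the only differential equation that has to be solved besides a quadrature.\<close>
lemma constant_on_interval:
  fixes c :: "real \<Rightarrow> 'a::real_normed_vector"
  assumes "\<And>t. t \<in> {a<..<b} \<Longrightarrow> (c has_vector_derivative 0) (at t)" "s \<in> {a<..<b}" "t \<in> {a<..<b}"
  shows "c s = c t"
proof -
  obtain k where "\<And>t. t \<in> {a<..<b} \<Longrightarrow> c t = k"
    using has_vector_derivative_zero_constant[of "{a<..<b}" c] assms(1)
    by (auto intro: has_vector_derivative_at_within)
  then show ?thesis using assms(2,3) by auto
qed

context parallel_patch
begin

lemma combo_notin_tangent:
  assumes "q \<in> W" "n \<notin> tangent_plane f q" "k *\<^sub>R n \<in> tangent_plane f q"
  shows "k = 0"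
proof (rule ccontr)
  assume "k \<noteq> 0"
  have "inverse k *\<^sub>R (k *\<^sub>R n) \<in> tangent_plane f q"
    by (rule subspace_scale[OF subspace_tangent_plane[OF assms(1)] assms(3)])
  then show False using \<open>k \<noteq> 0\<close> assms(2) by simp
qed

lemma tangent_combo:
  assumes "q \<in> W" "\<And>v::plane. \<exists>k l. v = k *\<^sub>R E + l *\<^sub>R F"
  shows "t \<in> tangent_plane f q \<longleftrightarrow> (\<exists>k l. t = k *\<^sub>R df q E + l *\<^sub>R df q F)"
  using assms df_combo unfolding tangent_plane_def by (metis (no_types, lifting) rangeE rangeI)

lemma frame_form_const:
  "frame_form f (\<lambda>_. E) (\<lambda>_. F) (\<lambda>_. a) (\<lambda>_. b) q = 1/2 *
    (det4 (df q E) (df q F) (D2 f q E a) (D2 f q F b) + det4 (df q E) (df q F) (D2 f q E b) (D2 f q F a))"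
  unfolding frame_form_def push_def dirder_def D2_def by simp

text \<open>For the frame \<open>E, F\<close> the degenerate form has entries \<open>P, Q, R\<close> with \<open>P R = Q\<^sup>2\<close>, and \<open>-Q E + P F\<close> is a smooth
  null vector as long as \<open>P \<noteq> 0\<close>.  If \<open>P\<close> vanishes at the given point then \<open>R\<close> does not, and exchanging \<open>E\<close> and \<open>F\<close>
  leads back to the first case.\<close>
lemma null_field:
  assumes "q0 \<in> W"
  obtains V E Z where "open V" "V \<subseteq> W" "q0 \<in> V" "smooth_on V Z"
    "\<And>q v. q \<in> V \<Longrightarrow> \<exists>k l. v = k *\<^sub>R E + l *\<^sub>R Z q" "\<And>q. q \<in> V \<Longrightarrow> Z q \<noteq> 0"
    "\<And>q. q \<in> V \<Longrightarrow> D2 f q (Z q) (Z q) \<in> tangent_plane f q"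
    "\<And>q. q \<in> V \<Longrightarrow> D2 f q E (Z q) \<notin> tangent_plane f q"
proof -
  define P where "P E F q = det4 (df q E) (df q F) (D2 f q E E) (D2 f q E F)" for E F q
  define Q where "Q E F q = det4 (df q E) (df q F) (D2 f q E E) (D2 f q F F) / 2" for E F q
  define R where "R E F q = det4 (df q E) (df q F) (D2 f q E F) (D2 f q F F)" for E F q
  have sD: "smooth_on W (\<lambda>q. D2 f q a b)" "smooth_on W (\<lambda>q. df q a)" for a b
    unfolding D2_def by (intro smooth_on_frechet smooth_f)+
  have form: "P (1,0) (0,1) q * R (1,0) (0,1) q = (Q (1,0) (0,1) q)\<^sup>2"
    "P (1,0) (0,1) q \<noteq> 0 \<or> R (1,0) (0,1) q \<noteq> 0" if "q \<in> W" for q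
  proof -
    have ind: "((1,0)::plane) \<noteq> (0,1) \<and> independent {(1,0), (0,1)::plane}"
      by (rule independent_pairI) (simp add: prod_eq_iff)
    have *: "frame_form f (\<lambda>_. (1,0)) (\<lambda>_. (0,1)) (\<lambda>_. (1,0)) (\<lambda>_. (1,0)) q = P (1,0) (0,1) q"
      "frame_form f (\<lambda>_. (1,0)) (\<lambda>_. (0,1)) (\<lambda>_. (1,0)) (\<lambda>_. (0,1)) q = Q (1,0) (0,1) q"
      "frame_form f (\<lambda>_. (1,0)) (\<lambda>_. (0,1)) (\<lambda>_. (0,1)) (\<lambda>_. (1,0)) q = Q (1,0) (0,1) q"
      "frame_form f (\<lambda>_. (1,0)) (\<lambda>_. (0,1)) (\<lambda>_. (0,1)) (\<lambda>_. (0,1)) q = R (1,0) (0,1) q"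
      unfolding frame_form_const P_def Q_def R_def using D2_sym[OF that, of "(0,1)" "(1,0)"] by simp_all
    have "rank (vector [vector [P (1,0) (0,1) q, Q (1,0) (0,1) q],
        vector [Q (1,0) (0,1) q, R (1,0) (0,1) q]] :: real^2^2) = 1"
      using rank_one[OF open_W order_refl smooth_on_const[OF open_W] smooth_on_const[OF open_W] ind that]
      unfolding * .
    then show "P (1,0) (0,1) q * R (1,0) (0,1) q = (Q (1,0) (0,1) q)\<^sup>2"
      "P (1,0) (0,1) q \<noteq> 0 \<or> R (1,0) (0,1) q \<noteq> 0"
      by (rule rank_one_symmetric_2)+
  qed
  have swap: "P (0,1) (1,0) q = R (1,0) (0,1) q" "R (0,1) (1,0) q = P (1,0) (0,1) q"
    "Q (0,1) (1,0) q = Q (1,0) (0,1) q" if "q \<in> W" for q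
    unfolding P_def Q_def R_def D2_sym[OF that, of "(0,1)" "(1,0)"]
    using det4_swap(1)[of "df q (0,1)" "df q (1,0)"] det4_swap(3)[of "df q (1,0)" "df q (0,1)" "D2 f q (0,1) (0,1)"]
      det4_swap(3)[of "df q (1,0)" "df q (0,1)" "D2 f q (1,0) (0,1)" "D2 f q (1,0) (1,0)"]
    by auto
  note result = that
  have main: thesis
    if EF: "\<And>v. \<exists>k l. v = k *\<^sub>R E + l *\<^sub>R F" "\<And>k l. k *\<^sub>R E + l *\<^sub>R F = 0 \<Longrightarrow> k = 0 \<and> l = 0"
      and PR: "\<And>q. q \<in> W \<Longrightarrow> P E F q * R E F q = (Q E F q)\<^sup>2"
      and nz: "P E F q0 \<noteq> 0" for E F
  proof -
    define V where "V = {q \<in> W. P E F q \<noteq> 0}"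
    define Z where "Z q = (- Q E F q) *\<^sub>R E + P E F q *\<^sub>R F" for q
    have sP: "smooth_on W (P E F)" "smooth_on W (Q E F)"
      unfolding P_def Q_def by (intro smooth_intros sD open_W; simp)+
    have V: "open V" "V \<subseteq> W" "q0 \<in> V"
      unfolding V_def using open_nonzero[OF open_W smooth_on_continuous[OF sP(1)]] nz assms by auto
    have sZ: "smooth_on V Z"
      unfolding Z_def by (intro smooth_intros V(1) smooth_on_subset[OF sP(1) V(2)] smooth_on_subset[OF sP(2) V(2)])
    show thesis
    proof (rule result[of V Z E, OF V sZ])
      fix q assume q: "q \<in> V"
      then have qW: "q \<in> W" and Pq: "P E F q \<noteq> 0" by (auto simp: V_def)
      show "Z q \<noteq> 0" using EF(2) Pq unfolding Z_def by blast
      fix v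
      obtain k l where "v = k *\<^sub>R E + l *\<^sub>R F" using EF(1) by blast
      then have "v = (k + l / P E F q * Q E F q) *\<^sub>R E + (l / P E F q) *\<^sub>R Z q"
        using Pq by (simp add: Z_def algebra_simps)
      then show "\<exists>k l. v = k *\<^sub>R E + l *\<^sub>R Z q" by blast
    next
      fix q assume q: "q \<in> V"
      then have qW: "q \<in> W" and Pq: "P E F q \<noteq> 0" by (auto simp: V_def)
      have lin: "D2 f q (k *\<^sub>R a + l *\<^sub>R b) c = k *\<^sub>R D2 f q a c + l *\<^sub>R D2 f q b c" for k a l b c
        using linear_add[OF D2_linear_left[OF qW]] linear_cmul[OF D2_linear_left[OF qW]] by simp
      have EZ: "D2 f q c (Z q) = (- Q E F q) *\<^sub>R D2 f q c E + P E F q *\<^sub>R D2 f q c F" for c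
        using lin[of "- Q E F q" E "P E F q" F c] unfolding Z_def D2_sym[OF qW, of c] .
      have "D2 f q (Z q) (Z q) = (Q E F q)\<^sup>2 *\<^sub>R D2 f q E E - (2 * Q E F q * P E F q) *\<^sub>R D2 f q E F
          + (P E F q)\<^sup>2 *\<^sub>R D2 f q F F"
        unfolding EZ[of "Z q"] D2_sym[OF qW, of "Z q"] EZ D2_sym[OF qW, of F E]
        by (simp add: algebra_simps power2_eq_square scaleR_2[symmetric])
      moreover obtain k l where "(Q E F q)\<^sup>2 *\<^sub>R D2 f q E E - (2 * Q E F q * P E F q) *\<^sub>R D2 f q E F
          + (P E F q)\<^sup>2 *\<^sub>R D2 f q F F = k *\<^sub>R df q E + l *\<^sub>R df q F"
        using null_vector_mod[OF _ _ _ PR[OF qW] Pq, of "df q E" "df q F" "D2 f q E E" "D2 f q E F" "D2 f q F F"]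
        unfolding P_def Q_def R_def by auto
      ultimately show "D2 f q (Z q) (Z q) \<in> tangent_plane f q"
        using tangent_combo[OF qW EF(1)] by metis
      show "D2 f q E (Z q) \<notin> tangent_plane f q"
      proof
        assume "D2 f q E (Z q) \<in> tangent_plane f q"
        then obtain k l where kl: "D2 f q E (Z q) = k *\<^sub>R df q E + l *\<^sub>R df q F"
          using tangent_combo[OF qW EF(1)] by metis
        have "det4 (df q E) (df q F) (D2 f q E E) (D2 f q E (Z q)) = (P E F q)\<^sup>2"
          unfolding EZ by (simp add: P_def power2_eq_square)
        then show False using Pq unfolding kl by simp
      qed
    qed
  qed
  show thesis
  proof (cases "P (1,0) (0,1) q0 = 0")
    case False
    show thesis
      by (rule main[of "(1,0)" "(0,1)"]) (use False form in \<open>auto simp: prod_eq_iff\<close>)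
  next
    case True
    then have "P (0,1) (1,0) q0 \<noteq> 0" using form swap assms by metis
    moreover have "P (0,1) (1,0) q * R (0,1) (1,0) q = (Q (0,1) (1,0) q)\<^sup>2" if "q \<in> W" for q
      using form swap that by (metis mult.commute)
    moreover have "\<exists>k l. v = k *\<^sub>R (0,1) + l *\<^sub>R (1::real,0::real)" for v
      by (rule exI[of _ "snd v"], rule exI[of _ "fst v"]) simp
    ultimately show thesis by (intro main[of "(0,1)" "(1,0)"]) (auto simp: prod_eq_iff)
  qed
qed

text \<open>Since \<open>h(Z,Z)\<close> is both tangent and in \<open>S\<close>, it vanishes identically, and \<open>\<nabla>h = 0\<close> yields \<open>2 h(\<nabla>\<^sub>X Z, Z) = 0\<close>.  The part of
  \<open>\<nabla>\<^sub>X Z\<close> along \<open>E\<close> must then be zero because \<open>h(E,Z)\<close> is not.\<close>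
lemma null_field_parallel:
  assumes V: "open V" "V \<subseteq> W" "smooth_on V Z" "smooth_on V X" "q \<in> V"
    and EZ: "\<And>q v. q \<in> V \<Longrightarrow> \<exists>k l. v = k *\<^sub>R E + l *\<^sub>R Z q"
    and ZZ: "\<And>q. q \<in> V \<Longrightarrow> D2 f q (Z q) (Z q) \<in> tangent_plane f q"
    and EZn: "\<And>q. q \<in> V \<Longrightarrow> D2 f q E (Z q) \<notin> tangent_plane f q"
  shows "II q (Z q) (Z q) = 0" "II q E (Z q) \<notin> tangent_plane f q"
    "\<exists>l. dirder X (push f Z) q = l *\<^sub>R df q (Z q) + II q (X q) (Z q)"
proof -
  have qW: "q \<in> W" using V by auto
  have IIZ: "II q (Z q) (Z q) = 0" if "q \<in> V" for q
  proof -
    have qW: "q \<in> W" using V that by auto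
    have "II q (Z q) (Z q) \<in> tangent_plane f q"
      unfolding II_def by (intro subspace_diff subspace_tangent_plane qW ZZ that df_in)
    then show ?thesis using II_in[OF qW] transversal[OF qW] by blast
  qed
  show "II q (Z q) (Z q) = 0" by (rule IIZ[OF V(5)])
  show n: "II q E (Z q) \<notin> tangent_plane f q"
  proof
    assume "II q E (Z q) \<in> tangent_plane f q"
    then have "II q E (Z q) + df q (\<Gamma> q E (Z q)) \<in> tangent_plane f q"
      by (intro subspace_add subspace_tangent_plane qW df_in)
    then show False using EZn[OF V(5)] by (simp add: II_def)
  qed
  have "frechet_derivative (second_form f \<Gamma> Z Z) (at q) = frechet_derivative (\<lambda>_. 0) (at q)"
    by (rule frechet_derivative_cong_open[OF V(1,5)]) (use second_form_eq[OF V(1-3)] IIZ in auto)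
  then have "dirder X (second_form f \<Gamma> Z Z) q = 0" by (simp add: dirder_def)
  then have "- (II q (cov \<Gamma> X Z q) (Z q) + II q (cov \<Gamma> X Z q) (Z q)) \<in> tangent_plane f q"
    using parallel_mod_tangent[OF V(1,2,4,3,3,5)] II_sym[OF qW, of "Z q" "cov \<Gamma> X Z q"] by simp
  moreover have "- (II q (cov \<Gamma> X Z q) (Z q) + II q (cov \<Gamma> X Z q) (Z q)) = (-2) *\<^sub>R II q (cov \<Gamma> X Z q) (Z q)"
    by (simp add: scaleR_2)
  moreover obtain k l where kl: "cov \<Gamma> X Z q = k *\<^sub>R E + l *\<^sub>R Z q" using EZ[OF V(5)] by blast
  moreover have "II q (cov \<Gamma> X Z q) (Z q) = k *\<^sub>R II q E (Z q)"
    unfolding kl II_combo_left[OF qW] IIZ[OF V(5)] by simp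
  ultimately have "(-2 * k) *\<^sub>R II q E (Z q) \<in> tangent_plane f q"
    by (metis scaleR_scaleR)
  from combo_notin_tangent[OF qW n this] have "k = 0" by simp
  then have "l *\<^sub>R df q (Z q) = df q (dirder X Z q + \<Gamma> q (X q) (Z q))"
    using kl linear_cmul[OF linear_df[OF qW]] by (simp add: cov_def)
  also have "\<dots> = df q (dirder X Z q) + df q (\<Gamma> q (X q) (Z q))" by (rule linear_add[OF linear_df[OF qW]])
  finally have "dirder X (push f Z) q = l *\<^sub>R df q (Z q) + II q (X q) (Z q)"
    unfolding dirder_push[OF V(1-3,5)] II_def by simp
  then show "\<exists>l. dirder X (push f Z) q = l *\<^sub>R df q (Z q) + II q (X q) (Z q)" by blast
qed

text \<open>Scaling the image \<open>Y\<close> of the null field so that its \<open>i\<close>-th component is one gives a map \<open>N\<close> that is constant along the null direction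
  and not along \<open>E\<close>.  A component of \<open>N\<close> that changes along \<open>E\<close> is the coordinate \<open>u\<close>; the \<open>i\<close>-th component of \<open>f\<close> is
  \<open>v\<close>, for which the coordinate derivative of \<open>f\<close> is \<open>N\<close> itself.\<close>
lemma ruled_coordinates:
  assumes "q0 \<in> W"
  obtains V u0 u1 v0 v1 \<Psi> \<alpha> \<beta> and \<Phi> :: "plane \<Rightarrow> plane" where
    "open V" "V \<subseteq> W" "q0 \<in> V" "smooth_on V \<Phi>"
    "smooth_on ({u0<..<u1} \<times> {v0<..<v1}) \<Psi>"
    "homeomorphism V ({u0<..<u1} \<times> {v0<..<v1}) \<Phi> \<Psi>"
    "smooth_on {u0<..<u1} \<alpha>" "smooth_on {u0<..<u1} \<beta>"
    "\<And>u v. u \<in> {u0<..<u1} \<Longrightarrow> v \<in> {v0<..<v1} \<Longrightarrow> f (\<Psi> (u, v)) = \<alpha> u + v *\<^sub>R \<beta> u"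
proof -
  obtain V0 E Z where V0: "open V0" "V0 \<subseteq> W" "q0 \<in> V0" "smooth_on V0 Z"
    "\<And>q v. q \<in> V0 \<Longrightarrow> \<exists>k l. v = k *\<^sub>R E + l *\<^sub>R Z q" "\<And>q. q \<in> V0 \<Longrightarrow> Z q \<noteq> 0"
    "\<And>q. q \<in> V0 \<Longrightarrow> D2 f q (Z q) (Z q) \<in> tangent_plane f q"
    "\<And>q. q \<in> V0 \<Longrightarrow> D2 f q E (Z q) \<notin> tangent_plane f q"
    by (rule null_field[OF assms]) (rule that; assumption)
  note par = null_field_parallel[OF V0(1,2,4) _ _ V0(5,7,8)]
  define Y where "Y = push f Z"
  have sY: "smooth_on V0 Y"
    unfolding Y_def push_def by (intro smooth_intros V0(1,4) smooth_on_subset[OF smooth_f V0(2)])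
  have Yq: "Y q = df q (Z q)" for q by (simp add: Y_def push_def)
  have "Y q0 \<noteq> 0"
    unfolding Yq using df_inject[OF assms, of "Z q0" 0] V0(6)[OF V0(3)] linear_0[OF linear_df[OF assms]] by metis
  then obtain i where i: "Y q0 $ i \<noteq> 0" by (auto simp: vec_eq_iff)
  define V1 where "V1 = {q \<in> V0. Y q $ i \<noteq> 0}"
  have V1: "open V1" "V1 \<subseteq> V0" "V1 \<subseteq> W" "q0 \<in> V1"
    unfolding V1_def
    using open_nonzero[OF V0(1) smooth_on_continuous[OF smooth_on_nth[OF V0(1) sY]]] V0(2,3) i by auto
  have Yi: "Y q $ i \<noteq> 0" if "q \<in> V1" for q using that by (simp add: V1_def)
  define N where "N q = inverse (Y q $ i) *\<^sub>R Y q" for q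
  have sN: "smooth_on V1 N"
    unfolding N_def by (intro smooth_intros V1(1) smooth_on_subset[OF sY V1(2)] Yi)
  have Nder: "frechet_derivative N (at q) v = inverse (Y q $ i) *\<^sub>R
      (frechet_derivative Y (at q) v - (frechet_derivative Y (at q) v $ i) *\<^sub>R N q)" if "q \<in> V1" for q v
  proof -
    have Y: "(Y has_derivative frechet_derivative Y (at q)) (at q)"
      using smooth_on_has_derivative[OF sY] V1(2) that by blast
    have Yi': "((\<lambda>q. Y q $ i) has_derivative (\<lambda>v. frechet_derivative Y (at q) v $ i)) (at q)"
      by (rule bounded_linear.has_derivative[OF bounded_linear_vec_nth Y])
    have "(N has_derivative (\<lambda>v. inverse (Y q $ i) *\<^sub>R frechet_derivative Y (at q) v
        + (- (inverse (Y q $ i) * (frechet_derivative Y (at q) v $ i) * inverse (Y q $ i))) *\<^sub>R Y q)) (at q)"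
      unfolding N_def by (rule has_derivative_scaleR[OF Deriv.has_derivative_inverse[OF Yi[OF that] Yi'] Y])
    from frechet_derivative_eqI[OF this] show ?thesis
      by (simp add: N_def algebra_simps)
  qed
  have dirY: "frechet_derivative Y (at q) (X q) = dirder X (push f Z) q" for X q
    by (simp add: dirder_def Y_def)
  have NZ: "frechet_derivative N (at q) (Z q) = 0" if q: "q \<in> V1" for q
  proof -
    have q0: "q \<in> V0" using q V1 by auto
    obtain l where "frechet_derivative Y (at q) (Z q) = l *\<^sub>R Y q"
      using par(3)[OF V0(4) q0] par(1)[OF V0(4) q0] dirY by (auto simp: Yq)
    then show ?thesis unfolding Nder[OF q] using Yi[OF q] by (simp add: N_def)
  qed
  have NE: "frechet_derivative N (at q0) E \<noteq> 0"
  proof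
    assume 0: "frechet_derivative N (at q0) E = 0"
    have sE: "smooth_on V0 (\<lambda>_. E)" by (rule smooth_on_const[OF V0(1)])
    obtain l where l: "frechet_derivative Y (at q0) E = l *\<^sub>R Y q0 + II q0 E (Z q0)"
      using par(3)[OF sE V0(3)] dirY[of q0 "\<lambda>_. E"] by (auto simp: Yq)
    have "frechet_derivative Y (at q0) E = (frechet_derivative Y (at q0) E $ i) *\<^sub>R N q0"
      using 0 Yi[OF V1(4)] unfolding Nder[OF V1(4)] by simp
    then have "II q0 E (Z q0) = ((frechet_derivative Y (at q0) E $ i) * inverse (Y q0 $ i) - l) *\<^sub>R Y q0"
      using l unfolding N_def by (metis (no_types, lifting) add_diff_cancel_left' diff_add_cancel scaleR_diff_left scaleR_scaleR)
    also have "\<dots> \<in> tangent_plane f q0"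
      unfolding Yq by (intro subspace_scale subspace_tangent_plane assms df_in)
    finally show False using par(2)[OF sE V0(3)] by simp
  qed
  then obtain j where j: "frechet_derivative N (at q0) E $ j \<noteq> 0" by (auto simp: vec_eq_iff)
  define \<Phi> where "\<Phi> q = (N q $ j, f q $ i)" for q
  have s\<Phi>: "smooth_on V1 \<Phi>"
    unfolding \<Phi>_def by (intro smooth_intros V1(1) sN smooth_on_subset[OF smooth_f V1(3)])
  have \<Phi>der: "frechet_derivative \<Phi> (at q) v = (frechet_derivative N (at q) v $ j, df q v $ i)" if "q \<in> V1" for q v
  proof -
    have "(\<Phi> has_derivative (\<lambda>v. (frechet_derivative N (at q) v $ j, df q v $ i))) (at q)"
      unfolding \<Phi>_def
      by (intro has_derivative_Pair bounded_linear.has_derivative[OF bounded_linear_vec_nth]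
          smooth_on_has_derivative[OF sN that] smooth_on_has_derivative[OF smooth_f])
        (use that V1(3) in auto)
    from frechet_derivative_eqI[OF this] show ?thesis by simp
  qed
  have lin\<Phi>: "linear (frechet_derivative \<Phi> (at q0))"
    using smooth_on_has_derivative[OF s\<Phi> V1(4)] by (rule has_derivative_linear)
  have "inj (frechet_derivative \<Phi> (at q0))"
    unfolding linear_injective_0[OF lin\<Phi>]
  proof (intro allI impI)
    fix v assume v: "frechet_derivative \<Phi> (at q0) v = 0"
    obtain k l where kl: "v = k *\<^sub>R E + l *\<^sub>R Z q0" using V0(5)[OF V0(3)] by blast
    have "linear (frechet_derivative N (at q0))"
      using smooth_on_has_derivative[OF sN V1(4)] by (rule has_derivative_linear)
    then have "frechet_derivative N (at q0) v = k *\<^sub>R frechet_derivative N (at q0) E"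
      unfolding kl using NZ[OF V1(4)] by (simp add: linear_add linear_cmul)
    then have "k = 0" using v j unfolding \<Phi>der[OF V1(4)] by (simp add: prod_eq_iff)
    then have "df q0 v = l *\<^sub>R Y q0" using kl linear_cmul[OF linear_df[OF assms]] by (simp add: Yq)
    then have "l = 0" using v i unfolding \<Phi>der[OF V1(4)] by (simp add: prod_eq_iff)
    then show "v = 0" using kl \<open>k = 0\<close> by simp
  qed
  then obtain U' V' \<Psi> where U': "open U'" "U' \<subseteq> V1" "q0 \<in> U'" "open V'" "homeomorphism U' V' \<Phi> \<Psi>" "smooth_on V' \<Psi>"
    by (rule smooth_local_inverse_plane[OF V1(1) s\<Phi> V1(4)])
  have \<Phi>\<Psi>: "\<Psi> (\<Phi> q) = q" "\<Phi> q \<in> V'" if "q \<in> U'" for q using U'(5) that by (auto simp: homeomorphism_def)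
  have \<Psi>\<Phi>: "\<Phi> (\<Psi> y) = y" "\<Psi> y \<in> U'" if "y \<in> V'" for y using U'(5) that by (auto simp: homeomorphism_def)
  have \<Psi>v: "frechet_derivative \<Psi> (at y) (0,1) = inverse (Y (\<Psi> y) $ i) *\<^sub>R Z (\<Psi> y)" if y: "y \<in> V'" for y
  proof -
    let ?q = "\<Psi> y"
    have q: "?q \<in> U'" "?q \<in> V1" using \<Psi>\<Phi>(2)[OF y] U'(2) by auto
    have h\<Psi>: "(\<Psi> has_derivative frechet_derivative \<Psi> (at y)) (at y)"
      by (rule smooth_on_has_derivative[OF U'(6) y])
    have h\<Phi>: "(\<Phi> has_derivative frechet_derivative \<Phi> (at ?q)) (at ?q)"
      by (rule smooth_on_has_derivative[OF s\<Phi> q(2)])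
    have "((\<lambda>q. \<Psi> (\<Phi> q)) has_derivative (\<lambda>v. frechet_derivative \<Psi> (at y) (frechet_derivative \<Phi> (at ?q) v))) (at ?q)"
      using has_derivative_compose[OF h\<Phi>, of \<Psi>] h\<Psi> \<Psi>\<Phi>(1)[OF y] by simp
    then have "((\<lambda>q. q) has_derivative (\<lambda>v. frechet_derivative \<Psi> (at y) (frechet_derivative \<Phi> (at ?q) v))) (at ?q)"
      by (rule has_derivative_transform_within_open[OF _ U'(1) q(1)]) (rule \<Phi>\<Psi>(1))
    then have inv: "frechet_derivative \<Psi> (at y) (frechet_derivative \<Phi> (at ?q) v) = v" for v
      using has_derivative_unique[OF has_derivative_ident] by metis
    have "frechet_derivative \<Phi> (at ?q) (inverse (Y ?q $ i) *\<^sub>R Z ?q) = inverse (Y ?q $ i) *\<^sub>R frechet_derivative \<Phi> (at ?q) (Z ?q)"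
      by (rule linear_cmul[OF has_derivative_linear[OF h\<Phi>]])
    also have "\<dots> = (0, 1)" unfolding \<Phi>der[OF q(2)] NZ[OF q(2)] using Yi[OF q(2)] by (simp add: Yq)
    finally show ?thesis using inv by metis
  qed
  obtain u0 u1 v0 v1 where R: "\<Phi> q0 \<in> {u0<..<u1} \<times> {v0<..<v1}" "{u0<..<u1} \<times> {v0<..<v1} \<subseteq> V'"
    by (rule open_rectangle[OF U'(4) \<Phi>\<Psi>(2)[OF U'(3)]])
  let ?I = "{u0<..<u1}" and ?J = "{v0<..<v1}"
  define w where "w = f q0 $ i"
  have w: "w \<in> ?J" using R(1) by (auto simp: w_def \<Phi>_def)
  define \<beta> where "\<beta> u = N (\<Psi> (u, w))" for u
  define \<alpha> where "\<alpha> u = f (\<Psi> (u, w)) - w *\<^sub>R \<beta> u" for u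
  have along: "((\<lambda>v. g (\<Psi> (u, v))) has_vector_derivative
      frechet_derivative g (at (\<Psi> (u, v))) (inverse (Y (\<Psi> (u, v)) $ i) *\<^sub>R Z (\<Psi> (u, v)))) (at v)"
    if "u \<in> ?I" "v \<in> ?J" "smooth_on V1 g" for g :: "plane \<Rightarrow> real^4" and u v
  proof -
    have y: "(u, v) \<in> V'" using that R(2) by auto
    then have q: "\<Psi> (u, v) \<in> V1" using \<Psi>\<Phi>(2) U'(2) by blast
    have "((\<lambda>y. g (\<Psi> y)) has_derivative (\<lambda>h. frechet_derivative g (at (\<Psi> (u, v))) (frechet_derivative \<Psi> (at (u, v)) h))) (at (u, v))"
      by (rule has_derivative_compose[OF smooth_on_has_derivative[OF U'(6) y] smooth_on_has_derivative[OF that(3) q]])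
    from has_vector_derivative_snd[OF this] show ?thesis by (simp add: \<Psi>v[OF y])
  qed
  have N\<beta>: "N (\<Psi> (u, v)) = \<beta> u" if "u \<in> ?I" "v \<in> ?J" for u v
    unfolding \<beta>_def
  proof (rule constant_on_interval[OF _ that(2) w])
    fix t assume t: "t \<in> ?J"
    have "(u, t) \<in> V'" using that t R(2) by auto
    then have q: "\<Psi> (u, t) \<in> V1" using \<Psi>\<Phi>(2) U'(2) by blast
    have "frechet_derivative N (at (\<Psi> (u, t))) (inverse (Y (\<Psi> (u, t)) $ i) *\<^sub>R Z (\<Psi> (u, t))) = 0"
      using linear_cmul[OF has_derivative_linear[OF smooth_on_has_derivative[OF sN q]]] NZ[OF q] by simp
    then show "((\<lambda>v. N (\<Psi> (u, v))) has_vector_derivative 0) (at t)"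
      using along[OF that(1) t sN] by simp
  qed
  have f\<alpha>: "f (\<Psi> (u, v)) = \<alpha> u + v *\<^sub>R \<beta> u" if "u \<in> ?I" "v \<in> ?J" for u v
  proof -
    have "f (\<Psi> (u, v)) - v *\<^sub>R \<beta> u = f (\<Psi> (u, w)) - w *\<^sub>R \<beta> u"
    proof (rule constant_on_interval[OF _ that(2) w, of "\<lambda>v. f (\<Psi> (u, v)) - v *\<^sub>R \<beta> u"])
      fix t assume t: "t \<in> ?J"
      have "(u, t) \<in> V'" using that t R(2) by auto
      then have q: "\<Psi> (u, t) \<in> W" using \<Psi>\<Phi>(2) U'(2) V1(3) by blast
      have "df (\<Psi> (u, t)) (inverse (Y (\<Psi> (u, t)) $ i) *\<^sub>R Z (\<Psi> (u, t))) = \<beta> u"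
        using linear_cmul[OF linear_df[OF q]] N\<beta>[OF that(1) t] by (simp add: N_def Yq)
      then have "((\<lambda>v. f (\<Psi> (u, v))) has_vector_derivative \<beta> u) (at t)"
        using along[OF that(1) t smooth_on_subset[OF smooth_f V1(3)]] by simp
      then show "((\<lambda>v. f (\<Psi> (u, v)) - v *\<^sub>R \<beta> u) has_vector_derivative 0) (at t)"
        by (auto intro!: derivative_eq_intros)
    qed
    then show ?thesis by (simp add: \<alpha>_def algebra_simps)
  qed
  have s\<Psi>w: "smooth_on ?I (\<lambda>u. \<Psi> (u, w))"
    by (rule smooth_on_compose[OF U'(6)]) (use w R(2) U'(4) in \<open>auto intro!: smooth_intros\<close>)
  have into: "(\<lambda>u. \<Psi> (u, w)) ` ?I \<subseteq> V1" using w R(2) \<Psi>\<Phi>(2) U'(2) by blast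
  have s\<beta>: "smooth_on ?I \<beta>"
    unfolding \<beta>_def by (rule smooth_on_compose[OF sN s\<Psi>w _ V1(1) into]) simp
  have s\<alpha>: "smooth_on ?I \<alpha>"
    unfolding \<alpha>_def
    by (intro smooth_intros s\<beta> smooth_on_compose[OF smooth_f s\<Psi>w _ open_W]) (use into V1(3) in auto)
  define V where "V = \<Psi> ` (?I \<times> ?J)"
  have VU: "V = {q \<in> U'. \<Phi> q \<in> ?I \<times> ?J}"
    unfolding V_def
  proof (intro set_eqI iffI)
    fix q assume "q \<in> \<Psi> ` (?I \<times> ?J)"
    then show "q \<in> {q \<in> U'. \<Phi> q \<in> ?I \<times> ?J}" using \<Psi>\<Phi> R(2) by auto
  next
    fix q assume "q \<in> {q \<in> U'. \<Phi> q \<in> ?I \<times> ?J}"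
    then show "q \<in> \<Psi> ` (?I \<times> ?J)" using \<Phi>\<Psi>(1) by (metis (mono_tags, lifting) image_eqI mem_Collect_eq)
  qed
  have c\<Phi>: "continuous_on U' \<Phi>" using U'(5) by (simp add: homeomorphism_def)
  have "V = U' \<inter> \<Phi> -` (?I \<times> ?J)" unfolding VU by auto
  then have oV: "open V"
    using continuous_open_preimage[OF c\<Phi> U'(1), of "?I \<times> ?J"] by (simp add: open_Times)
  have img: "\<Phi> ` V = ?I \<times> ?J"
    unfolding V_def image_image using \<Psi>\<Phi>(1) R(2) by force
  have subV: "V \<subseteq> U'" by (auto simp: VU)
  have hom: "homeomorphism V (?I \<times> ?J) \<Phi> \<Psi>"
    by (rule homeomorphism_of_subsets[OF U'(5) subV _ img]) (rule R(2))
  show thesis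
  proof (rule that[OF oV _ _ _ _ hom s\<alpha> s\<beta>])
    show VW: "V \<subseteq> W" using subV U'(2) V1(3) by auto
    show "q0 \<in> V" using VU U'(3) R(1) by auto
    show "smooth_on V \<Phi>" using smooth_on_subset[OF s\<Phi>, of V] subV U'(2) by auto
    show "smooth_on (?I \<times> ?J) \<Psi>" by (rule smooth_on_subset[OF U'(6) R(2)])
  qed (rule f\<alpha>)
qed

end

section \<open>The structure equations of a ruled chart\<close>

text \<open>Otherwise \<open>der 1\<close> is rewritten to \<open>der (Suc 0)\<close>, which no fact about derivatives matches.\<close>
declare One_nat_def [simp del]

text \<open>The structure equations of \<open>x = \<alpha>(u) + v \<beta>(u)\<close> at one point, with transversal plane \<open>N\<close>.  The numbers \<open>p, q, r\<close> are
  \<open>\<phi>\<^sub>2\<^sub>1\<^sup>2\<close>, \<open>\<phi>\<^sub>1\<^sub>1\<^sup>1\<close>, \<open>\<phi>\<^sub>1\<^sub>1\<^sup>2\<close>, and the two spanning vectors are \<open>h(\<partial>\<^sub>u,\<partial>\<^sub>v)\<close> and \<open>h(\<partial>\<^sub>u,\<partial>\<^sub>u)\<close>.\<close>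
definition ruled_structure ::
  "(real \<Rightarrow> real^4) \<Rightarrow> (real \<Rightarrow> real^4) \<Rightarrow> real \<Rightarrow> real \<Rightarrow> (real^4) set \<Rightarrow> bool" where
  "ruled_structure \<alpha> \<beta> u v N \<longleftrightarrow>
    (let x\<^sub>u = der 1 \<alpha> u + v *\<^sub>R der 1 \<beta> u;
         x\<^sub>u\<^sub>u = der 2 \<alpha> u + v *\<^sub>R der 2 \<beta> u;
         x\<^sub>u\<^sub>u\<^sub>u = der 3 \<alpha> u + v *\<^sub>R der 3 \<beta> u
     in det4 x\<^sub>u (\<beta> u) (der 1 \<beta> u) x\<^sub>u\<^sub>u \<noteq> 0 \<and>
       (\<exists>p q r. N = span {der 1 \<beta> u - p *\<^sub>R \<beta> u, x\<^sub>u\<^sub>u - q *\<^sub>R x\<^sub>u - r *\<^sub>R \<beta> u} \<and>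
         (\<exists>k l. der 2 \<beta> u = (2 * p + q) *\<^sub>R der 1 \<beta> u + k *\<^sub>R x\<^sub>u + l *\<^sub>R \<beta> u) \<and>
         (\<exists>k l. x\<^sub>u\<^sub>u\<^sub>u = (3 * q) *\<^sub>R x\<^sub>u\<^sub>u + (3 * r) *\<^sub>R der 1 \<beta> u + k *\<^sub>R x\<^sub>u + l *\<^sub>R \<beta> u)))"

lemma der_1_der:
  "der 1 (der 1 c) = der 2 c" "der 1 (der 2 c) = der 3 c" "der 1 (der 3 c) = der 4 c"
  using der_Suc[of 1 c] der_Suc[of 2 c] der_Suc[of 3 c] by (simp_all add: fun_eq_iff der_1)

lemma has_derivative_ruled:
  assumes "(c has_vector_derivative c') (at (fst z))" "(d has_vector_derivative d') (at (fst z))"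
  shows "((\<lambda>z. c (fst z) + snd z *\<^sub>R d (fst z)) has_derivative
    (\<lambda>h. fst h *\<^sub>R (c' + snd z *\<^sub>R d') + snd h *\<^sub>R d (fst z))) (at (z::plane))"
proof -
  have comp: "((\<lambda>z. e (fst z)) has_derivative (\<lambda>h. fst h *\<^sub>R e')) (at z)"
    if "(e has_vector_derivative e') (at (fst z))" for e :: "real \<Rightarrow> 'a" and e'
    using has_derivative_compose[OF has_derivative_fst[OF has_derivative_ident] that[unfolded has_vector_derivative_def]] .
  have "((\<lambda>z. c (fst z) + snd z *\<^sub>R d (fst z)) has_derivative
    (\<lambda>h. fst h *\<^sub>R c' + (snd z *\<^sub>R (fst h *\<^sub>R d') + snd h *\<^sub>R d (fst z)))) (at z)"
    by (intro has_derivative_add has_derivative_scaleR comp assms has_derivative_snd has_derivative_ident)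
  then show ?thesis by (simp add: algebra_simps)
qed

context parallel_patch
begin

text \<open>Inserting \<open>h(Y,Z) = G - x\<^sub>*(\<nabla>\<^sub>Y Z)\<close> into \<open>\<nabla>h = 0\<close> expresses the third derivatives of the immersion modulo the tangent plane
  by values of \<open>h\<close> at the point, with no derivative of the connection left.\<close>
lemma parallel_third:
  assumes V: "open V" "V \<subseteq> W" "smooth_on V X" "smooth_on V Y" "smooth_on V Z" "q \<in> V"
    and G: "\<And>q. q \<in> V \<Longrightarrow> dirder Y (push f Z) q = G q" "G differentiable (at q)"
  shows "dirder X G q - II q (X q) (cov \<Gamma> Y Z q) - II q (cov \<Gamma> X Y q) (Z q) - II q (Y q) (cov \<Gamma> X Z q)
    \<in> tangent_plane f q"
proof -
  have qW: "q \<in> W" using V by auto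
  let ?C = "cov \<Gamma> Y Z"
  have sC: "smooth_on V ?C" by (rule smooth_cov[OF V(1,2,4,5)])
  have "dirder X (second_form f \<Gamma> Y Z) q = dirder X (\<lambda>q. G q - push f ?C q) q"
    unfolding dirder_def
    using frechet_derivative_cong_open[OF V(1,6), of "second_form f \<Gamma> Y Z" "\<lambda>q. G q - push f ?C q"] G(1)
    by (simp add: second_form_def)
  also have "\<dots> = dirder X G q - dirder X (push f ?C) q"
    unfolding dirder_def
    using frechet_derivative_eqI[OF has_derivative_diff[OF differentiable_imp_frechet[OF G(2)]
          has_derivative_push[OF V(1,2) sC V(6)]]]
      frechet_derivative_eqI[OF has_derivative_push[OF V(1,2) sC V(6)]] by simp
  also have "\<dots> = dirder X G q - II q (X q) (?C q) - df q (cov \<Gamma> X ?C q)"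
    using second_form_eq[OF V(1,2) sC V(6), of X] by (simp add: second_form_def push_def algebra_simps)
  finally have eq: "dirder X (second_form f \<Gamma> Y Z) q = dirder X G q - II q (X q) (?C q) - df q (cov \<Gamma> X ?C q)" .
  have "(dirder X (second_form f \<Gamma> Y Z) q - II q (cov \<Gamma> X Y q) (Z q) - II q (Y q) (cov \<Gamma> X Z q))
      + df q (cov \<Gamma> X ?C q) \<in> tangent_plane f q"
    by (intro subspace_add subspace_tangent_plane qW df_in parallel_mod_tangent[OF V])
  then show ?thesis unfolding eq by (simp add: algebra_simps)
qed

text \<open>The coordinate fields of the ruled coordinates are used as vector fields in the given chart, where their images are \<open>x\<^sub>u\<close> and
  \<open>\<beta>\<close>.  From \<open>x\<^sub>v\<^sub>v = 0\<close> one gets \<open>h(\<partial>\<^sub>v,\<partial>\<^sub>v) = 0\<close> and \<open>\<nabla>\<^sub>v \<partial>\<^sub>v = 0\<close>; then \<open>x\<^sub>v\<^sub>v\<^sub>u = 0\<close> makes \<open>\<nabla>\<^sub>u \<partial>\<^sub>v\<close> a multiple \<open>p\<close> of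
  \<open>\<partial>\<^sub>v\<close>; finally \<open>x\<^sub>u\<^sub>v\<^sub>u\<close> and \<open>x\<^sub>u\<^sub>u\<^sub>u\<close> give the two equations of \<^const>\<open>ruled_structure\<close>, with
  \<open>\<nabla>\<^sub>u \<partial>\<^sub>u = k \<partial>\<^sub>u + r \<partial>\<^sub>v\<close>.\<close>
lemma ruled_structure_local:
  assumes V: "open V" "V \<subseteq> W" and R: "open R"
    and s\<Phi>: "smooth_on V \<Phi>" and s\<Psi>: "smooth_on R \<Psi>"
    and \<Phi>\<Psi>: "\<And>q. q \<in> V \<Longrightarrow> \<Phi> q \<in> R \<and> \<Psi> (\<Phi> q) = q"
    and \<Psi>\<Phi>: "\<And>z. z \<in> R \<Longrightarrow> \<Psi> z \<in> V \<and> \<Phi> (\<Psi> z) = z"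
    and I: "open I" "smooth_on I \<alpha>" "smooth_on I \<beta>"
    and ruled: "\<And>u v. (u, v) \<in> R \<Longrightarrow> u \<in> I \<and> f (\<Psi> (u, v)) = \<alpha> u + v *\<^sub>R \<beta> u"
    and uv: "(u, v) \<in> R"
  shows "ruled_structure \<alpha> \<beta> u v (S (\<Psi> (u, v)))"
proof -
  define X where "X e q = frechet_derivative \<Psi> (at (\<Phi> q)) e" for e q
  have \<Phi>V: "\<Phi> ` V \<subseteq> R" using \<Phi>\<Psi> by auto
  have sX: "smooth_on V (X e)" for e
    unfolding X_def by (rule smooth_on_compose[OF smooth_on_frechet[OF s\<Psi>] s\<Phi> V(1) R \<Phi>V])
  have h\<Psi>: "(\<Psi> has_derivative frechet_derivative \<Psi> (at (\<Phi> q))) (at (\<Phi> q))" if "q \<in> V" for q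
    using smooth_on_has_derivative[OF s\<Psi>] \<Phi>\<Psi>[OF that] by blast
  have h\<Phi>: "(\<Phi> has_derivative frechet_derivative \<Phi> (at q)) (at q)" if "q \<in> V" for q
    by (rule smooth_on_has_derivative[OF s\<Phi> that])
  have d\<Phi>X: "frechet_derivative \<Phi> (at q) (X e q) = e" if q: "q \<in> V" for q e
  proof -
    have h\<Phi>': "(\<Phi> has_derivative frechet_derivative \<Phi> (at q)) (at (\<Psi> (\<Phi> q)))"
      using h\<Phi>[OF q] \<Phi>\<Psi>[OF q] by simp
    have "((\<lambda>z. \<Phi> (\<Psi> z)) has_derivative (\<lambda>h. frechet_derivative \<Phi> (at q) (frechet_derivative \<Psi> (at (\<Phi> q)) h))) (at (\<Phi> q))"
      by (rule has_derivative_compose[OF h\<Psi>[OF q] h\<Phi>'])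
    then have "((\<lambda>z. z) has_derivative (\<lambda>h. frechet_derivative \<Phi> (at q) (frechet_derivative \<Psi> (at (\<Phi> q)) h))) (at (\<Phi> q))"
      by (rule has_derivative_transform_within_open[OF _ R]) (use \<Phi>\<Psi>[OF q] \<Psi>\<Phi> in auto)
    then show ?thesis unfolding X_def using has_derivative_unique[OF has_derivative_ident] by metis
  qed
  have Xd\<Phi>: "frechet_derivative \<Psi> (at (\<Phi> q)) (frechet_derivative \<Phi> (at q) w) = w" if q: "q \<in> V" for q w
  proof -
    have "((\<lambda>q. \<Psi> (\<Phi> q)) has_derivative (\<lambda>h. frechet_derivative \<Psi> (at (\<Phi> q)) (frechet_derivative \<Phi> (at q) h))) (at q)"
      by (rule has_derivative_compose[OF h\<Phi>[OF q] h\<Psi>[OF q]])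
    then have "((\<lambda>z. z) has_derivative (\<lambda>h. frechet_derivative \<Psi> (at (\<Phi> q)) (frechet_derivative \<Phi> (at q) h))) (at q)"
      by (rule has_derivative_transform_within_open[OF _ V(1)]) (use \<Phi>\<Psi> q in auto)
    then show ?thesis using has_derivative_unique[OF has_derivative_ident] by metis
  qed
  have dirX: "dirder (X e) g q = G' e"
    if q: "q \<in> V" and g: "\<And>q. q \<in> V \<Longrightarrow> g q = G (\<Phi> q)" and G: "(G has_derivative G') (at (\<Phi> q))"
    for e q g G' and G :: "plane \<Rightarrow> real^4"
  proof -
    have "((\<lambda>q. G (\<Phi> q)) has_derivative (\<lambda>h. G' (frechet_derivative \<Phi> (at q) h))) (at q)"
      by (rule has_derivative_compose[OF h\<Phi>[OF q] G])
    from frechet_derivative_eqI[OF this]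
    have "frechet_derivative g (at q) = (\<lambda>h. G' (frechet_derivative \<Phi> (at q) h))"
      using frechet_derivative_cong_open[OF V(1) q g] by simp
    then show ?thesis by (simp add: dirder_def d\<Phi>X[OF q])
  qed
  let ?e = "(1,0) :: plane" and ?d = "(0,1) :: plane"
  define Y where "Y c d z = c (fst z) + snd z *\<^sub>R d (fst z)" for c d :: "real \<Rightarrow> real^4" and z :: plane
  \<comment> \<open>Lets the ruled-surface derivatives also cover \<open>x\<^sub>v = \<beta>\<close> and \<open>x\<^sub>u\<^sub>v = \<beta>'\<close>, with zero second curve.\<close>
  define zc where "zc = (\<lambda>u::real. 0 :: real^4)"
  have zc: "smooth_on I zc" "der k zc u = 0" for k u
  proof -
    show "smooth_on I zc" unfolding zc_def by (rule smooth_on_const[OF I(1)])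
    have "der k zc = zc"
    proof (induction k)
      case (Suc k) then show ?case by (auto simp: der_Suc zc_def)
    qed simp
    then show "der k zc u = 0" by (simp add: zc_def)
  qed
  have inI: "fst (\<Phi> q) \<in> I" if "q \<in> V" for q using \<Phi>\<Psi>[OF that] ruled[of "fst (\<Phi> q)" "snd (\<Phi> q)"] by simp
  have Yder: "(Y c d has_derivative (\<lambda>h. fst h *\<^sub>R Y (der 1 c) (der 1 d) z + snd h *\<^sub>R d (fst z))) (at z)"
    if "smooth_on I c" "smooth_on I d" "fst z \<in> I" for c d z
    unfolding Y_def
    by (rule has_derivative_ruled) (rule smooth_on_has_vector_derivative; fact)+
  have dirY: "dirder (X ?e) g q = Y (der 1 c) (der 1 d) (\<Phi> q)" "dirder (X ?d) g q = d (fst (\<Phi> q))"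
    if q: "q \<in> V" and g: "\<And>q. q \<in> V \<Longrightarrow> g q = Y c d (\<Phi> q)" and cd: "smooth_on I c" "smooth_on I d" for q g c d
    using dirX[OF q g Yder[OF cd inI[OF q]]] by simp_all
  have pushX: "push f (X e) q = fst e *\<^sub>R Y (der 1 \<alpha>) (der 1 \<beta>) (\<Phi> q) + snd e *\<^sub>R \<beta> (fst (\<Phi> q))"
    if q: "q \<in> V" for q e
  proof -
    have "f q' = Y \<alpha> \<beta> (\<Phi> q')" if "q' \<in> V" for q'
      using \<Phi>\<Psi>[OF that] ruled[of "fst (\<Phi> q')" "snd (\<Phi> q')"] by (simp add: Y_def)
    from dirX[OF q this Yder[OF I(2,3) inI[OF q]]] show ?thesis by (simp add: push_def dirder_def)
  qed
  have sder: "smooth_on I (der k \<alpha>)" "smooth_on I (der k \<beta>)" for k by (intro smooth_on_der I)+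
  have Y0: "Y c zc z = c (fst z)" for c z by (simp add: Y_def zc_def)
  have push1: "push f (X ?e) q = Y (der 1 \<alpha>) (der 1 \<beta>) (\<Phi> q)" "push f (X ?d) q = Y \<beta> zc (\<Phi> q)"
    if "q \<in> V" for q using pushX[OF that, of ?e] pushX[OF that, of ?d] by (simp_all add: Y0)
  have Y11: "dirder (X ?e) (push f (X ?e)) q = Y (der 2 \<alpha>) (der 2 \<beta>) (\<Phi> q)"
    and Y21: "dirder (X ?d) (push f (X ?e)) q = Y (der 1 \<beta>) zc (\<Phi> q)"
    and Y12: "dirder (X ?e) (push f (X ?d)) q = Y (der 1 \<beta>) zc (\<Phi> q)"
    and Y22: "dirder (X ?d) (push f (X ?d)) q = 0" if "q \<in> V" for q
    using dirY[OF that push1(1) sder] dirY[OF that push1(2) I(3) zc(1)] zc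
    by (simp_all add: der_1_der Y0) (simp_all add: Y_def zc_def)
  define q where "q = \<Psi> (u, v)"
  have q: "q \<in> V" "q \<in> W" "\<Phi> q = (u, v)" using \<Psi>\<Phi>[OF uv] V by (auto simp: q_def)
  define x1 where "x1 = der 1 \<alpha> u + v *\<^sub>R der 1 \<beta> u"
  define x11 where "x11 = der 2 \<alpha> u + v *\<^sub>R der 2 \<beta> u"
  define x111 where "x111 = der 3 \<alpha> u + v *\<^sub>R der 3 \<beta> u"
  define b where "b = \<beta> u"
  define b1 where "b1 = der 1 \<beta> u"
  define b11 where "b11 = der 2 \<beta> u"
  have lin\<Psi>: "linear (frechet_derivative \<Psi> (at (\<Phi> q)))" using h\<Psi>[OF q(1)] has_derivative_linear by blast
  have Xlin: "frechet_derivative \<Psi> (at (\<Phi> q')) (k, l) = k *\<^sub>R X ?e q' + l *\<^sub>R X ?d q'" if "q' \<in> V" for k l q'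
    unfolding X_def using linear_plane_expand[OF has_derivative_linear[OF h\<Psi>[OF that]], of "(k, l)"] by simp
  have Xspan: "\<exists>k l. w = k *\<^sub>R X ?e q + l *\<^sub>R X ?d q" for w
    using Xd\<Phi>[OF q(1), of w] Xlin[OF q(1)] by (metis prod.collapse)
  have Xind: "X ?e q' \<noteq> X ?d q' \<and> independent {X ?e q', X ?d q'}" if "q' \<in> V" for q'
  proof (rule independent_pairI)
    fix k l assume "k *\<^sub>R X ?e q' + l *\<^sub>R X ?d q' = 0"
    then have "X (k, l) q' = 0" using Xlin[OF that, of k l] X_def[of "(k, l)" q'] by metis
    then have "(k, l) = frechet_derivative \<Phi> (at q') 0" using d\<Phi>X[OF that, of "(k, l)"] by simp
    then show "k = 0 \<and> l = 0" using linear_0[OF has_derivative_linear[OF h\<Phi>[OF that]]] by (simp add: zero_prod_def)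
  qed
  have dfX: "df q (X ?e q) = x1" "df q (X ?d q) = b"
    using push1[OF q(1)] by (simp_all add: push_def Y0 q(3) b_def) (simp add: Y_def q(3) x1_def)
  have T: "t \<in> tangent_plane f q \<longleftrightarrow> (\<exists>k l. t = k *\<^sub>R x1 + l *\<^sub>R b)" for t
    using tangent_combo[OF q(2) Xspan] dfX by simp
  have Yq: "Y (der 2 \<alpha>) (der 2 \<beta>) (\<Phi> q) = x11" "Y (der 1 \<beta>) zc (\<Phi> q) = b1"
    by (simp_all add: Y0 q(3) b1_def) (simp add: Y_def q(3) x11_def)
  have ff: "frame_form f (X ?e) (X ?d) (X ?e) (X ?e) q = det4 x1 b x11 b1"
    "frame_form f (X ?e) (X ?d) (X ?e) (X ?d) q = 0"
    "frame_form f (X ?e) (X ?d) (X ?d) (X ?e) q = 0"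
    "frame_form f (X ?e) (X ?d) (X ?d) (X ?d) q = 0"
    unfolding frame_form_def Y11[OF q(1)] Y12[OF q(1)] Y21[OF q(1)] Y22[OF q(1)] Yq
    by (simp_all add: push_def dfX)
  have "det4 x1 b x11 b1 \<noteq> 0"
    using rank_one_symmetric_2(2)[OF rank_one[OF V sX[of ?e] sX[of ?d] Xind q(1), unfolded ff]] by simp
  then have D: "det4 x1 b b1 x11 \<noteq> 0" using det4_swap(3)[of x1 b b1 x11] by simp
  have b1T: "k = 0" if "k *\<^sub>R b1 \<in> tangent_plane f q" for k
  proof -
    from that obtain m n where "k *\<^sub>R b1 = m *\<^sub>R x1 + n *\<^sub>R b" using T by blast
    then have "det4 x1 b (k *\<^sub>R b1) x11 = det4 x1 b (m *\<^sub>R x1 + n *\<^sub>R b) x11" by simp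
    then have "k * det4 x1 b b1 x11 = 0" unfolding det4_linear by simp
    then show ?thesis using D by simp
  qed
  define c where "c i j = cov \<Gamma> (X i) (X j) q" for i j
  have sf: "II q (X i q) (X j q) = dirder (X i) (push f (X j)) q - df q (c i j)" for i j
    using second_form_eq[OF V sX q(1), of "X i" j] by (simp add: second_form_def push_def c_def)
  have T0: "s = 0" if "s \<in> S q" "s \<in> tangent_plane f q" for s using transversal[OF q(2)] that by blast
  have II22: "II q (X ?d q) (X ?d q) = 0"
  proof (rule T0[OF II_in[OF q(2)]])
    show "II q (X ?d q) (X ?d q) \<in> tangent_plane f q"
      unfolding sf Y22[OF q(1)] by (intro subspace_diff subspace_tangent_plane subspace_0 q df_in)
  qed
  then have "df q (c ?d ?d) = df q 0" unfolding sf Y22[OF q(1)] using linear_0[OF linear_df[OF q(2)]] by simp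
  then have c22: "c ?d ?d = 0" using df_inject[OF q(2)] by simp
  have II12: "II q (X ?e q) (X ?d q) = b1 - df q (c ?e ?d)"
    unfolding sf Y12[OF q(1)] Yq ..
  have diff: "(\<lambda>q. Y c d (\<Phi> q)) differentiable (at q)" if "smooth_on I c" "smooth_on I d" for c d
    using has_derivative_compose[OF h\<Phi>[OF q(1)] Yder[OF that inI[OF q(1)]]] by (rule differentiableI)
  obtain a p where ap: "c ?e ?d = a *\<^sub>R X ?e q + p *\<^sub>R X ?d q" using Xspan by blast
  have dO: "dirder (X ?e) (\<lambda>q. 0) q = (0::real^4)" by (simp add: dirder_def)
  have "dirder (X ?e) (\<lambda>q. 0) q - II q (X ?e q) (c ?d ?d) - II q (c ?e ?d) (X ?d q) - II q (X ?d q) (c ?e ?d) \<in> tangent_plane f q"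
    unfolding c_def by (rule parallel_third[OF V sX sX sX q(1) Y22]) auto
  moreover have "II q (X ?d q) (c ?e ?d) = II q (c ?e ?d) (X ?d q)" by (rule II_sym[OF q(2)])
  moreover have "II q (c ?e ?d) (X ?d q) = a *\<^sub>R II q (X ?e q) (X ?d q)"
    unfolding ap II_combo_left[OF q(2)] II22 by simp
  moreover have "II q (X ?e q) (c ?d ?d) = 0"
    unfolding c22 using linear_0[OF II_linear_left[OF q(2), of "X ?e q"]] II_sym[OF q(2)] by metis
  ultimately have "- (a *\<^sub>R II q (X ?e q) (X ?d q) + a *\<^sub>R II q (X ?e q) (X ?d q)) \<in> tangent_plane f q"
    unfolding dO by simp
  then have "- (a *\<^sub>R II q (X ?e q) (X ?d q) + a *\<^sub>R II q (X ?e q) (X ?d q)) - (2 * a) *\<^sub>R df q (c ?e ?d) \<in> tangent_plane f q"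
    by (intro subspace_diff subspace_scale subspace_tangent_plane q df_in)
  moreover have "- (a *\<^sub>R II q (X ?e q) (X ?d q) + a *\<^sub>R II q (X ?e q) (X ?d q)) - (2 * a) *\<^sub>R df q (c ?e ?d) = (- 2 * a) *\<^sub>R b1"
    unfolding II12 by (simp add: vec_eq_iff algebra_simps)
  ultimately have "(- 2 * a) *\<^sub>R b1 \<in> tangent_plane f q" by simp
  from b1T[OF this] have "a = 0" by simp
  then have c12: "c ?e ?d = p *\<^sub>R X ?d q" using ap by simp
  obtain k r where c11: "c ?e ?e = k *\<^sub>R X ?e q + r *\<^sub>R X ?d q" using Xspan by blast
  have II12': "II q (X ?e q) (X ?d q) = b1 - p *\<^sub>R b"
    unfolding II12 c12 using linear_cmul[OF linear_df[OF q(2)]] dfX by simp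
  have II11: "II q (X ?e q) (X ?e q) = x11 - k *\<^sub>R x1 - r *\<^sub>R b"
    unfolding sf Y11[OF q(1)] Yq c11 df_combo[OF q(2)] dfX by simp
  have dY: "dirder (X ?e) (\<lambda>q. Y (der 1 \<beta>) zc (\<Phi> q)) q = b11"
    "dirder (X ?e) (\<lambda>q. Y (der 2 \<alpha>) (der 2 \<beta>) (\<Phi> q)) q = x111"
    using dirY(1)[OF q(1) refl sder(2) zc(1)] dirY(1)[OF q(1) refl sder] zc(2)
    by (simp_all add: der_1_der Y_def q(3) x111_def b11_def)
  have "dirder (X ?e) (\<lambda>q. Y (der 1 \<beta>) zc (\<Phi> q)) q - II q (X ?e q) (c ?e ?d) - II q (c ?e ?e) (X ?d q) - II q (X ?e q) (c ?e ?d) \<in> tangent_plane f q"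
    unfolding c_def by (rule parallel_third[OF V sX sX sX q(1) Y12 diff[OF sder(2) zc(1)]])
  then obtain m n where mn: "b11 - II q (X ?e q) (c ?e ?d) - II q (c ?e ?e) (X ?d q) - II q (X ?e q) (c ?e ?d) = m *\<^sub>R x1 + n *\<^sub>R b"
    unfolding dY T by blast
  have IIc: "II q (X ?e q) (c ?e ?d) = p *\<^sub>R (b1 - p *\<^sub>R b)" "II q (c ?e ?e) (X ?d q) = k *\<^sub>R (b1 - p *\<^sub>R b)"
    "II q (X ?e q) (c ?e ?e) = k *\<^sub>R (x11 - k *\<^sub>R x1 - r *\<^sub>R b) + r *\<^sub>R (b1 - p *\<^sub>R b)"
    using II_combo_right[OF q(2), of "X ?e q" 0 "X ?e q" p "X ?d q"] II22
    by (simp_all add: c12 c11 II_combo_left[OF q(2)] II_combo_right[OF q(2)] II12' II11)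
  have e1: "b11 = (2 * p + k) *\<^sub>R b1 + m *\<^sub>R x1 + (n - 2 * p * p - k * p) *\<^sub>R b"
    using mn[unfolded IIc] by (simp add: vec_eq_iff algebra_simps)
  have "dirder (X ?e) (\<lambda>q. Y (der 2 \<alpha>) (der 2 \<beta>) (\<Phi> q)) q - II q (X ?e q) (c ?e ?e) - II q (c ?e ?e) (X ?e q) - II q (X ?e q) (c ?e ?e) \<in> tangent_plane f q"
    unfolding c_def by (rule parallel_third[OF V sX sX sX q(1) Y11 diff[OF sder]])
  then obtain m' n' where mn': "x111 - II q (X ?e q) (c ?e ?e) - II q (X ?e q) (c ?e ?e) - II q (X ?e q) (c ?e ?e) = m' *\<^sub>R x1 + n' *\<^sub>R b"
    unfolding dY T II_sym[OF q(2), of "c ?e ?e"] by blast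
  have "x111 = (3 *\<^sub>R II q (X ?e q) (c ?e ?e)) + (m' *\<^sub>R x1 + n' *\<^sub>R b)"
    unfolding mn'[symmetric] using scaleR_left.add[of 1 2 "II q (X ?e q) (c ?e ?e)"] by (simp add: scaleR_2)
  then have e2: "x111 = (3 * k) *\<^sub>R x11 + (3 * r) *\<^sub>R b1 + (m' - 3 * k * k) *\<^sub>R x1 + (n' - 3 * k * r - 3 * r * p) *\<^sub>R b"
    unfolding IIc by (simp add: algebra_simps)
  obtain s\<^sub>1 s\<^sub>2 where S12: "S q = span {s\<^sub>1, s\<^sub>2}" using span_S[OF q(2)] by blast
  have "span {s\<^sub>1, s\<^sub>2} = span {b1 - p *\<^sub>R b, x11 - k *\<^sub>R x1 - r *\<^sub>R b}"
  proof (rule span_pair_eqI)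
    show "b1 - p *\<^sub>R b \<in> span {s\<^sub>1, s\<^sub>2}" "x11 - k *\<^sub>R x1 - r *\<^sub>R b \<in> span {s\<^sub>1, s\<^sub>2}"
      using II_in[OF q(2)] II12' II11 S12 by metis+
    fix m n assume 0: "m *\<^sub>R (b1 - p *\<^sub>R b) + n *\<^sub>R (x11 - k *\<^sub>R x1 - r *\<^sub>R b) = 0"
    have "det4 x1 b (m *\<^sub>R (b1 - p *\<^sub>R b) + n *\<^sub>R (x11 - k *\<^sub>R x1 - r *\<^sub>R b)) x11 = m * det4 x1 b b1 x11"
      "det4 x1 b b1 (m *\<^sub>R (b1 - p *\<^sub>R b) + n *\<^sub>R (x11 - k *\<^sub>R x1 - r *\<^sub>R b)) = n * det4 x1 b b1 x11"
      by simp_all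
    then show "m = 0 \<and> n = 0" unfolding 0 using D by simp
  qed
  then have Sq: "S (\<Psi> (u, v)) = span {b1 - p *\<^sub>R b, x11 - k *\<^sub>R x1 - r *\<^sub>R b}" using S12 by (simp add: q_def)
  show ?thesis
    unfolding ruled_structure_def Let_def
    using D Sq e1 e2 unfolding x1_def x11_def x111_def b_def b1_def b11_def by blast
qed

end

section \<open>Charts of the maximal atlas\<close>

lemma chart_inverse:
  assumes "is_chart \<kappa>"
  shows "q \<in> fst \<kappa> \<Longrightarrow> inv_into (fst \<kappa>) (snd \<kappa>) (snd \<kappa> q) = q"
    "p \<in> image_of \<kappa> \<Longrightarrow> snd \<kappa> (inv_into (fst \<kappa>) (snd \<kappa>) p) = p"
    "p \<in> image_of \<kappa> \<Longrightarrow> inv_into (fst \<kappa>) (snd \<kappa>) p \<in> fst \<kappa>"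
    "q \<in> fst \<kappa> \<Longrightarrow> snd \<kappa> q \<in> image_of \<kappa>"
  using assms by (auto simp: is_chart_def homeomorphism_def image_of_def inv_into_into f_inv_into_f)

lemma open_overlap:
  assumes "is_chart \<kappa>" "is_chart \<kappa>'"
  shows "open (overlap \<kappa> \<kappa>')"
proof -
  have "overlap \<kappa> \<kappa>' = fst \<kappa> \<inter> snd \<kappa> -` image_of \<kappa>'" by (auto simp: overlap_def)
  then show ?thesis
    using assms continuous_open_preimage[of "fst \<kappa>" "snd \<kappa>" "image_of \<kappa>'"]
    by (auto simp: is_chart_def homeomorphism_def)
qed

lemma transition_overlap:
  assumes "is_chart \<kappa>" "is_chart \<kappa>'" "q \<in> overlap \<kappa> \<kappa>'"
  shows "transition \<kappa> \<kappa>' q \<in> overlap \<kappa>' \<kappa>" "transition \<kappa>' \<kappa> (transition \<kappa> \<kappa>' q) = q"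
    "snd \<kappa>' (transition \<kappa> \<kappa>' q) = snd \<kappa> q"
  using assms chart_inverse[OF assms(1)] chart_inverse[OF assms(2)]
  by (auto simp: overlap_def transition_def)

lemma atlas_local_coordinates:
  assumes "smooth_surface \<A>" "\<kappa> \<in> \<A>"
  shows "local_coordinates \<A> \<kappa>"
  using assms by (auto simp: smooth_surface_def local_coordinates_def points_def)

lemma local_coordinates_reparametrize:
  assumes \<kappa>: "local_coordinates \<A> \<kappa>" and \<A>: "smooth_surface \<A>"
    and V: "open V" "V \<subseteq> fst \<kappa>" and R: "open R"
    and hom: "homeomorphism V R \<Phi> \<Psi>" and s\<Phi>: "smooth_on V \<Phi>" and s\<Psi>: "smooth_on R \<Psi>"
  shows "local_coordinates \<A> (R, snd \<kappa> \<circ> \<Psi>)"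
proof -
  let ?g = "snd \<kappa> \<circ> \<Psi>" and ?inv = "inv_into (fst \<kappa>) (snd \<kappa>)" and ?n = "(R, snd \<kappa> \<circ> \<Psi>)"
  have c: "is_chart \<kappa>" using \<kappa> by (simp add: local_coordinates_def)
  have hom\<kappa>: "homeomorphism (fst \<kappa>) (image_of \<kappa>) (snd \<kappa>) ?inv" using c by (simp add: is_chart_def)
  have \<Phi>\<Psi>: "\<Psi> (\<Phi> q) = q" "\<Phi> q \<in> R" if "q \<in> V" for q using hom that by (auto simp: homeomorphism_def)
  have \<Psi>\<Phi>: "\<Phi> (\<Psi> z) = z" "\<Psi> z \<in> V" if "z \<in> R" for z using hom that by (auto simp: homeomorphism_def)
  have img: "image_of ?n = snd \<kappa> ` V"
    using homeomorphism_image2[OF hom] by (simp add: image_of_def image_comp[symmetric] del: comp_apply)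
  have "snd \<kappa> ` V = image_of \<kappa> \<inter> ?inv -` V"
  proof (intro set_eqI iffI)
    fix p assume "p \<in> snd \<kappa> ` V"
    then show "p \<in> image_of \<kappa> \<inter> ?inv -` V" using V chart_inverse[OF c] by auto
  next
    fix p assume "p \<in> image_of \<kappa> \<inter> ?inv -` V"
    then show "p \<in> snd \<kappa> ` V" using chart_inverse(2)[OF c] by (metis IntE image_eqI vimageE)
  qed
  then have open_img: "open (image_of ?n)"
    using hom\<kappa> c continuous_open_preimage[of "image_of \<kappa>" ?inv V] V img
    by (auto simp: homeomorphism_def is_chart_def)
  have inj: "inj_on ?g R"
  proof (rule inj_on_inverseI[of R "\<Phi> \<circ> ?inv"])
    fix z assume "z \<in> R"
    then show "(\<Phi> \<circ> ?inv) (?g z) = z" using \<Psi>\<Phi>[of z] V chart_inverse(1)[OF c, of "\<Psi> z"] by auto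
  qed
  have inv: "inv_into R ?g (snd \<kappa> q) = \<Phi> q" if "q \<in> V" for q
    using inv_into_f_eq[OF inj, of "\<Phi> q" "snd \<kappa> q"] \<Phi>\<Psi>[OF that] by simp
  have "homeomorphism V (snd \<kappa> ` V) (snd \<kappa>) ?inv"
    by (rule homeomorphism_of_subsets[OF hom\<kappa> V(2), of "snd \<kappa> ` V"]) (use V chart_inverse(4)[OF c] in auto)
  then have "homeomorphism R (snd \<kappa> ` V) ?g (\<Phi> \<circ> ?inv)"
    by (rule homeomorphism_compose[OF homeomorphism_symD[OF hom]])
  then have homn: "homeomorphism R (image_of ?n) ?g (inv_into R ?g)"
    unfolding img
  proof (rule homeomorphism_cong)
    fix p assume "p \<in> snd \<kappa> ` V"
    then obtain q where q: "q \<in> V" "p = snd \<kappa> q" by blast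
    then show "inv_into R ?g p = (\<Phi> \<circ> ?inv) p" using inv[of q] V(2) chart_inverse(1)[OF c, of q] by auto
  qed auto
  have chart: "is_chart ?n" using R open_img homn by (simp add: is_chart_def)
  have "image_of ?n \<subseteq> points \<A>"
    using \<kappa> img V chart_inverse(4)[OF c] by (force simp: local_coordinates_def)
  moreover have "compatible ?n \<kappa>'" if "\<kappa>' \<in> \<A>" for \<kappa>'
  proof -
    have c': "is_chart \<kappa>'" using \<A> that by (simp add: smooth_surface_def)
    have comp: "smooth_on (overlap \<kappa> \<kappa>') (transition \<kappa> \<kappa>')" "smooth_on (overlap \<kappa>' \<kappa>) (transition \<kappa>' \<kappa>)"
      using \<kappa> that by (auto simp: local_coordinates_def compatible_def)
    have o: "open (overlap ?n \<kappa>')" "open (overlap \<kappa>' ?n)" by (rule open_overlap[OF chart c'], rule open_overlap[OF c' chart])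
    have "smooth_on (overlap ?n \<kappa>') (\<lambda>z. transition \<kappa> \<kappa>' (\<Psi> z))"
      by (rule smooth_on_compose[OF comp(1) smooth_on_subset[OF s\<Psi>] o(1) open_overlap[OF c c']])
        (use \<Psi>\<Phi> V in \<open>auto simp: overlap_def\<close>)
    moreover have "transition ?n \<kappa>' = (\<lambda>z. transition \<kappa> \<kappa>' (\<Psi> z))"
      by (simp add: transition_def fun_eq_iff)
    ultimately have 1: "smooth_on (overlap ?n \<kappa>') (transition ?n \<kappa>')" by simp
    have sub: "q \<in> overlap \<kappa>' \<kappa> \<and> transition \<kappa>' \<kappa> q \<in> V \<and> transition \<kappa>' ?n q = \<Phi> (transition \<kappa>' \<kappa> q)"
      if "q \<in> overlap \<kappa>' ?n" for q
    proof -
      obtain q' where q': "q' \<in> V" "snd \<kappa>' q = snd \<kappa> q'" using \<open>q \<in> overlap \<kappa>' ?n\<close> img by (auto simp: overlap_def)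
      then have "transition \<kappa>' \<kappa> q = q'" "transition \<kappa>' ?n q = \<Phi> q'"
        using V chart_inverse(1)[OF c, of q'] inv[of q'] by (auto simp: transition_def)
      then show ?thesis using q' V chart_inverse(4)[OF c, of q'] that by (auto simp: overlap_def)
    qed
    have "smooth_on (overlap \<kappa>' ?n) (\<lambda>q. \<Phi> (transition \<kappa>' \<kappa> q))"
      by (rule smooth_on_compose[OF s\<Phi> smooth_on_subset[OF comp(2)] o(2) V(1)]) (use sub in auto)
    then have "smooth_on (overlap \<kappa>' ?n) (transition \<kappa>' ?n)"
      by (rule smooth_on_cong[OF o(2), rotated]) (use sub in auto)
    with 1 show ?thesis by (simp add: compatible_def)
  qed
  ultimately show ?thesis using chart by (simp add: local_coordinates_def)
qed

section \<open>Ruled charts\<close>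

definition ruled_chart ::
  "'m::{t2_space,second_countable_topology} chart set \<Rightarrow> ('m \<Rightarrow> real^4) \<Rightarrow> real \<Rightarrow> real \<Rightarrow> real \<Rightarrow> real \<Rightarrow>
     (plane \<Rightarrow> 'm) \<Rightarrow> (real \<Rightarrow> real^4) \<Rightarrow> (real \<Rightarrow> real^4) \<Rightarrow> bool" where
  "ruled_chart \<A> x u0 u1 v0 v1 \<psi> \<alpha> \<beta> \<longleftrightarrow>
     local_coordinates \<A> ({u0<..<u1} \<times> {v0<..<v1}, \<psi>) \<and>
     smooth_on {u0<..<u1} \<alpha> \<and> smooth_on {u0<..<u1} \<beta> \<and>
     (\<forall>u\<in>{u0<..<u1}. \<forall>v\<in>{v0<..<v1}. x (\<psi> (u, v)) = \<alpha> u + v *\<^sub>R \<beta> u)"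

text \<open>The new coordinates are \<open>(s(u), (v - w(u)) / l(u))\<close>, and \<open>S\<close> is the local inverse of \<open>s\<close>.\<close>
lemma ruled_chart_reparametrize:
  assumes \<A>: "smooth_surface \<A>" and rc: "ruled_chart \<A> x u0 u1 v0 v1 \<psi> \<alpha> \<beta>"
    and I: "open I" "I \<subseteq> {u0<..<u1}" "u \<in> I" and v: "v \<in> {v0<..<v1}"
    and sm: "smooth_on I s" "smooth_on I l" "smooth_on I w"
    and nz: "der 1 s u \<noteq> 0" "\<And>u. u \<in> I \<Longrightarrow> l u \<noteq> 0"
  obtains t0 t1 y0 y1 \<psi>' S where
    "ruled_chart \<A> x t0 t1 y0 y1 \<psi>' (\<lambda>t. \<alpha> (S t) + w (S t) *\<^sub>R \<beta> (S t)) (\<lambda>t. l (S t) *\<^sub>R \<beta> (S t))"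
    "\<psi> (u, v) \<in> \<psi>' ` ({t0<..<t1} \<times> {y0<..<y1})" "smooth_on {t0<..<t1} S"
    "\<And>t. t \<in> {t0<..<t1} \<Longrightarrow> S t \<in> I \<and> s (S t) = t \<and> der 1 s (S t) \<noteq> 0 \<and>
        (S has_vector_derivative inverse (der 1 s (S t))) (at t)"
proof -
  let ?J = "{v0<..<v1}"
  obtain I2 T S where S: "open I2" "I2 \<subseteq> I" "u \<in> I2" "open T" "homeomorphism I2 T s S" "smooth_on T S"
    "\<And>u. u \<in> I2 \<Longrightarrow> der 1 s u \<noteq> 0"
    "\<And>t. t \<in> T \<Longrightarrow> (S has_vector_derivative inverse (der 1 s (S t))) (at t)"
    by (rule smooth_local_inverse_real[OF I(1) sm(1) I(3) nz(1)]) (rule that; assumption)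
  have sS: "S (s a) = a" "s a \<in> T" if "a \<in> I2" for a using S(5) that by (auto simp: homeomorphism_def)
  have Ss: "s (S t) = t" "S t \<in> I2" if "t \<in> T" for t using S(5) that by (auto simp: homeomorphism_def)
  define \<Phi> where "\<Phi> z = (s (fst z), (snd z - w (fst z)) / l (fst z))" for z :: plane
  define \<Psi> where "\<Psi> z = (S (fst z), w (S (fst z)) + snd z * l (S (fst z)))" for z :: plane
  have cf: "smooth_on (A \<times> B) (\<lambda>z. g (fst z))" if "open A" "open B" "smooth_on A g"
    for A B :: "real set" and g :: "real \<Rightarrow> real"
    by (rule smooth_on_compose[OF that(3), of "A \<times> B" fst]) (use that in \<open>auto intro!: smooth_intros open_Times\<close>)
  have sI2: "smooth_on I2 s" "smooth_on I2 l" "smooth_on I2 w" using sm smooth_on_subset S(2) by blast+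
  have sT: "smooth_on T (\<lambda>t. l (S t))" "smooth_on T (\<lambda>t. w (S t))"
    by (rule smooth_on_compose[OF _ S(6,4,1)], use sI2 Ss in auto)+
  have s\<Phi>: "smooth_on (I2 \<times> ?J) \<Phi>"
    unfolding \<Phi>_def using nz(2) S(2) by (intro smooth_intros cf sI2 S(1) open_Times) auto
  have s\<Psi>: "smooth_on (T \<times> UNIV) \<Psi>"
    unfolding \<Psi>_def by (intro smooth_intros cf sT S(4,6) open_Times) auto
  have \<Phi>\<Psi>: "\<Psi> (\<Phi> z) = z" if "z \<in> I2 \<times> ?J" for z
    using that sS nz(2) S(2) by (auto simp: \<Phi>_def \<Psi>_def mem_Times_iff prod_eq_iff subset_iff)
  have \<Psi>\<Phi>: "\<Phi> (\<Psi> z) = z" if "z \<in> T \<times> UNIV" for z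
    using that Ss nz(2) S(2) by (auto simp: \<Phi>_def \<Psi>_def mem_Times_iff prod_eq_iff subset_iff)
  define R0 where "R0 = (T \<times> UNIV) \<inter> \<Psi> -` (I2 \<times> ?J)"
  have "open R0"
    unfolding R0_def
    by (rule continuous_open_preimage[OF smooth_on_continuous[OF s\<Psi>]]) (use S in \<open>auto intro: open_Times\<close>)
  moreover have uvIJ: "(u, v) \<in> I2 \<times> ?J" using S(3) v by simp
  then have "\<Phi> (u, v) \<in> R0" using \<Phi>\<Psi>[OF uvIJ] sS(2)[OF S(3)] by (simp add: R0_def) (simp add: \<Phi>_def)
  ultimately obtain t0 t1 y0 y1 where R: "\<Phi> (u, v) \<in> {t0<..<t1} \<times> {y0<..<y1}"
    "{t0<..<t1} \<times> {y0<..<y1} \<subseteq> R0" by (rule open_rectangle)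
  let ?R = "{t0<..<t1} \<times> {y0<..<y1}"
  define V where "V = (I2 \<times> ?J) \<inter> \<Phi> -` ?R"
  have V: "open V" "V \<subseteq> I2 \<times> ?J" "V \<subseteq> {u0<..<u1} \<times> ?J"
    unfolding V_def using continuous_open_preimage[OF smooth_on_continuous[OF s\<Phi>], of ?R] S(2) I(2)
      open_Times[OF S(1), of ?J] open_Times[of "{t0<..<t1}" "{y0<..<y1}"] by auto
  have RT: "?R \<subseteq> T \<times> UNIV" "t \<in> {t0<..<t1} \<Longrightarrow> t \<in> T" for t
  proof -
    show "?R \<subseteq> T \<times> UNIV" using R(2) by (auto simp: R0_def)
    moreover have "y \<in> {y0<..<y1}" if "y = snd (\<Phi> (u, v))" for y using R(1) that by (simp add: mem_Times_iff)
    ultimately show "t \<in> {t0<..<t1} \<Longrightarrow> t \<in> T" by blast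
  qed
  have s\<Phi>V: "smooth_on V \<Phi>" by (rule smooth_on_subset[OF s\<Phi> V(2)])
  have s\<Psi>R: "smooth_on ?R \<Psi>" by (rule smooth_on_subset[OF s\<Psi> RT(1)])
  have hom: "homeomorphism V ?R \<Phi> \<Psi>"
  proof (rule homeomorphismI)
    show "continuous_on V \<Phi>" "continuous_on ?R \<Psi>" using s\<Phi>V s\<Psi>R by (auto intro: smooth_on_continuous)
    show "\<Phi> ` V \<subseteq> ?R" by (auto simp: V_def)
    show "\<Psi> ` ?R \<subseteq> V"
    proof
      fix q assume "q \<in> \<Psi> ` ?R"
      then obtain z where z: "z \<in> ?R" "q = \<Psi> z" by blast
      then have "z \<in> R0" using R(2) by blast
      then show "q \<in> V" using z \<Psi>\<Phi>[of z] by (auto simp: V_def R0_def)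
    qed
    show "\<Psi> (\<Phi> z) = z" if "z \<in> V" for z using \<Phi>\<Psi> V(2) that by blast
    show "\<Phi> (\<Psi> z) = z" if "z \<in> ?R" for z using \<Psi>\<Phi> RT(1) that by blast
  qed
  have lc: "local_coordinates \<A> ({u0<..<u1} \<times> ?J, \<psi>)" using rc by (simp add: ruled_chart_def)
  have lc': "local_coordinates \<A> (?R, \<psi> \<circ> \<Psi>)"
    using local_coordinates_reparametrize[OF lc \<A> V(1) _ _ hom s\<Phi>V s\<Psi>R] V(3) by (simp add: open_Times)
  have sRS: "smooth_on {t0<..<t1} S" using RT(2) by (intro smooth_on_subset[OF S(6)]) auto
  have SI: "S ` {t0<..<t1} \<subseteq> {u0<..<u1}" using RT(2) Ss S(2) I(2) by blast
  have sab: "smooth_on {t0<..<t1} (\<lambda>t. \<alpha> (S t))" "smooth_on {t0<..<t1} (\<lambda>t. \<beta> (S t))"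
    by (rule smooth_on_compose[OF _ sRS _ _ SI], use rc in \<open>auto simp: ruled_chart_def\<close>)+
  have swl: "smooth_on {t0<..<t1} (\<lambda>t. w (S t))" "smooth_on {t0<..<t1} (\<lambda>t. l (S t))"
    using RT(2) by (auto intro!: smooth_on_subset[OF sT(1)] smooth_on_subset[OF sT(2)])
  show thesis
  proof (rule that)
    show "ruled_chart \<A> x t0 t1 y0 y1 (\<psi> \<circ> \<Psi>) (\<lambda>t. \<alpha> (S t) + w (S t) *\<^sub>R \<beta> (S t)) (\<lambda>t. l (S t) *\<^sub>R \<beta> (S t))"
      unfolding ruled_chart_def
    proof (intro conjI ballI lc' smooth_intros sab swl open_greaterThanLessThan)
      fix t y assume ty: "t \<in> {t0<..<t1}" "y \<in> {y0<..<y1}"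
      then have "(t, y) \<in> R0" using R(2) by blast
      then have "\<Psi> (t, y) \<in> I2 \<times> ?J" by (simp add: R0_def)
      then show "x ((\<psi> \<circ> \<Psi>) (t, y)) = \<alpha> (S t) + w (S t) *\<^sub>R \<beta> (S t) + y *\<^sub>R l (S t) *\<^sub>R \<beta> (S t)"
        using rc S(2) I(2) by (auto simp: ruled_chart_def \<Psi>_def algebra_simps subset_iff)
    qed
    show "\<psi> (u, v) \<in> (\<psi> \<circ> \<Psi>) ` ?R" using R(1) \<Phi>\<Psi>[OF uvIJ] by (metis comp_apply image_eqI)
    show "smooth_on {t0<..<t1} S" by (rule sRS)
    fix t assume "t \<in> {t0<..<t1}"
    then have t: "t \<in> T" by (rule RT(2))
    show "S t \<in> I \<and> s (S t) = t \<and> der 1 s (S t) \<noteq> 0 \<and> (S has_vector_derivative inverse (der 1 s (S t))) (at t)"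
      using Ss[OF t] S(2) S(7)[of "S t"] S(8)[OF t] by (simp add: subset_iff)
  qed
qed

section \<open>Parallel 1-degenerate surfaces are ruled\<close>

locale parallel_surface =
  fixes \<A> :: "'m::{t2_space,second_countable_topology} chart set"
    and nabla :: "'m chart \<Rightarrow> christoffel"
    and x :: "'m \<Rightarrow> real^4"
    and \<sigma> :: "'m \<Rightarrow> (real^4) set"
  assumes surface: "smooth_surface \<A>"
    and connection: "affine_connection \<A> nabla" and torsion: "torsion_free \<A> nabla"
    and immersion: "affine_immersion \<A> nabla x \<sigma>"
    and degenerate: "one_degenerate \<A> x"
    and parallel: "parallel_immersion \<A> nabla x \<sigma>"
begin

lemma patch_chart:
  assumes "\<kappa> \<in> \<A>"
  shows "parallel_patch (fst \<kappa>) (x \<circ> snd \<kappa>) (nabla \<kappa>) (\<sigma> \<circ> snd \<kappa>)"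
proof
  show W: "open (fst \<kappa>)" using surface assms by (simp add: smooth_surface_def is_chart_def)
  show "smooth_on (fst \<kappa>) (x \<circ> snd \<kappa>)"
    "\<And>q. q \<in> fst \<kappa> \<Longrightarrow> inj (frechet_derivative (x \<circ> snd \<kappa>) (at q))"
    using immersion assms by (auto simp: affine_immersion_def smooth_immersion_def)
  show "\<And>q. q \<in> fst \<kappa> \<Longrightarrow> bilinear (nabla \<kappa> q)" "\<And>a b. smooth_on (fst \<kappa>) (\<lambda>q. nabla \<kappa> q a b)"
    using connection assms by (auto simp: affine_connection_def)
  show "nabla \<kappa> q a b = nabla \<kappa> q b a" if "q \<in> fst \<kappa>" for q a b
  proof -
    have "cov (nabla \<kappa>) (\<lambda>_. a) (\<lambda>_. b) q - cov (nabla \<kappa>) (\<lambda>_. b) (\<lambda>_. a) q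
      = dirder (\<lambda>_. a) (\<lambda>_. b) q - dirder (\<lambda>_. b) (\<lambda>_. a) q"
      using torsion assms W that smooth_on_const[OF W] unfolding torsion_free_def by blast
    then show ?thesis by (simp add: cov_def dirder_def)
  qed
  show "\<exists>s\<^sub>1 s\<^sub>2. (\<sigma> \<circ> snd \<kappa>) q = span {s\<^sub>1, s\<^sub>2}" if "q \<in> fst \<kappa>" for q
  proof -
    have "rank2_bundle_along \<A> \<sigma>" using immersion by (simp add: affine_immersion_def)
    then have "\<exists>V s\<^sub>1 s\<^sub>2. open V \<and> q \<in> V \<and> V \<subseteq> fst \<kappa> \<and> smooth_on V s\<^sub>1 \<and> smooth_on V s\<^sub>2 \<and>
       (\<forall>z\<in>V. s\<^sub>1 z \<noteq> s\<^sub>2 z \<and> independent {s\<^sub>1 z, s\<^sub>2 z} \<and> \<sigma> (snd \<kappa> z) = span {s\<^sub>1 z, s\<^sub>2 z})"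
      unfolding rank2_bundle_along_def using assms that by simp
    then show ?thesis unfolding comp_apply by metis
  qed
  show "\<And>q. q \<in> fst \<kappa> \<Longrightarrow> tangent_plane (x \<circ> snd \<kappa>) q \<inter> (\<sigma> \<circ> snd \<kappa>) q = {0}"
    "\<And>q. q \<in> fst \<kappa> \<Longrightarrow> {t + s |t s. t \<in> tangent_plane (x \<circ> snd \<kappa>) q \<and> s \<in> (\<sigma> \<circ> snd \<kappa>) q} = UNIV"
    using immersion assms by (simp_all add: affine_immersion_def)
  show "\<And>V X Y q. open V \<Longrightarrow> V \<subseteq> fst \<kappa> \<Longrightarrow> smooth_on V X \<Longrightarrow> smooth_on V Y \<Longrightarrow> q \<in> V \<Longrightarrow>
      second_form (x \<circ> snd \<kappa>) (nabla \<kappa>) X Y q \<in> (\<sigma> \<circ> snd \<kappa>) q"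
    using immersion assms unfolding affine_immersion_def comp_apply[of \<sigma>] by blast
  show "\<And>V X Y Z q. open V \<Longrightarrow> V \<subseteq> fst \<kappa> \<Longrightarrow> smooth_on V X \<Longrightarrow> smooth_on V Y \<Longrightarrow> smooth_on V Z \<Longrightarrow> q \<in> V \<Longrightarrow>
      nabla_second_form (x \<circ> snd \<kappa>) (nabla \<kappa>) (\<sigma> \<circ> snd \<kappa>) X Y Z q = 0"
    using parallel assms unfolding parallel_immersion_def by blast
  show "\<And>V X\<^sub>1 X\<^sub>2 q. open V \<Longrightarrow> V \<subseteq> fst \<kappa> \<Longrightarrow> smooth_on V X\<^sub>1 \<Longrightarrow> smooth_on V X\<^sub>2 \<Longrightarrow>
      (\<And>q. q \<in> V \<Longrightarrow> X\<^sub>1 q \<noteq> X\<^sub>2 q \<and> independent {X\<^sub>1 q, X\<^sub>2 q}) \<Longrightarrow> q \<in> V \<Longrightarrow>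
      rank (vector [vector [frame_form (x \<circ> snd \<kappa>) X\<^sub>1 X\<^sub>2 X\<^sub>1 X\<^sub>1 q, frame_form (x \<circ> snd \<kappa>) X\<^sub>1 X\<^sub>2 X\<^sub>1 X\<^sub>2 q],
                    vector [frame_form (x \<circ> snd \<kappa>) X\<^sub>1 X\<^sub>2 X\<^sub>2 X\<^sub>1 q, frame_form (x \<circ> snd \<kappa>) X\<^sub>1 X\<^sub>2 X\<^sub>2 X\<^sub>2 q]] :: real^2^2) = 1"
    using degenerate assms unfolding one_degenerate_def Let_def by blast
qed

lemma ruled_chart_exists:
  assumes "p \<in> points \<A>"
  obtains u0 u1 v0 v1 \<psi> \<alpha> \<beta> where "ruled_chart \<A> x u0 u1 v0 v1 \<psi> \<alpha> \<beta>"
    "p \<in> \<psi> ` ({u0<..<u1} \<times> {v0<..<v1})"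
proof -
  obtain \<kappa> q where \<kappa>: "\<kappa> \<in> \<A>" "q \<in> fst \<kappa>" "p = snd \<kappa> q"
    using assms by (auto simp: points_def image_of_def)
  interpret parallel_patch "fst \<kappa>" "x \<circ> snd \<kappa>" "nabla \<kappa>" "\<sigma> \<circ> snd \<kappa>" by (rule patch_chart[OF \<kappa>(1)])
  obtain V u0 u1 v0 v1 \<Psi> \<alpha> \<beta> and \<Phi> :: "plane \<Rightarrow> plane" where *:
    "open V" "V \<subseteq> fst \<kappa>" "q \<in> V" "smooth_on V \<Phi>"
    "smooth_on ({u0<..<u1} \<times> {v0<..<v1}) \<Psi>"
    "homeomorphism V ({u0<..<u1} \<times> {v0<..<v1}) \<Phi> \<Psi>"
    "smooth_on {u0<..<u1} \<alpha>" "smooth_on {u0<..<u1} \<beta>"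
    "\<And>u v. u \<in> {u0<..<u1} \<Longrightarrow> v \<in> {v0<..<v1} \<Longrightarrow> (x \<circ> snd \<kappa>) (\<Psi> (u, v)) = \<alpha> u + v *\<^sub>R \<beta> u"
    by (rule ruled_coordinates[OF \<kappa>(2)]) (rule that; assumption)
  have "local_coordinates \<A> ({u0<..<u1} \<times> {v0<..<v1}, snd \<kappa> \<circ> \<Psi>)"
    using local_coordinates_reparametrize[OF atlas_local_coordinates[OF surface \<kappa>(1)] surface *(1,2) _ *(6,4,5)]
    by (simp add: open_Times)
  then have "ruled_chart \<A> x u0 u1 v0 v1 (snd \<kappa> \<circ> \<Psi>) \<alpha> \<beta>"
    using *(7-9) by (simp add: ruled_chart_def)
  moreover have "\<Phi> q \<in> {u0<..<u1} \<times> {v0<..<v1}" "\<Psi> (\<Phi> q) = q" using *(3,6) by (auto simp: homeomorphism_def)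
  then have "p \<in> (snd \<kappa> \<circ> \<Psi>) ` ({u0<..<u1} \<times> {v0<..<v1})" using \<kappa>(3) by (metis comp_apply image_eqI)
  ultimately show thesis by (rule that)
qed

lemma ruled_chart_structure:
  assumes rc: "ruled_chart \<A> x u0 u1 v0 v1 \<psi> \<alpha> \<beta>" and uv: "u \<in> {u0<..<u1}" "v \<in> {v0<..<v1}"
  shows "ruled_structure \<alpha> \<beta> u v (\<sigma> (\<psi> (u, v)))"
proof -
  let ?r = "({u0<..<u1} \<times> {v0<..<v1}, \<psi>)"
  have lc: "local_coordinates \<A> ?r" using rc by (simp add: ruled_chart_def)
  then have "\<psi> (u, v) \<in> points \<A>" using uv by (force simp: local_coordinates_def image_of_def)
  then obtain \<kappa> where \<kappa>: "\<kappa> \<in> \<A>" "\<psi> (u, v) \<in> image_of \<kappa>" by (auto simp: points_def)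
  interpret parallel_patch "fst \<kappa>" "x \<circ> snd \<kappa>" "nabla \<kappa>" "\<sigma> \<circ> snd \<kappa>" by (rule patch_chart[OF \<kappa>(1)])
  have c: "is_chart ?r" "is_chart \<kappa>" using lc surface \<kappa> by (auto simp: local_coordinates_def smooth_surface_def)
  have comp: "smooth_on (overlap ?r \<kappa>) (transition ?r \<kappa>)" "smooth_on (overlap \<kappa> ?r) (transition \<kappa> ?r)"
    using lc \<kappa> by (auto simp: local_coordinates_def compatible_def)
  have uvo: "(u, v) \<in> overlap ?r \<kappa>" using uv \<kappa> by (simp add: overlap_def)
  have "ruled_structure \<alpha> \<beta> u v ((\<sigma> \<circ> snd \<kappa>) (transition ?r \<kappa> (u, v)))"
  proof (rule ruled_structure_local[OF open_overlap[OF c(2,1)] _ open_overlap[OF c] comp(2,1)])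
    show "overlap \<kappa> ?r \<subseteq> fst \<kappa>" by (auto simp: overlap_def)
    show "smooth_on {u0<..<u1} \<alpha>" "smooth_on {u0<..<u1} \<beta>" using rc by (auto simp: ruled_chart_def)
    fix a b assume ab: "(a, b) \<in> overlap ?r \<kappa>"
    then have "a \<in> {u0<..<u1}" "b \<in> {v0<..<v1}" by (auto simp: overlap_def)
    then show "a \<in> {u0<..<u1} \<and> (x \<circ> snd \<kappa>) (transition ?r \<kappa> (a, b)) = \<alpha> a + b *\<^sub>R \<beta> a"
      using rc transition_overlap(3)[OF c ab] by (simp add: ruled_chart_def)
  qed (use transition_overlap[OF c] transition_overlap[OF c(2,1)] uvo in auto)
  then show ?thesis using transition_overlap(3)[OF c uvo] by simp
qed

lemma ruled: "ruled_surface \<A> x"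
  unfolding ruled_surface_def
proof
  fix p assume "p \<in> points \<A>"
  then obtain u0 u1 v0 v1 \<psi> \<alpha> \<beta> where "ruled_chart \<A> x u0 u1 v0 v1 \<psi> \<alpha> \<beta>"
    "p \<in> \<psi> ` ({u0<..<u1} \<times> {v0<..<v1})" by (rule ruled_chart_exists)
  then show "\<exists>u0 u1 v0 v1 \<psi> \<alpha> \<beta>.
        local_coordinates \<A> ({u0<..<u1} \<times> {v0<..<v1}, \<psi>) \<and>
        p \<in> \<psi> ` ({u0<..<u1} \<times> {v0<..<v1}) \<and>
        smooth_on {u0<..<u1} \<alpha> \<and> smooth_on {u0<..<u1} \<beta> \<and>
        (\<forall>u\<in>{u0<..<u1}. \<forall>v\<in>{v0<..<v1}. x (\<psi> (u, v)) = \<alpha> u + v *\<^sub>R \<beta> u)"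
    unfolding ruled_chart_def by blast
qed

end

section \<open>Uniqueness of the connection coefficients\<close>

lemma det4_coefficients_unique:
  assumes "det4 x b c y \<noteq> 0"
    and "k\<^sub>1 *\<^sub>R x + k\<^sub>2 *\<^sub>R b + k\<^sub>3 *\<^sub>R c + k\<^sub>4 *\<^sub>R y = l\<^sub>1 *\<^sub>R x + l\<^sub>2 *\<^sub>R b + l\<^sub>3 *\<^sub>R c + l\<^sub>4 *\<^sub>R y"
  shows "k\<^sub>3 = l\<^sub>3" "k\<^sub>4 = l\<^sub>4"
proof -
  let ?k = "k\<^sub>1 *\<^sub>R x + k\<^sub>2 *\<^sub>R b + k\<^sub>3 *\<^sub>R c + k\<^sub>4 *\<^sub>R y"
  let ?l = "l\<^sub>1 *\<^sub>R x + l\<^sub>2 *\<^sub>R b + l\<^sub>3 *\<^sub>R c + l\<^sub>4 *\<^sub>R y"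
  have "det4 x b ?k y = det4 x b ?l y" "det4 x b c ?k = det4 x b c ?l" using assms(2) by auto
  then show "k\<^sub>3 = l\<^sub>3" "k\<^sub>4 = l\<^sub>4" using assms(1) by simp_all
qed

text \<open>The coefficients of \<open>\<beta>'\<close> and \<open>x\<^sub>u\<^sub>u\<close> are unique modulo the tangent plane, so any decomposition of \<open>\<beta>''\<close> and \<open>x\<^sub>u\<^sub>u\<^sub>u\<close>
  reveals \<open>2p + q\<close>, \<open>3q\<close> and \<open>3r\<close>.  Each normal form is obtained by exhibiting such decompositions.\<close>
lemma ruled_structure_coeffs:
  fixes \<alpha> \<beta> :: "real \<Rightarrow> real^4" and u v :: real
  defines "x\<^sub>u \<equiv> der 1 \<alpha> u + v *\<^sub>R der 1 \<beta> u" and "x\<^sub>u\<^sub>u \<equiv> der 2 \<alpha> u + v *\<^sub>R der 2 \<beta> u"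
  assumes rs: "ruled_structure \<alpha> \<beta> u v N"
    and \<beta>: "der 2 \<beta> u = m *\<^sub>R der 1 \<beta> u + k *\<^sub>R x\<^sub>u + l *\<^sub>R \<beta> u"
    and x: "der 3 \<alpha> u + v *\<^sub>R der 3 \<beta> u = Q *\<^sub>R x\<^sub>u\<^sub>u + R *\<^sub>R der 1 \<beta> u + k' *\<^sub>R x\<^sub>u + l' *\<^sub>R \<beta> u"
  shows "N = span {der 1 \<beta> u - ((m - Q / 3) / 2) *\<^sub>R \<beta> u, x\<^sub>u\<^sub>u - (Q / 3) *\<^sub>R x\<^sub>u - (R / 3) *\<^sub>R \<beta> u}"
proof -
  from rs obtain p q r k1 l1 k2 l2 where D: "det4 x\<^sub>u (\<beta> u) (der 1 \<beta> u) x\<^sub>u\<^sub>u \<noteq> 0"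
    and N: "N = span {der 1 \<beta> u - p *\<^sub>R \<beta> u, x\<^sub>u\<^sub>u - q *\<^sub>R x\<^sub>u - r *\<^sub>R \<beta> u}"
    and \<beta>': "der 2 \<beta> u = (2 * p + q) *\<^sub>R der 1 \<beta> u + k1 *\<^sub>R x\<^sub>u + l1 *\<^sub>R \<beta> u"
    and x': "der 3 \<alpha> u + v *\<^sub>R der 3 \<beta> u = (3 * q) *\<^sub>R x\<^sub>u\<^sub>u + (3 * r) *\<^sub>R der 1 \<beta> u + k2 *\<^sub>R x\<^sub>u + l2 *\<^sub>R \<beta> u"
    unfolding ruled_structure_def Let_def x\<^sub>u_def[symmetric] x\<^sub>u\<^sub>u_def[symmetric] by blast
  have "m = 2 * p + q"
    by (rule det4_coefficients_unique(1)[OF D, of k l m 0 k1 l1 _ 0])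
      (use \<beta> \<beta>' in \<open>simp add: ac_simps\<close>)
  moreover have "Q = 3 * q"
    by (rule det4_coefficients_unique(2)[OF D, of k' l' R Q k2 l2 "3 * r"])
      (use x x' in \<open>simp add: ac_simps\<close>)
  moreover have "R = 3 * r"
    by (rule det4_coefficients_unique(1)[OF D, of k' l' R Q k2 l2 "3 * r" "3 * q"])
      (use x x' in \<open>simp add: ac_simps\<close>)
  ultimately show ?thesis using N by simp
qed

section \<open>The normal forms\<close>

lemma ruled_chart_smooth:
  assumes "ruled_chart \<A> x u0 u1 v0 v1 \<psi> \<alpha> \<beta>"
  shows "smooth_on {u0<..<u1} \<alpha>" "smooth_on {u0<..<u1} \<beta>"
    "smooth_on {u0<..<u1} (der k \<alpha>)" "smooth_on {u0<..<u1} (der k \<beta>)"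
    "u \<in> {u0<..<u1} \<Longrightarrow> (der k \<alpha> has_vector_derivative der (Suc k) \<alpha> u) (at u)"
    "u \<in> {u0<..<u1} \<Longrightarrow> (der k \<beta> has_vector_derivative der (Suc k) \<beta> u) (at u)"
  using assms
  by (simp_all add: ruled_chart_def smooth_on_der smooth_on_der_has_vector_derivative[of "{u0<..<u1}"]
      del: greaterThanLessThan_iff)

lemma der_1_ln_abs:
  fixes D :: "real \<Rightarrow> real"
  assumes "(D has_vector_derivative D') (at u)" "D u \<noteq> 0"
  shows "der 1 (\<lambda>u. ln \<bar>D u\<bar>) u = D' / D u"
proof (rule der_1_eqI)
  have D: "(D has_real_derivative D') (at u)"
    using assms(1) by (simp add: has_real_derivative_iff_has_vector_derivative)
  have "((\<lambda>u. ln ((D u)\<^sup>2) / 2) has_real_derivative D' / D u) (at u)"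
    using assms(2) by (auto intro!: derivative_eq_intros D simp: field_simps power2_eq_square)
      (metis not_real_square_gt_zero)
  moreover have "ln ((D u)\<^sup>2) / 2 = ln \<bar>D u\<bar>" for u
    using ln_realpow[of "\<bar>D u\<bar>" 2] by (cases "D u = 0") simp_all
  ultimately show "((\<lambda>u. ln \<bar>D u\<bar>) has_vector_derivative D' / D u) (at u)"
    by (simp add: has_real_derivative_iff_has_vector_derivative)
qed

lemma der_1_der_shift: "der k (der 1 c) = der (Suc k) c"
proof (induction k)
  case (Suc k)
  show ?case by (rule ext) (metis der_Suc Suc)
qed (simp flip: One_nat_def)

lemma der_shift_on:
  assumes "open I" "\<And>u. u \<in> I \<Longrightarrow> der 1 c u = d u" "u \<in> I"
  shows "der (Suc k) c u = der k d u"
  unfolding der_1_der_shift[symmetric] by (rule der_cong_open[OF assms(1,2,3)])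

context parallel_surface
begin

text \<open>As \<open>\<beta>'' = -\<beta>\<close>, differentiating \<open>\<Delta>\<close> only affects \<open>\<alpha>''\<close>; hence \<open>\<Delta>'/\<Delta>\<close> is the coefficient \<open>T\<close> of \<open>\<alpha>''\<close> in \<open>\<alpha>'''\<close>.\<close>
lemma form_II_of_ruled_chart:
  assumes rc: "ruled_chart \<A> x u0 u1 v0 v1 \<psi> \<alpha> \<beta>" and J: "{v0<..<v1} \<noteq> {}"
    and ode: "\<And>u. u \<in> {u0<..<u1} \<Longrightarrow> der 2 \<beta> u = - \<beta> u"
  shows "form_II {u0<..<u1} {v0<..<v1} (\<lambda>q. x (\<psi> q)) (\<lambda>q. \<sigma> (\<psi> q))"
proof -
  let ?I = "{u0<..<u1}" and ?J = "{v0<..<v1}"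
  note s = ruled_chart_smooth(1,2)[OF rc] and sd = ruled_chart_smooth(3,4)[OF rc]
    and hd = ruled_chart_smooth(5,6)[OF rc]
  have \<beta>3: "der 3 \<beta> u = - der 1 \<beta> u" if u: "u \<in> ?I" for u
  proof -
    have "((\<lambda>u. - \<beta> u) has_vector_derivative - der 1 \<beta> u) (at u)"
      using has_vector_derivative_minus[OF hd(2)[OF u, of 0]] by (simp flip: One_nat_def)
    then have "(der 2 \<beta> has_vector_derivative - der 1 \<beta> u) (at u)"
      by (rule has_vector_derivative_transform_within_open[OF _ _ u]) (simp_all add: ode)
    then show ?thesis using der_Suc[of 2 \<beta> u] by (simp add: vector_derivative_at)
  qed
  define \<Delta> where "\<Delta> u = det4 (der 2 \<alpha> u) (der 1 \<alpha> u) (der 1 \<beta> u) (\<beta> u)" for u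
  have \<Delta>nz: "\<Delta> u \<noteq> 0" if u: "u \<in> ?I" for u
  proof -
    obtain v where v: "v \<in> ?J" using J by blast
    have "det4 (der 1 \<alpha> u + v *\<^sub>R der 1 \<beta> u) (\<beta> u) (der 1 \<beta> u) (der 2 \<alpha> u + v *\<^sub>R der 2 \<beta> u) \<noteq> 0"
      using ruled_chart_structure[OF rc u v] by (simp add: ruled_structure_def Let_def)
    then have "det4 (der 1 \<alpha> u) (\<beta> u) (der 1 \<beta> u) (der 2 \<alpha> u) \<noteq> 0" by (simp add: ode[OF u])
    then show ?thesis
      unfolding \<Delta>_def
      using det4_swap(1)[of "der 1 \<alpha> u" "der 2 \<alpha> u"] det4_swap(2)[of "der 1 \<alpha> u" "\<beta> u" "der 2 \<alpha> u"]
        det4_swap(3)[of "der 1 \<alpha> u" "\<beta> u" "der 1 \<beta> u" "der 2 \<alpha> u"]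
        det4_swap(3)[of "der 1 \<alpha> u" "der 2 \<alpha> u" "der 1 \<beta> u" "\<beta> u"] by auto
  qed
  define T where "T u = det4 (der 3 \<alpha> u) (der 1 \<alpha> u) (der 1 \<beta> u) (\<beta> u) / \<Delta> u" for u
  define a where "a u = det4 (der 2 \<alpha> u) (der 3 \<alpha> u) (der 1 \<beta> u) (\<beta> u) / \<Delta> u" for u
  define b where "b u = det4 (der 2 \<alpha> u) (der 1 \<alpha> u) (der 3 \<alpha> u) (\<beta> u) / \<Delta> u" for u
  define c where "c u = det4 (der 2 \<alpha> u) (der 1 \<alpha> u) (der 1 \<beta> u) (der 3 \<alpha> u) / \<Delta> u" for u
  have s\<Delta>: "smooth_on ?I \<Delta>" unfolding \<Delta>_def by (intro smooth_intros sd s) simp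
  have sabc: "smooth_on ?I a" "smooth_on ?I b" "smooth_on ?I c"
    unfolding a_def b_def c_def by (intro smooth_intros s\<Delta> sd s \<Delta>nz; simp)+
  have \<alpha>3: "der 3 \<alpha> u = T u *\<^sub>R der 2 \<alpha> u + a u *\<^sub>R der 1 \<alpha> u + b u *\<^sub>R der 1 \<beta> u + c u *\<^sub>R \<beta> u" if "u \<in> ?I" for u
    using det4_basis[OF \<Delta>nz[OF that, unfolded \<Delta>_def], of "der 3 \<alpha> u"]
    unfolding T_def a_def b_def c_def \<Delta>_def .
  have L: "der 1 (\<lambda>u. ln \<bar>\<Delta> u\<bar>) u = T u" if u: "u \<in> ?I" for u
  proof -
    have "(\<Delta> has_vector_derivative det4 (der 3 \<alpha> u) (der 1 \<alpha> u) (der 1 \<beta> u) (\<beta> u)) (at u)"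
      unfolding \<Delta>_def
      using has_vector_derivative_det4[OF hd(1)[OF u, of 2] hd(1)[OF u, of 1] hd(2)[OF u, of 1] hd(2)[OF u, of 0]]
      by (simp add: ode[OF u] numeral_2_eq_2[symmetric] numeral_3_eq_3[symmetric] flip: One_nat_def)
    from der_1_ln_abs[OF this \<Delta>nz[OF u]] show ?thesis by (simp add: T_def)
  qed
  have S: "\<sigma> (\<psi> (u, v)) = span
       {der 1 \<beta> u - (- 1/6 * T u) *\<^sub>R \<beta> u,
        der 2 \<alpha> u - (1/3 * T u) *\<^sub>R der 1 \<alpha> u - (v * (1/3 * T u)) *\<^sub>R der 1 \<beta> u
          - (v + 1/3 * (b u - v * a u - v)) *\<^sub>R \<beta> u}" if u: "u \<in> ?I" and v: "v \<in> ?J" for u v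
  proof -
    have "\<sigma> (\<psi> (u, v)) = span {der 1 \<beta> u - ((0 - T u / 3) / 2) *\<^sub>R \<beta> u,
        der 2 \<alpha> u + v *\<^sub>R der 2 \<beta> u - (T u / 3) *\<^sub>R (der 1 \<alpha> u + v *\<^sub>R der 1 \<beta> u) - ((b u - v * a u - v) / 3) *\<^sub>R \<beta> u}"
      by (rule ruled_structure_coeffs[OF ruled_chart_structure[OF rc u v], where k=0 and l="-1" and k'="a u" and l'="c u + v * T u"])
        (simp_all add: ode[OF u] \<beta>3[OF u] \<alpha>3[OF u] algebra_simps)
    moreover have "der 2 \<alpha> u + v *\<^sub>R der 2 \<beta> u - (T u / 3) *\<^sub>R (der 1 \<alpha> u + v *\<^sub>R der 1 \<beta> u) - ((b u - v * a u - v) / 3) *\<^sub>R \<beta> u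
      = der 2 \<alpha> u - (1/3 * T u) *\<^sub>R der 1 \<alpha> u - (v * (1/3 * T u)) *\<^sub>R der 1 \<beta> u
          - (v + 1/3 * (b u - v * a u - v)) *\<^sub>R \<beta> u"
      by (simp add: ode[OF u] vec_eq_iff field_simps)
    ultimately show ?thesis by simp
  qed
  show ?thesis
    unfolding form_II_def Let_def
    apply (rule exI[of _ \<alpha>], rule exI[of _ \<beta>], rule exI[of _ a], rule exI[of _ b], rule exI[of _ c])
    apply (intro conjI ballI s sabc)
    subgoal for u using \<Delta>nz[of u] by (simp add: \<Delta>_def)
    subgoal for u by (rule ode)
    subgoal for u using \<alpha>3[of u] L[of u] by (simp add: \<Delta>_def)
    subgoal for u v using rc by (simp add: ruled_chart_def)
    subgoal for u v using S[of u v] L[of u] unfolding \<Delta>_def by simp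
    done
qed

text \<open>The curve \<open>\<gamma>\<close> is \<open>\<beta>\<close>, and \<open>t\<close> is the constant \<open>\<beta>' - \<alpha>\<close>.\<close>
lemma form_I1_of_ruled_chart:
  assumes rc: "ruled_chart \<A> x u0 u1 v0 v1 \<psi> \<alpha> \<beta>" and J: "{v0<..<v1} \<noteq> {}"
    and ode: "\<And>u. u \<in> {u0<..<u1} \<Longrightarrow> der 2 \<beta> u = der 1 \<alpha> u"
  shows "\<exists>t. form_I1 {u0<..<u1} {v0<..<v1} (\<lambda>q. x (\<psi> q) + t) (\<lambda>q. \<sigma> (\<psi> q))"
proof -
  let ?I = "{u0<..<u1}" and ?J = "{v0<..<v1}"
  note s = ruled_chart_smooth(1,2)[OF rc] and sd = ruled_chart_smooth(3,4)[OF rc]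
    and hd = ruled_chart_smooth(5,6)[OF rc]
  obtain t where t: "\<And>u. u \<in> ?I \<Longrightarrow> \<alpha> u + t = der 1 \<beta> u"
  proof (cases "?I = {}")
    case False
    then obtain w where w: "w \<in> ?I" by blast
    have "der 1 \<beta> u - \<alpha> u = der 1 \<beta> w - \<alpha> w" if u: "u \<in> ?I" for u
    proof (rule constant_on_interval[OF _ u w, of "\<lambda>u. der 1 \<beta> u - \<alpha> u"])
      fix z assume z: "z \<in> ?I"
      have "((\<lambda>u. der 1 \<beta> u - der 0 \<alpha> u) has_vector_derivative der (Suc 1) \<beta> z - der (Suc 0) \<alpha> z) (at z)"
        by (intro has_vector_derivative_diff hd z)
      then show "((\<lambda>u. der 1 \<beta> u - \<alpha> u) has_vector_derivative 0) (at z)"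
        using ode[OF z] by (simp add: numeral_2_eq_2[symmetric] flip: One_nat_def)
    qed
    then show thesis by (intro that[of "der 1 \<beta> w - \<alpha> w"]) (metis diff_add_cancel add.commute)
  qed (rule that[of 0], simp)
  have \<alpha>: "der 1 \<alpha> u = der 2 \<beta> u" "der 2 \<alpha> u = der 3 \<beta> u" "der 3 \<alpha> u = der 4 \<beta> u" if u: "u \<in> ?I" for u
  proof -
    have "der (Suc k) \<alpha> u = der k (der 2 \<beta>) u" for k
      by (rule der_shift_on[OF open_greaterThanLessThan _ u]) (simp add: ode)
    from this[of 0] this[of 1] this[of 2]
    have *: "der 1 \<alpha> u = der 2 \<beta> u" "der 2 \<alpha> u = der 1 (der 2 \<beta>) u" "der 3 \<alpha> u = der 2 (der 2 \<beta>) u"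
      by (simp_all add: numeral_2_eq_2[symmetric] numeral_3_eq_3[symmetric] flip: One_nat_def)
    then show "der 1 \<alpha> u = der 2 \<beta> u" "der 2 \<alpha> u = der 3 \<beta> u" "der 3 \<alpha> u = der 4 \<beta> u"
      using der_1_der(1)[of "der 2 \<beta>"] by (simp_all add: der_1_der)
  qed
  define G where "G u = det4 (\<beta> u) (der 1 \<beta> u) (der 2 \<beta> u) (der 3 \<beta> u)" for u
  have Gnz: "G u \<noteq> 0" if u: "u \<in> ?I" for u
  proof -
    obtain v where v: "v \<in> ?J" using J by blast
    have "det4 (der 1 \<alpha> u + v *\<^sub>R der 1 \<beta> u) (\<beta> u) (der 1 \<beta> u) (der 2 \<alpha> u + v *\<^sub>R der 2 \<beta> u) \<noteq> 0"
      using ruled_chart_structure[OF rc u v] by (simp add: ruled_structure_def Let_def)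
    then have "det4 (der 2 \<beta> u) (\<beta> u) (der 1 \<beta> u) (der 3 \<beta> u) \<noteq> 0" by (simp add: \<alpha>[OF u])
    then show ?thesis
      unfolding G_def
      using det4_swap(1)[of "\<beta> u" "der 2 \<beta> u"] det4_swap(2)[of "\<beta> u" "der 1 \<beta> u" "der 2 \<beta> u"] by auto
  qed
  define T where "T u = det4 (\<beta> u) (der 1 \<beta> u) (der 2 \<beta> u) (der 4 \<beta> u) / G u" for u
  define a where "a u = det4 (\<beta> u) (der 1 \<beta> u) (der 4 \<beta> u) (der 3 \<beta> u) / G u" for u
  define b where "b u = det4 (\<beta> u) (der 4 \<beta> u) (der 2 \<beta> u) (der 3 \<beta> u) / G u" for u
  define c where "c u = det4 (der 4 \<beta> u) (der 1 \<beta> u) (der 2 \<beta> u) (der 3 \<beta> u) / G u" for u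
  have sG: "smooth_on ?I G" unfolding G_def by (intro smooth_intros sd s) simp
  have sabc: "smooth_on ?I a" "smooth_on ?I b" "smooth_on ?I c"
    unfolding a_def b_def c_def by (intro smooth_intros sG sd s Gnz; simp)+
  have \<beta>4: "der 4 \<beta> u = T u *\<^sub>R der 3 \<beta> u + a u *\<^sub>R der 2 \<beta> u + b u *\<^sub>R der 1 \<beta> u + c u *\<^sub>R \<beta> u" if "u \<in> ?I" for u
    using det4_basis[OF Gnz[OF that, unfolded G_def], of "der 4 \<beta> u"]
    unfolding T_def a_def b_def c_def G_def by (simp add: ac_simps)
  have L: "der 1 (\<lambda>u. ln \<bar>G u\<bar>) u = T u" if u: "u \<in> ?I" for u
  proof -
    have "(G has_vector_derivative det4 (\<beta> u) (der 1 \<beta> u) (der 2 \<beta> u) (der 4 \<beta> u)) (at u)"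
      unfolding G_def
      using has_vector_derivative_det4[OF hd(2)[OF u, of 0] hd(2)[OF u, of 1] hd(2)[OF u, of 2] hd(2)[OF u, of 3]]
      by (simp add: numeral_2_eq_2[symmetric] numeral_3_eq_3[symmetric] eval_nat_numeral(2)[symmetric] flip: One_nat_def)
    from der_1_ln_abs[OF this Gnz[OF u]] show ?thesis by (simp add: T_def)
  qed
  have S: "\<sigma> (\<psi> (u, v)) = span
       {der 1 \<beta> u - (- 1/6 * (T u + 4 * v)) *\<^sub>R \<beta> u,
        der 3 \<beta> u + (v - 1/3 * (T u + v)) *\<^sub>R der 2 \<beta> u - (v * (1/3 * (T u + v))) *\<^sub>R der 1 \<beta> u
          - (1/3 * (b u - v * a u + v^2 * (T u + v))) *\<^sub>R \<beta> u}" if u: "u \<in> ?I" and v: "v \<in> ?J" for u v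
  proof -
    have "\<sigma> (\<psi> (u, v)) = span {der 1 \<beta> u - ((- v - (T u + v) / 3) / 2) *\<^sub>R \<beta> u,
        der 2 \<alpha> u + v *\<^sub>R der 2 \<beta> u - ((T u + v) / 3) *\<^sub>R (der 1 \<alpha> u + v *\<^sub>R der 1 \<beta> u)
          - ((b u - v * a u + v^2 * (T u + v)) / 3) *\<^sub>R \<beta> u}"
      by (rule ruled_structure_coeffs[OF ruled_chart_structure[OF rc u v], where k=1 and l=0
            and k'="a u - v * (T u + v)" and l'="c u"])
        (simp_all add: \<alpha>[OF u] \<beta>4[OF u] algebra_simps power2_eq_square)
    moreover have "(- v - (T u + v) / 3) / 2 = - 1/6 * (T u + 4 * v)" by (simp add: field_simps)
    moreover have "der 2 \<alpha> u + v *\<^sub>R der 2 \<beta> u - ((T u + v) / 3) *\<^sub>R (der 1 \<alpha> u + v *\<^sub>R der 1 \<beta> u)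
          - ((b u - v * a u + v^2 * (T u + v)) / 3) *\<^sub>R \<beta> u
      = der 3 \<beta> u + (v - 1/3 * (T u + v)) *\<^sub>R der 2 \<beta> u - (v * (1/3 * (T u + v))) *\<^sub>R der 1 \<beta> u
          - (1/3 * (b u - v * a u + v^2 * (T u + v))) *\<^sub>R \<beta> u"
      by (simp add: \<alpha>[OF u] vec_eq_iff field_simps)
    ultimately show ?thesis by simp
  qed
  have "form_I1 ?I ?J (\<lambda>q. x (\<psi> q) + t) (\<lambda>q. \<sigma> (\<psi> q))"
    unfolding form_I1_def Let_def
    apply (rule exI[of _ \<beta>], rule exI[of _ a], rule exI[of _ b], rule exI[of _ c])
    apply (intro conjI ballI s sabc)
    subgoal for u using Gnz[of u] by (simp add: G_def)
    subgoal for u using \<beta>4[of u] L[of u] by (simp add: G_def)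
    subgoal for u v using rc t[of u] by (simp add: ruled_chart_def)
    subgoal for u v using S[of u v] L[of u] unfolding G_def by simp
    done
  then show ?thesis by blast
qed

text \<open>The curve \<open>\<gamma>\<close> is \<open>\<epsilon> (\<alpha> + t - \<beta>')\<close>, whose derivative is \<open>\<beta>\<close>.  One-degeneracy makes \<open>\<gamma>', \<gamma>'', \<gamma>''', \<gamma>''''\<close>
  independent, which gives \<open>c \<noteq> 0\<close>, but \<open>G \<noteq> 0\<close> depends on the position of the origin and is a hypothesis on \<open>t\<close>.\<close>
lemma form_I2_of_ruled_chart:
  assumes rc: "ruled_chart \<A> x u0 u1 v0 v1 \<psi> \<alpha> \<beta>" and J: "{v0<..<v1} \<noteq> {}"
    and \<epsilon>: "\<epsilon> \<in> {1, -1}"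
    and ode: "\<And>u. u \<in> {u0<..<u1} \<Longrightarrow> der 1 \<alpha> u = der 2 \<beta> u + \<epsilon> *\<^sub>R \<beta> u"
    and position: "\<And>u. u \<in> {u0<..<u1} \<Longrightarrow>
        det4 (\<epsilon> *\<^sub>R (\<alpha> u + t - der 1 \<beta> u)) (\<beta> u) (der 1 \<beta> u) (der 2 \<beta> u) \<noteq> 0"
  shows "form_I2 {u0<..<u1} {v0<..<v1} (\<lambda>q. x (\<psi> q) + t) (\<lambda>q. \<sigma> (\<psi> q))"
proof -
  let ?I = "{u0<..<u1}" and ?J = "{v0<..<v1}"
  define g where "g u = \<epsilon> *\<^sub>R (\<alpha> u + t - der 1 \<beta> u)" for u
  have s\<alpha>\<beta>: "smooth_on ?I \<alpha>" "smooth_on ?I \<beta>" using rc by (auto simp: ruled_chart_def)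
  have sg: "smooth_on ?I g" unfolding g_def by (intro smooth_intros s\<alpha>\<beta>; simp)
  have sd: "smooth_on ?I (der k g)" for k by (intro smooth_on_der sg; simp)
  have hd: "(der k g has_vector_derivative der (Suc k) g u) (at u)" if "u \<in> ?I" for k u
    using smooth_on_der_has_vector_derivative[OF _ sg that] by auto
  have \<epsilon>2: "\<epsilon> * \<epsilon> = 1" using \<epsilon> by auto
  have g1: "der 1 g u = \<beta> u" if u: "u \<in> ?I" for u
  proof (rule der_1_eqI)
    have "((\<lambda>u. \<epsilon> *\<^sub>R (\<alpha> u + t - der 1 \<beta> u)) has_vector_derivative \<epsilon> *\<^sub>R (der 1 \<alpha> u + 0 - der (Suc 1) \<beta> u)) (at u)"
      by (intro bounded_linear.has_vector_derivative[OF bounded_linear_scaleR_right] has_vector_derivative_diff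
          has_vector_derivative_add has_vector_derivative_const smooth_on_has_vector_derivative[OF s\<alpha>\<beta>(1) u]
          smooth_on_der_has_vector_derivative[OF _ s\<alpha>\<beta>(2) u]) simp
    then show "(g has_vector_derivative \<beta> u) (at u)"
      unfolding g_def using ode[OF u] \<epsilon>2 by simp
  qed
  have shift: "der (Suc k) g u = der k \<beta> u" if "u \<in> ?I" for k u
    by (rule der_shift_on[OF open_greaterThanLessThan g1 that])
  have g: "\<beta> u = der 1 g u" "der 1 \<beta> u = der 2 g u" "der 2 \<beta> u = der 3 g u" "der 3 \<beta> u = der 4 g u"
    if "u \<in> ?I" for u
    using g1[OF that] shift[OF that, of 1] shift[OF that, of 2] shift[OF that, of 3] by simp_all
  have \<alpha>0: "\<alpha> u + t = \<epsilon> *\<^sub>R g u + der 2 g u" if "u \<in> ?I" for u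
    using \<epsilon>2 g(2)[OF that] unfolding g_def by simp
  have \<alpha>: "der 1 \<alpha> u = der 3 g u + \<epsilon> *\<^sub>R der 1 g u" "der 2 \<alpha> u = der 4 g u + \<epsilon> *\<^sub>R der 2 g u"
    "der 3 \<alpha> u = der 5 g u + \<epsilon> *\<^sub>R der 3 g u" if u: "u \<in> ?I" for u
  proof -
    have 1: "der 1 \<alpha> u = der 3 g u + \<epsilon> *\<^sub>R der 1 g u" if "u \<in> ?I" for u using ode[OF that] g[OF that] by simp
    have comb: "((\<lambda>u. der k g u + \<epsilon> *\<^sub>R der l g u) has_vector_derivative der (Suc k) g u + \<epsilon> *\<^sub>R der (Suc l) g u) (at u)"
      if "u \<in> ?I" for k l u
      by (intro bounded_linear.has_vector_derivative[OF bounded_linear_scaleR_right] has_vector_derivative_add hd that)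
    have step: "der (Suc m) \<alpha> u = der (Suc k) g u + \<epsilon> *\<^sub>R der (Suc l) g u"
      if "u \<in> ?I" "\<And>u. u \<in> ?I \<Longrightarrow> der m \<alpha> u = der k g u + \<epsilon> *\<^sub>R der l g u" for m k l u
    proof -
      have "(der m \<alpha> has_vector_derivative der (Suc k) g u + \<epsilon> *\<^sub>R der (Suc l) g u) (at u)"
        by (rule has_vector_derivative_transform_within_open[OF comb[OF that(1)] _ that(1)]) (simp_all add: that(2))
      then show ?thesis by (simp add: der_Suc vector_derivative_at)
    qed
    have 2: "der 2 \<alpha> u = der 4 g u + \<epsilon> *\<^sub>R der 2 g u" if "u \<in> ?I" for u
      using step[OF that 1] by simp
    show "der 1 \<alpha> u = der 3 g u + \<epsilon> *\<^sub>R der 1 g u" "der 2 \<alpha> u = der 4 g u + \<epsilon> *\<^sub>R der 2 g u" by (rule 1[OF u], rule 2[OF u])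
    show "der 3 \<alpha> u = der 5 g u + \<epsilon> *\<^sub>R der 3 g u" using step[OF u 2] by simp
  qed
  define G where "G u = det4 (g u) (der 1 g u) (der 2 g u) (der 3 g u)" for u
  have Gnz: "G u \<noteq> 0" if u: "u \<in> ?I" for u
    using position[OF u] g[OF u] unfolding G_def by (simp add: g_def)
  define T where "T u = det4 (g u) (der 1 g u) (der 2 g u) (der 4 g u) / G u" for u
  define a where "a u = det4 (g u) (der 1 g u) (der 4 g u) (der 3 g u) / G u" for u
  define b where "b u = det4 (g u) (der 4 g u) (der 2 g u) (der 3 g u) / G u" for u
  define c where "c u = det4 (der 4 g u) (der 1 g u) (der 2 g u) (der 3 g u) / G u" for u
  have sG: "smooth_on ?I G" unfolding G_def by (intro smooth_intros sd sg) simp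
  have sabc: "smooth_on ?I a" "smooth_on ?I b" "smooth_on ?I c" "smooth_on ?I T"
    unfolding a_def b_def c_def T_def by (intro smooth_intros sG sd sg Gnz; simp)+
  have g4: "der 4 g u = T u *\<^sub>R der 3 g u + a u *\<^sub>R der 2 g u + b u *\<^sub>R der 1 g u + c u *\<^sub>R g u" if "u \<in> ?I" for u
    using det4_basis[OF Gnz[OF that, unfolded G_def], of "der 4 g u"]
    unfolding T_def a_def b_def c_def G_def by (simp add: ac_simps)
  have L: "der 1 (\<lambda>u. ln \<bar>G u\<bar>) u = T u" if u: "u \<in> ?I" for u
  proof -
    have "(G has_vector_derivative det4 (g u) (der 1 g u) (der 2 g u) (der 4 g u)) (at u)"
      unfolding G_def
      using has_vector_derivative_det4[OF hd[OF u, of 0] hd[OF u, of 1] hd[OF u, of 2] hd[OF u, of 3]]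
      by (simp flip: One_nat_def)
    from der_1_ln_abs[OF this Gnz[OF u]] show ?thesis by (simp add: T_def)
  qed
  have L2: "der 2 (\<lambda>u. ln \<bar>G u\<bar>) u = der 1 T u" if u: "u \<in> ?I" for u
    using der_shift_on[OF open_greaterThanLessThan L u, of 1] by simp
  have cnz: "c u \<noteq> 0" if u: "u \<in> ?I" for u
  proof
    assume "c u = 0"
    obtain v where v: "v \<in> ?J" using J by blast
    have "det4 (der 1 \<alpha> u + v *\<^sub>R der 1 \<beta> u) (\<beta> u) (der 1 \<beta> u) (der 2 \<alpha> u + v *\<^sub>R der 2 \<beta> u) \<noteq> 0"
      using ruled_chart_structure[OF rc u v] by (simp add: ruled_structure_def Let_def)
    then show False unfolding \<alpha>[OF u] g[OF u] g4[OF u] \<open>c u = 0\<close> by simp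
  qed
  have g5: "der 5 g u = der 1 T u *\<^sub>R der 3 g u + T u *\<^sub>R der 4 g u + der 1 a u *\<^sub>R der 2 g u + a u *\<^sub>R der 3 g u
      + der 1 b u *\<^sub>R der 1 g u + b u *\<^sub>R der 2 g u + der 1 c u *\<^sub>R g u + c u *\<^sub>R der 1 g u" if u: "u \<in> ?I" for u
  proof -
    have fd: "(h has_real_derivative der 1 h u) (at u)" if "smooth_on ?I h" for h
      using smooth_on_has_vector_derivative[OF that u] by (simp add: has_real_derivative_iff_has_vector_derivative)
    have "((\<lambda>u. T u *\<^sub>R der 3 g u + a u *\<^sub>R der 2 g u + b u *\<^sub>R der 1 g u + c u *\<^sub>R der 0 g u) has_vector_derivative
        (T u *\<^sub>R der (Suc 3) g u + der 1 T u *\<^sub>R der 3 g u) + (a u *\<^sub>R der (Suc 2) g u + der 1 a u *\<^sub>R der 2 g u)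
        + (b u *\<^sub>R der (Suc 1) g u + der 1 b u *\<^sub>R der 1 g u) + (c u *\<^sub>R der (Suc 0) g u + der 1 c u *\<^sub>R der 0 g u)) (at u)"
      by (intro has_vector_derivative_add has_vector_derivative_scaleR fd sabc hd u)
    then have "(der 4 g has_vector_derivative
        (T u *\<^sub>R der (Suc 3) g u + der 1 T u *\<^sub>R der 3 g u) + (a u *\<^sub>R der (Suc 2) g u + der 1 a u *\<^sub>R der 2 g u)
        + (b u *\<^sub>R der (Suc 1) g u + der 1 b u *\<^sub>R der 1 g u) + (c u *\<^sub>R der (Suc 0) g u + der 1 c u *\<^sub>R der 0 g u)) (at u)"
      by (rule has_vector_derivative_transform_within_open[OF _ _ u]) (simp_all add: g4)
    then have "der (Suc 4) g u = (T u *\<^sub>R der (Suc 3) g u + der 1 T u *\<^sub>R der 3 g u) + (a u *\<^sub>R der (Suc 2) g u + der 1 a u *\<^sub>R der 2 g u)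
        + (b u *\<^sub>R der (Suc 1) g u + der 1 b u *\<^sub>R der 1 g u) + (c u *\<^sub>R der (Suc 0) g u + der 1 c u *\<^sub>R der 0 g u)"
      by (simp only: der_Suc vector_derivative_at)
    then show ?thesis by (simp add: ac_simps flip: One_nat_def)
  qed
  define C where "C u = der 1 c u / c u" for u
  define R where "R u v = b u + der 1 a u - \<epsilon> * T u - (a u + \<epsilon>) * C u
      + v * (- der 1 T u + T u * C u - a u - 2 * \<epsilon>) + v^2 * (C u + T u) + v^3" for u v
  have S: "\<sigma> (\<psi> (u, v)) = span
       {der 2 g u - (- 1/6 * ((C u + T u) + 4 * v)) *\<^sub>R der 1 g u,
        (T u + v - 1/3 * ((C u + T u) + v)) *\<^sub>R der 3 g u
          + (a u + \<epsilon> - v * (1/3 * ((C u + T u) + v))) *\<^sub>R der 2 g u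
          + (b u - \<epsilon> * (1/3 * ((C u + T u) + v)) - 1/3 * R u v) *\<^sub>R der 1 g u + c u *\<^sub>R g u}"
    if u: "u \<in> ?I" and v: "v \<in> ?J" for u v
  proof -
    define k where "k = \<epsilon> + der 1 T u + a u - (T u + v) * (v + C u)"
    have c': "der 1 c u = C u * c u" using cnz[OF u] by (simp add: C_def)
    have "\<sigma> (\<psi> (u, v)) = span {der 1 \<beta> u - ((- v - (C u + T u + v) / 3) / 2) *\<^sub>R \<beta> u,
        der 2 \<alpha> u + v *\<^sub>R der 2 \<beta> u - ((C u + T u + v) / 3) *\<^sub>R (der 1 \<alpha> u + v *\<^sub>R der 1 \<beta> u)
          - (R u v / 3) *\<^sub>R \<beta> u}"
    proof (rule ruled_structure_coeffs[OF ruled_chart_structure[OF rc u v], where k=1 and l="- \<epsilon>"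
            and k'=k and l'="(T u + v) * b u + der 1 b u + c u - (C u + T u + v) * b u - k * \<epsilon>"])
      show "der 2 \<beta> u = - v *\<^sub>R der 1 \<beta> u + 1 *\<^sub>R (der 1 \<alpha> u + v *\<^sub>R der 1 \<beta> u) + - \<epsilon> *\<^sub>R \<beta> u"
        by (simp add: \<alpha>[OF u] g[OF u])
      show "der 3 \<alpha> u + v *\<^sub>R der 3 \<beta> u = (C u + T u + v) *\<^sub>R (der 2 \<alpha> u + v *\<^sub>R der 2 \<beta> u) + R u v *\<^sub>R der 1 \<beta> u
          + k *\<^sub>R (der 1 \<alpha> u + v *\<^sub>R der 1 \<beta> u)
          + ((T u + v) * b u + der 1 b u + c u - (C u + T u + v) * b u - k * \<epsilon>) *\<^sub>R \<beta> u"
        unfolding \<alpha>[OF u] g[OF u] g5[OF u] g4[OF u] c' k_def R_def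
        by (simp add: vec_eq_iff algebra_simps power2_eq_square power3_eq_cube)
    qed
    moreover have "(- v - (C u + T u + v) / 3) / 2 = - 1/6 * ((C u + T u) + 4 * v)" by (simp add: field_simps)
    moreover have "der 2 \<alpha> u + v *\<^sub>R der 2 \<beta> u - ((C u + T u + v) / 3) *\<^sub>R (der 1 \<alpha> u + v *\<^sub>R der 1 \<beta> u)
          - (R u v / 3) *\<^sub>R \<beta> u
      = (T u + v - 1/3 * ((C u + T u) + v)) *\<^sub>R der 3 g u
          + (a u + \<epsilon> - v * (1/3 * ((C u + T u) + v))) *\<^sub>R der 2 g u
          + (b u - \<epsilon> * (1/3 * ((C u + T u) + v)) - 1/3 * R u v) *\<^sub>R der 1 g u + c u *\<^sub>R g u"
      unfolding \<alpha>[OF u] g[OF u] g4[OF u] by (simp add: vec_eq_iff field_simps)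
    ultimately show ?thesis by (simp only: g[OF u])
  qed
  show ?thesis
    unfolding form_I2_def Let_def
    apply (rule exI[of _ \<epsilon>], rule exI[of _ g], rule exI[of _ a], rule exI[of _ b], rule exI[of _ c])
    apply (intro conjI ballI sg sabc \<epsilon>)
    subgoal for u using Gnz[of u] by (simp add: G_def)
    subgoal for u by (rule cnz)
    subgoal for u using g4[of u] L[of u] by (simp add: G_def)
    subgoal for u v using rc \<alpha>0[of u] g(1)[of u] by (simp add: ruled_chart_def algebra_simps)
    subgoal for u v using S[of u v] L[of u] L2[of u] unfolding G_def C_def R_def by simp
    done
qed

end

section \<open>Normalization\<close>

lemma open_interval:
  assumes "open A" "(u::real) \<in> A"
  obtains a b where "u \<in> {a<..<b}" "{a<..<b} \<subseteq> A"
proof -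
  obtain e where "e > 0" "ball u e \<subseteq> A" using assms open_contains_ball by blast
  then show thesis by (intro that[of "u - e" "u + e"]) (auto simp: ball_eq_greaterThanLessThan)
qed

lemma der_scaleR:
  fixes F :: "real \<Rightarrow> real" and b :: "real \<Rightarrow> 'a::real_normed_vector"
  assumes "open I" "smooth_on I F" "smooth_on I b" "u \<in> I"
  shows "der 1 (\<lambda>u. F u *\<^sub>R b u) u = F u *\<^sub>R der 1 b u + der 1 F u *\<^sub>R b u"
    "der 2 (\<lambda>u. F u *\<^sub>R b u) u = F u *\<^sub>R der 2 b u + (2 * der 1 F u) *\<^sub>R der 1 b u + der 2 F u *\<^sub>R b u"
proof -
  have 1: "((\<lambda>u. der k F u *\<^sub>R der l b u) has_vector_derivative
      der k F u *\<^sub>R der (Suc l) b u + der (Suc k) F u *\<^sub>R der l b u) (at u)" if "u \<in> I" for k l u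
    using has_vector_derivative_scaleR[of "der k F" "der (Suc k) F u" u UNIV "der l b" "der (Suc l) b u"]
      smooth_on_der_has_vector_derivative[OF assms(1,2) that] smooth_on_der_has_vector_derivative[OF assms(1,3) that]
    by (simp add: has_real_derivative_iff_has_vector_derivative)
  have d1: "der 1 (\<lambda>u. F u *\<^sub>R b u) u = F u *\<^sub>R der 1 b u + der 1 F u *\<^sub>R b u" if "u \<in> I" for u
    using 1[OF that, of 0 0] by (intro der_1_eqI) (simp flip: One_nat_def)
  then show "der 1 (\<lambda>u. F u *\<^sub>R b u) u = F u *\<^sub>R der 1 b u + der 1 F u *\<^sub>R b u" using assms(4) .
  have "der (Suc 1) (\<lambda>u. F u *\<^sub>R b u) u = der 1 (\<lambda>u. F u *\<^sub>R der 1 b u + der 1 F u *\<^sub>R b u) u"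
    by (rule der_shift_on[OF assms(1) d1 assms(4)])
  also have "\<dots> = (F u *\<^sub>R der 2 b u + der 1 F u *\<^sub>R der 1 b u) + (der 1 F u *\<^sub>R der 1 b u + der 2 F u *\<^sub>R b u)"
    using has_vector_derivative_add[OF 1[OF assms(4), of 0 1] 1[OF assms(4), of 1 0]]
    by (intro der_1_eqI) (simp flip: One_nat_def)
  finally show "der 2 (\<lambda>u. F u *\<^sub>R b u) u = F u *\<^sub>R der 2 b u + (2 * der 1 F u) *\<^sub>R der 1 b u + der 2 F u *\<^sub>R b u"
    using scaleR_left.add[of "der 1 F u" "der 1 F u" "der 1 b u"] by simp
qed

lemma der_1_chain:
  fixes c :: "real \<Rightarrow> 'a::real_normed_vector"
  assumes "smooth_on I c" "S t \<in> I" "(S has_vector_derivative k) (at t)"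
  shows "der 1 (\<lambda>t. c (S t)) t = k *\<^sub>R der 1 c (S t)"
  using vector_diff_chain_at[OF assms(3) smooth_on_has_vector_derivative[OF assms(1,2)]]
  by (intro der_1_eqI) (simp add: o_def)

lemma der_1_add:
  assumes "smooth_on I c" "smooth_on I d" "u \<in> I"
  shows "der 1 (\<lambda>u. c u + d u) u = der 1 c u + der 1 d u"
  by (intro der_1_eqI has_vector_derivative_add smooth_on_has_vector_derivative[OF assms(1,3)]
      smooth_on_has_vector_derivative[OF assms(2,3)])

definition normal_form_at ::
  "'m::{t2_space,second_countable_topology} chart set \<Rightarrow> ('m \<Rightarrow> real^4) \<Rightarrow> ('m \<Rightarrow> (real^4) set) \<Rightarrow> 'm \<Rightarrow> bool" where
  "normal_form_at \<A> x \<sigma> p \<longleftrightarrow> (\<exists>u0 u1 v0 v1 \<psi> (B :: real^4^4) t.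
        local_coordinates \<A> ({u0<..<u1} \<times> {v0<..<v1}, \<psi>) \<and>
        p \<in> \<psi> ` ({u0<..<u1} \<times> {v0<..<v1}) \<and>
        invertible B \<and>
        (let y = (\<lambda>q. B *v x (\<psi> q) + t);
             S = (\<lambda>q. (*v) B ` \<sigma> (\<psi> q))
         in form_I1 {u0<..<u1} {v0<..<v1} y S \<or>
            form_I2 {u0<..<u1} {v0<..<v1} y S \<or>
            form_II {u0<..<u1} {v0<..<v1} y S))"

lemma normal_form_atI:
  assumes "ruled_chart \<A> x u0 u1 v0 v1 \<psi> \<alpha> \<beta>"
    and "p \<in> \<psi> ` ({u0<..<u1} \<times> {v0<..<v1})"
    and "form_I1 {u0<..<u1} {v0<..<v1} (\<lambda>q. x (\<psi> q) + t) (\<lambda>q. \<sigma> (\<psi> q)) \<or>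
         form_I2 {u0<..<u1} {v0<..<v1} (\<lambda>q. x (\<psi> q) + t) (\<lambda>q. \<sigma> (\<psi> q)) \<or>
         form_II {u0<..<u1} {v0<..<v1} (\<lambda>q. x (\<psi> q) + t) (\<lambda>q. \<sigma> (\<psi> q))"
  shows "normal_form_at \<A> x \<sigma> p"
proof -
  have id: "(*v) (mat 1 :: real^4^4) ` A = A" for A by (simp add: image_def)
  have "local_coordinates \<A> ({u0<..<u1} \<times> {v0<..<v1}, \<psi>)" using assms(1) by (simp add: ruled_chart_def)
  moreover have "invertible (mat 1 :: real^4^4)" by (simp add: invertible_def exI[of _ "mat 1"])
  ultimately show ?thesis
    using assms(2,3) unfolding normal_form_at_def Let_def
    by (intro exI[of _ u0] exI[of _ u1] exI[of _ v0] exI[of _ v1] exI[of _ \<psi>] exI[of _ "mat 1"] exI[of _ t])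
      (simp add: id)
qed

lemma ruled_chart_restrict:
  assumes \<A>: "smooth_surface \<A>" and rc: "ruled_chart \<A> x u0 u1 v0 v1 \<psi> \<alpha> \<beta>"
    and sub: "{a<..<b} \<subseteq> {u0<..<u1}"
  shows "ruled_chart \<A> x a b v0 v1 \<psi> \<alpha> \<beta>"
proof -
  let ?R = "{a<..<b} \<times> {v0<..<v1}"
  have o: "open ?R" by (simp add: open_Times)
  have lc: "local_coordinates \<A> ({u0<..<u1} \<times> {v0<..<v1}, \<psi>)" using rc by (simp add: ruled_chart_def)
  have "homeomorphism ?R ?R (\<lambda>z. z) (\<lambda>z. z)" by (simp add: homeomorphism_def)
  then have "local_coordinates \<A> (?R, snd ({u0<..<u1} \<times> {v0<..<v1}, \<psi>) \<circ> (\<lambda>z. z))"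
    using sub by (intro local_coordinates_reparametrize[OF lc \<A> o _ o _ smooth_on_id[OF o] smooth_on_id[OF o]]) auto
  then have "local_coordinates \<A> (?R, \<psi>)" by (simp add: o_def)
  then show ?thesis
    using rc sub smooth_on_subset[OF _ sub] by (auto simp: ruled_chart_def subset_iff)
qed

lemma ruled_chart_image_openE:
  assumes rc: "ruled_chart \<A> x u0 u1 v0 v1 \<psi> \<alpha> \<beta>" and uv: "u \<in> {u0<..<u1}" "v \<in> {v0<..<v1}"
    and N: "open N" "\<psi> (u, v) \<in> N"
  obtains a b where "u \<in> {a<..<b}" "{a<..<b} \<subseteq> {u0<..<u1}" "\<And>u'. u' \<in> {a<..<b} \<Longrightarrow> \<psi> (u', v) \<in> N"
proof -
  have "continuous_on ({u0<..<u1} \<times> {v0<..<v1}) \<psi>"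
    using rc by (auto simp: ruled_chart_def local_coordinates_def is_chart_def homeomorphism_def)
  then have "continuous_on {u0<..<u1} (\<lambda>u. \<psi> (u, v))"
    by (rule continuous_on_compose2) (use uv in \<open>auto intro!: continuous_intros\<close>)
  then have "open ({u0<..<u1} \<inter> (\<lambda>u. \<psi> (u, v)) -` N)"
    using N(1) by (intro continuous_open_preimage) auto
  moreover have "u \<in> {u0<..<u1} \<inter> (\<lambda>u. \<psi> (u, v)) -` N" using uv N by simp
  ultimately obtain a b where "u \<in> {a<..<b}" "{a<..<b} \<subseteq> {u0<..<u1} \<inter> (\<lambda>u. \<psi> (u, v)) -` N"
    by (rule open_interval)
  then show thesis by (intro that[of a b]) auto
qed

context parallel_surface
begin

lemma ruled_chart_det:
  assumes "ruled_chart \<A> x u0 u1 v0 v1 \<psi> \<alpha> \<beta>" "u \<in> {u0<..<u1}" "v \<in> {v0<..<v1}"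
  shows "det4 (der 1 \<alpha> u + v *\<^sub>R der 1 \<beta> u) (\<beta> u) (der 1 \<beta> u) (der 2 \<alpha> u + v *\<^sub>R der 2 \<beta> u) \<noteq> 0"
  using ruled_chart_structure[OF assms] by (simp add: ruled_structure_def Let_def)

text \<open>The vector \<open>n = \<beta>\<^sub>i \<beta>' - \<beta>\<^sub>i' \<beta>\<close> satisfies \<open>n' = m n\<close>, so its direction \<open>E\<close> is constant.  Dividing \<open>\<beta>\<close> by \<open>\<beta>\<^sub>i\<close> gives an affine
  function of \<open>r = \<beta>\<^sub>j / \<beta>\<^sub>i\<close> with slope \<open>E\<close>, and normalizing that line, which avoids the origin, by
  the parameter \<open>arctan r\<close> turns it into \<open>cos t A0 + sin t E\<close>.\<close>
lemma normal_form_II: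
  assumes rc: "ruled_chart \<A> x u0 u1 v0 v1 \<psi> \<alpha> \<beta>" and uv: "u \<in> {u0<..<u1}" "v \<in> {v0<..<v1}"
    and ode: "\<And>u. u \<in> {u0<..<u1} \<Longrightarrow> der 2 \<beta> u = m u *\<^sub>R der 1 \<beta> u + g u *\<^sub>R \<beta> u"
  shows "normal_form_at \<A> x \<sigma> (\<psi> (u, v))"
proof -
  let ?I = "{u0<..<u1}"
  note s = ruled_chart_smooth(2)[OF rc] and sd = ruled_chart_smooth(4)[OF rc] and hd = ruled_chart_smooth(6)[OF rc]
  have hdi: "((\<lambda>u. der k \<beta> u $ i) has_real_derivative der (Suc k) \<beta> u $ i) (at u)" if "u \<in> ?I" for k u i
    using bounded_linear.has_vector_derivative[OF bounded_linear_vec_nth hd[OF that]]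
    by (simp add: has_real_derivative_iff_has_vector_derivative)
  note D = ruled_chart_det[OF rc uv]
  have "\<beta> u \<noteq> 0" using D by auto
  then obtain i where i: "\<beta> u $ i \<noteq> 0" by (auto simp: vec_eq_iff)
  define n where "n u = \<beta> u $ i *\<^sub>R der 1 \<beta> u - der 1 \<beta> u $ i *\<^sub>R \<beta> u" for u
  have "n u \<noteq> 0"
  proof
    assume "n u = 0"
    then have eq: "\<beta> u $ i *\<^sub>R der 1 \<beta> u = der 1 \<beta> u $ i *\<^sub>R \<beta> u" by (simp add: n_def)
    let ?d = "\<lambda>c. det4 (der 1 \<alpha> u + v *\<^sub>R der 1 \<beta> u) (\<beta> u) c (der 2 \<alpha> u + v *\<^sub>R der 2 \<beta> u)"
    have "\<beta> u $ i * ?d (der 1 \<beta> u) = ?d (\<beta> u $ i *\<^sub>R der 1 \<beta> u)" by (rule det4_linear(7)[symmetric])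
    also have "\<dots> = der 1 \<beta> u $ i * ?d (\<beta> u)" unfolding eq by (rule det4_linear(7))
    also have "?d (\<beta> u) = 0" by (rule det4_repeated(4))
    finally show False using D i by (simp only: mult_zero_right mult_eq_0_iff simp_thms)
  qed
  then obtain j where j: "n u $ j \<noteq> 0" by (auto simp: vec_eq_iff)
  have sn: "smooth_on ?I n" unfolding n_def by (intro smooth_intros s sd; simp)
  have o: "open {u \<in> ?I. \<beta> u $ i \<noteq> 0}" "open {u \<in> ?I. n u $ j \<noteq> 0}"
    by (intro open_nonzero smooth_on_continuous smooth_intros s sn; simp)+
  have "open ({u \<in> ?I. \<beta> u $ i \<noteq> 0} \<inter> {u \<in> ?I. n u $ j \<noteq> 0})" using o by blast
  moreover have "u \<in> {u \<in> ?I. \<beta> u $ i \<noteq> 0} \<inter> {u \<in> ?I. n u $ j \<noteq> 0}" using uv i j by simp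
  ultimately obtain a b where ab: "u \<in> {a<..<b}" "{a<..<b} \<subseteq> {u \<in> ?I. \<beta> u $ i \<noteq> 0} \<inter> {u \<in> ?I. n u $ j \<noteq> 0}"
    by (rule open_interval)
  let ?A = "{a<..<b}"
  have AI: "?A \<subseteq> ?I" using ab by auto
  have inA: "u \<in> ?I" "\<beta> u $ i \<noteq> 0" "n u $ j \<noteq> 0" if "u \<in> ?A" for u using ab that by auto
  have n': "(n has_vector_derivative m u *\<^sub>R n u) (at u)" if u: "u \<in> ?A" for u
  proof -
    note uI = inA(1)[OF u]
    have "(n has_vector_derivative (\<beta> u $ i *\<^sub>R der 2 \<beta> u + der 1 \<beta> u $ i *\<^sub>R der 1 \<beta> u)
        - (der 1 \<beta> u $ i *\<^sub>R der 1 \<beta> u + der 2 \<beta> u $ i *\<^sub>R \<beta> u)) (at u)"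
      unfolding n_def
      using hd[OF uI, of 0] hd[OF uI, of 1] hdi[OF uI, of 0] hdi[OF uI, of 1]
      by (intro has_vector_derivative_diff has_vector_derivative_scaleR) (simp_all flip: One_nat_def)
    moreover have "(\<beta> u $ i *\<^sub>R der 2 \<beta> u + der 1 \<beta> u $ i *\<^sub>R der 1 \<beta> u)
        - (der 1 \<beta> u $ i *\<^sub>R der 1 \<beta> u + der 2 \<beta> u $ i *\<^sub>R \<beta> u) = m u *\<^sub>R n u"
      unfolding ode[OF uI] n_def by (simp add: algebra_simps)
    ultimately show ?thesis by simp
  qed
  have nj': "((\<lambda>u. n u $ j) has_real_derivative m u * n u $ j) (at u)" if u: "u \<in> ?A" for u
    using bounded_linear.has_vector_derivative[OF bounded_linear_vec_nth n'[OF u]]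
    by (simp add: has_real_derivative_iff_has_vector_derivative)
  define E where "E = (1 / n u $ j) *\<^sub>R n u"
  have E: "(1 / n t $ j) *\<^sub>R n t = E" if t: "t \<in> ?A" for t
    unfolding E_def
  proof (rule constant_on_interval[OF _ t ab(1), of "\<lambda>t. (1 / n t $ j) *\<^sub>R n t"])
    fix t assume t: "t \<in> ?A"
    have "((\<lambda>t. 1 / n t $ j) has_real_derivative - (m t / n t $ j)) (at t)"
      using inA(3)[OF t] by (auto intro!: derivative_eq_intros nj'[OF t])
    from has_vector_derivative_scaleR[OF this n'[OF t]]
    show "((\<lambda>t. (1 / n t $ j) *\<^sub>R n t) has_vector_derivative 0) (at t)"
      using inA(3)[OF t] by simp
  qed
  define r where "r t = \<beta> t $ j / \<beta> t $ i" for t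
  have r': "(r has_real_derivative n t $ j / (\<beta> t $ i)\<^sup>2) (at t)" if t: "t \<in> ?A" for t
    unfolding r_def using hdi[OF inA(1)[OF t], of 0] inA(2)[OF t]
    by (auto intro!: derivative_eq_intros simp: n_def power2_eq_square algebra_simps simp flip: One_nat_def)
  define A0 where "A0 = (1 / \<beta> u $ i) *\<^sub>R \<beta> u - r u *\<^sub>R E"
  have A0: "(1 / \<beta> t $ i) *\<^sub>R \<beta> t - r t *\<^sub>R E = A0" if t: "t \<in> ?A" for t
    unfolding A0_def
  proof (rule constant_on_interval[OF _ t ab(1), of "\<lambda>t. (1 / \<beta> t $ i) *\<^sub>R \<beta> t - r t *\<^sub>R E"])
    fix t assume t: "t \<in> ?A"
    have 1: "((\<lambda>t. 1 / \<beta> t $ i) has_real_derivative - (der 1 \<beta> t $ i / (\<beta> t $ i)\<^sup>2)) (at t)"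
      using inA(2)[OF t] hdi[OF inA(1)[OF t], of 0 i]
      by (auto intro!: derivative_eq_intros simp: power2_eq_square simp flip: One_nat_def)
    have 2: "(\<beta> has_vector_derivative der 1 \<beta> t) (at t)"
      by (rule smooth_on_has_vector_derivative[OF s inA(1)[OF t]])
    have "((\<lambda>t. (1 / \<beta> t $ i) *\<^sub>R \<beta> t - r t *\<^sub>R E) has_vector_derivative
        ((1 / \<beta> t $ i) *\<^sub>R der 1 \<beta> t + (- (der 1 \<beta> t $ i / (\<beta> t $ i)\<^sup>2)) *\<^sub>R \<beta> t)
        - (r t *\<^sub>R 0 + (n t $ j / (\<beta> t $ i)\<^sup>2) *\<^sub>R E)) (at t)"
      by (intro has_vector_derivative_diff has_vector_derivative_scaleR 1 2 r'[OF t] has_vector_derivative_const)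
    moreover have "((1 / \<beta> t $ i) *\<^sub>R der 1 \<beta> t + (- (der 1 \<beta> t $ i / (\<beta> t $ i)\<^sup>2)) *\<^sub>R \<beta> t)
        - (r t *\<^sub>R 0 + (n t $ j / (\<beta> t $ i)\<^sup>2) *\<^sub>R E) = 0"
      unfolding E[OF t, symmetric] using inA(2,3)[OF t]
      by (simp add: n_def scaleR_diff_right power2_eq_square)
    ultimately show "((\<lambda>t. (1 / \<beta> t $ i) *\<^sub>R \<beta> t - r t *\<^sub>R E) has_vector_derivative 0) (at t)" by simp
  qed
  have \<beta>: "\<beta> t = \<beta> t $ i *\<^sub>R (A0 + r t *\<^sub>R E)" if t: "t \<in> ?A" for t
    unfolding A0[OF t, symmetric] using inA(2)[OF t] by simp
  define l where "l t = inverse (\<beta> t $ i) * inverse (sqrt (1 + (r t)\<^sup>2))" for t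
  have sA: "smooth_on ?A \<beta>" by (rule smooth_on_subset[OF s AI])
  have sr: "smooth_on ?A r" unfolding r_def by (intro smooth_intros sA inA(2); simp)
  have pos: "0 < 1 + (r t)\<^sup>2" for t by (simp add: add_pos_nonneg)
  have sl: "smooth_on ?A l"
    unfolding l_def by (intro smooth_intros sA sr inA(2)) (use pos in \<open>auto simp: less_imp_neq[symmetric]\<close>)
  have ss: "smooth_on ?A (\<lambda>t. arctan (r t))" by (intro smooth_intros sr; simp)
  have lnz: "l t \<noteq> 0" if "t \<in> ?A" for t using inA(2)[OF that] pos[of t] by (simp add: l_def)
  have "((\<lambda>t. arctan (r t)) has_real_derivative (n u $ j / (\<beta> u $ i)\<^sup>2) / (1 + (r u)\<^sup>2)) (at u)"
    using pos[of u] by (auto intro!: derivative_eq_intros r'[OF ab(1)] simp: field_simps)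
  then have s1: "der 1 (\<lambda>t. arctan (r t)) u \<noteq> 0"
    using der_1_eqI[of "\<lambda>t. arctan (r t)" "(n u $ j / (\<beta> u $ i)\<^sup>2) / (1 + (r u)\<^sup>2)" u] inA(2,3)[OF ab(1)] pos[of u]
    by (simp add: has_real_derivative_iff_has_vector_derivative)
  obtain t0 t1 y0 y1 \<psi>' S where N:
    "ruled_chart \<A> x t0 t1 y0 y1 \<psi>' (\<lambda>t. \<alpha> (S t) + 0 *\<^sub>R \<beta> (S t)) (\<lambda>t. l (S t) *\<^sub>R \<beta> (S t))"
    "\<psi> (u, v) \<in> \<psi>' ` ({t0<..<t1} \<times> {y0<..<y1})" "smooth_on {t0<..<t1} S"
    "\<And>t. t \<in> {t0<..<t1} \<Longrightarrow> S t \<in> ?A \<and> arctan (r (S t)) = t \<and> der 1 (\<lambda>t. arctan (r t)) (S t) \<noteq> 0 \<and>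
        (S has_vector_derivative inverse (der 1 (\<lambda>t. arctan (r t)) (S t))) (at t)"
    by (rule ruled_chart_reparametrize[OF surface rc open_greaterThanLessThan AI ab(1) uv(2) ss sl
          smooth_on_const[OF open_greaterThanLessThan, where c="0::real"] s1 lnz]) (assumption, (rule that; assumption))
  let ?T = "{t0<..<t1}"
  have polar: "l (S t) *\<^sub>R \<beta> (S t) = cos t *\<^sub>R A0 + sin t *\<^sub>R E" if t: "t \<in> ?T" for t
  proof -
    have A: "S t \<in> ?A" "t = arctan (r (S t))" using N(4)[OF t] by auto
    have "l (S t) *\<^sub>R \<beta> (S t) = inverse (sqrt (1 + (r (S t))\<^sup>2)) *\<^sub>R (A0 + r (S t) *\<^sub>R E)"
      by (subst \<beta>[OF A(1)]) (use inA(2)[OF A(1)] in \<open>simp add: l_def\<close>)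
    also have "\<dots> = cos t *\<^sub>R A0 + sin t *\<^sub>R E"
      using cos_arctan[of "r (S t)"] sin_arctan[of "r (S t)"] unfolding A(2)[symmetric]
      by (simp add: algebra_simps divide_inverse)
    finally show ?thesis .
  qed
  have "der 2 (\<lambda>t. l (S t) *\<^sub>R \<beta> (S t)) t = - (l (S t) *\<^sub>R \<beta> (S t))" if t: "t \<in> ?T" for t
  proof -
    have trig: "((\<lambda>t. cos t *\<^sub>R P + sin t *\<^sub>R Q) has_vector_derivative cos t *\<^sub>R Q + sin t *\<^sub>R (- P)) (at t)"
      for P Q :: "real^4" and t
      by (auto intro!: derivative_eq_intros)
    have "der 1 (\<lambda>t. cos t *\<^sub>R A0 + sin t *\<^sub>R E) = (\<lambda>t. cos t *\<^sub>R E + sin t *\<^sub>R (- A0))"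
      by (rule ext, rule der_1_eqI, rule trig)
    then have "der 1 (der 1 (\<lambda>t. cos t *\<^sub>R A0 + sin t *\<^sub>R E)) t = cos t *\<^sub>R (- A0) + sin t *\<^sub>R (- E)"
      by (simp only:) (rule der_1_eqI, rule trig)
    then have "der 2 (\<lambda>t. cos t *\<^sub>R A0 + sin t *\<^sub>R E) t = - (cos t *\<^sub>R A0 + sin t *\<^sub>R E)"
      by (simp add: der_1_der)
    then show ?thesis
      using der_cong_open[OF open_greaterThanLessThan polar t, where k=2] polar[OF t] by simp
  qed
  then have "form_II ?T {y0<..<y1} (\<lambda>q. x (\<psi>' q)) (\<lambda>q. \<sigma> (\<psi>' q))"
    using N(2) by (intro form_II_of_ruled_chart[OF N(1)]) auto
  then show ?thesis by (intro normal_form_atI[OF N(1,2), of 0]) simp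
qed

lemma normal_form_I1:
  assumes rc: "ruled_chart \<A> x u0 u1 v0 v1 \<psi> \<alpha> \<beta>" and p: "p \<in> \<psi> ` ({u0<..<u1} \<times> {v0<..<v1})"
    and ode: "\<And>u. u \<in> {u0<..<u1} \<Longrightarrow> der 2 \<beta> u = der 1 \<alpha> u"
  shows "normal_form_at \<A> x \<sigma> p"
proof -
  have "{v0<..<v1} \<noteq> {}" using p by auto
  from form_I1_of_ruled_chart[OF rc this ode] show ?thesis using normal_form_atI[OF rc p] by metis
qed

text \<open>Translating so that \<open>\<gamma>(u) = \<gamma>''''(u)\<close> at the given point ensures \<open>G \<noteq> 0\<close> there, hence on a smaller interval.\<close>
lemma normal_form_I2_unit:
  assumes rc: "ruled_chart \<A> x u0 u1 v0 v1 \<psi> \<alpha> \<beta>" and p: "p \<in> \<psi> ` ({u0<..<u1} \<times> {v0<..<v1})"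
    and \<epsilon>: "\<epsilon> \<in> {1, -1}"
    and ode: "\<And>u. u \<in> {u0<..<u1} \<Longrightarrow> der 1 \<alpha> u = der 2 \<beta> u + \<epsilon> *\<^sub>R \<beta> u"
  shows "normal_form_at \<A> x \<sigma> p"
proof -
  let ?I = "{u0<..<u1}"
  obtain u v where uv: "u \<in> ?I" "v \<in> {v0<..<v1}" "p = \<psi> (u, v)" using p by auto
  note s = ruled_chart_smooth(1,2)[OF rc] and sd = ruled_chart_smooth(4)[OF rc] and hd = ruled_chart_smooth(6)[OF rc]
  have \<alpha>2: "der 2 \<alpha> u = der 3 \<beta> u + \<epsilon> *\<^sub>R der 1 \<beta> u"
  proof -
    have "der (Suc 1) \<alpha> u = der 1 (\<lambda>u. der 2 \<beta> u + \<epsilon> *\<^sub>R der 0 \<beta> u) u"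
      by (rule der_shift_on[OF open_greaterThanLessThan _ uv(1)]) (simp add: ode)
    also have "\<dots> = der (Suc 2) \<beta> u + \<epsilon> *\<^sub>R der (Suc 0) \<beta> u"
      by (intro der_1_eqI has_vector_derivative_add hd uv
          bounded_linear.has_vector_derivative[OF bounded_linear_scaleR_right])
    finally show ?thesis by (simp flip: One_nat_def)
  qed
  have "det4 (der 2 \<beta> u) (\<beta> u) (der 1 \<beta> u) (der 3 \<beta> u) \<noteq> 0"
    using ruled_chart_det[OF rc uv(1,2)] by (simp add: ode[OF uv(1)] \<alpha>2)
  moreover have "det4 (der 3 \<beta> u) (\<beta> u) (der 1 \<beta> u) (der 2 \<beta> u) = - det4 (der 2 \<beta> u) (\<beta> u) (der 1 \<beta> u) (der 3 \<beta> u)"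
    by (simp add: det4_expand algebra_simps)
  ultimately have D: "det4 (der 3 \<beta> u) (\<beta> u) (der 1 \<beta> u) (der 2 \<beta> u) \<noteq> 0" by simp
  define t where "t = \<epsilon> *\<^sub>R der 3 \<beta> u - \<alpha> u + der 1 \<beta> u"
  define G where "G u = det4 (\<epsilon> *\<^sub>R (\<alpha> u + t - der 1 \<beta> u)) (\<beta> u) (der 1 \<beta> u) (der 2 \<beta> u)" for u
  have eq: "\<epsilon> *\<^sub>R (\<alpha> u + t - der 1 \<beta> u) = der 3 \<beta> u" using \<epsilon> by (auto simp: t_def)
  have "G u \<noteq> 0" unfolding G_def eq by (rule D)
  then have "u \<in> {u \<in> ?I. G u \<noteq> 0}" using uv by simp
  moreover have "open {u \<in> ?I. G u \<noteq> 0}"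
    unfolding G_def by (intro open_nonzero smooth_on_continuous smooth_intros s sd; simp)
  ultimately obtain a b where ab: "u \<in> {a<..<b}" "{a<..<b} \<subseteq> {u \<in> ?I. G u \<noteq> 0}" using open_interval by blast
  have rc': "ruled_chart \<A> x a b v0 v1 \<psi> \<alpha> \<beta>"
    using ab by (intro ruled_chart_restrict[OF surface rc]) auto
  have "form_I2 {a<..<b} {v0<..<v1} (\<lambda>q. x (\<psi> q) + t) (\<lambda>q. \<sigma> (\<psi> q))"
    using uv(2) ab(2) by (intro form_I2_of_ruled_chart[OF rc' _ \<epsilon>]) (auto simp: ode G_def)
  then show ?thesis
    using ab(1) uv by (intro normal_form_atI[OF rc', of _ t]) auto
qed

text \<open>With \<open>s' = k = sqrt \<bar>K\<bar>\<close>, scaling \<open>\<beta>\<close> by \<open>k\<close> and shifting \<open>\<alpha>\<close> by \<open>(k'/k) \<beta>\<close> keeps the coefficient of \<open>\<alpha>'\<close> at one and that of \<open>\<beta>'\<close>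
  at zero, whereas \<open>K\<close> is divided by \<open>k\<^sup>2\<close>.\<close>
lemma normal_form_I2:
  assumes rc: "ruled_chart \<A> x u0 u1 v0 v1 \<psi> \<alpha> \<beta>" and uv: "u \<in> {u0<..<u1}" "v \<in> {v0<..<v1}"
    and K: "smooth_on {u0<..<u1} K" "K u \<noteq> 0"
    and ode: "\<And>u. u \<in> {u0<..<u1} \<Longrightarrow> der 2 \<beta> u = der 1 \<alpha> u + K u *\<^sub>R \<beta> u"
  shows "normal_form_at \<A> x \<sigma> (\<psi> (u, v))"
proof -
  let ?I = "{u0<..<u1}"
  define d where "d = sgn (K u)"
  have d: "d * d = 1" "d \<in> {1, -1}" using K(2) by (auto simp: d_def sgn_if)
  have sdK: "smooth_on ?I (\<lambda>u. d * K u)" by (intro smooth_intros K(1); simp)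
  have "open (?I \<inter> (\<lambda>u. d * K u) -` {0<..})"
    by (intro continuous_open_preimage smooth_on_continuous[OF sdK]) auto
  moreover have "u \<in> ?I \<inter> (\<lambda>u. d * K u) -` {0<..}" using uv K(2) by (simp add: d_def sgn_if)
  ultimately obtain a' b' where ab': "u \<in> {a'<..<b'}" "{a'<..<b'} \<subseteq> ?I \<inter> (\<lambda>u. d * K u) -` {0<..}"
    by (rule open_interval)
  have sub': "{a'<..<b'} \<subseteq> ?I" using ab'(2) by auto
  define k where "k u = sqrt (d * K u)" for u
  have sk': "smooth_on {a'<..<b'} k"
    unfolding k_def by (intro smooth_intros smooth_on_subset[OF K(1) sub']) (use ab'(2) in auto)
  obtain a b s where ab: "u \<in> {a<..<b}" "{a<..<b} \<subseteq> {a'<..<b'}" "smooth_on {a<..<b} s"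
    "\<And>u. u \<in> {a<..<b} \<Longrightarrow> (s has_vector_derivative k u) (at u)"
    by (rule smooth_antiderivative[OF open_greaterThanLessThan sk' ab'(1)]) (rule that; assumption)
  let ?A = "{a<..<b}"
  have AI: "?A \<subseteq> ?I" using ab(2) sub' by auto
  have kpos: "0 < k u" "K u = d * (k u * k u)" if "u \<in> ?A" for u
  proof -
    have "0 < d * K u" using that ab(2) ab'(2) by auto
    then show "0 < k u" by (simp add: k_def)
    have "k u * k u = d * K u" using \<open>0 < d * K u\<close> by (simp add: k_def)
    then show "K u = d * (k u * k u)" using d(1) by (simp add: mult.assoc[symmetric])
  qed
  have sk: "smooth_on ?A k" by (rule smooth_on_subset[OF sk' ab(2)])
  have knz: "k u \<noteq> 0" if "u \<in> ?A" for u using kpos(1)[OF that] by simp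
  define w where "w u = der 1 k u / k u" for u
  have sw: "smooth_on ?A w" unfolding w_def by (intro smooth_intros sk knz; simp)
  have s1: "der 1 s u = k u" if "u \<in> ?A" for u by (rule der_1_eqI[OF ab(4)[OF that]])
  obtain t0 t1 y0 y1 \<psi>' S where N:
    "ruled_chart \<A> x t0 t1 y0 y1 \<psi>' (\<lambda>t. \<alpha> (S t) + w (S t) *\<^sub>R \<beta> (S t)) (\<lambda>t. k (S t) *\<^sub>R \<beta> (S t))"
    "\<psi> (u, v) \<in> \<psi>' ` ({t0<..<t1} \<times> {y0<..<y1})" "smooth_on {t0<..<t1} S"
    "\<And>t. t \<in> {t0<..<t1} \<Longrightarrow> S t \<in> ?A \<and> s (S t) = t \<and> der 1 s (S t) \<noteq> 0 \<and>
        (S has_vector_derivative inverse (der 1 s (S t))) (at t)"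
  proof (rule ruled_chart_reparametrize[OF surface rc open_greaterThanLessThan AI ab(1) uv(2) ab(3) sk sw])
    show "der 1 s u \<noteq> 0" using s1 knz ab(1) by simp
  qed (erule knz, (rule that; assumption))
  let ?T = "{t0<..<t1}"
  have S: "S t \<in> ?A" "(S has_vector_derivative inverse (k (S t))) (at t)" if "t \<in> ?T" for t
    using N(4)[OF that] s1[of "S t"] by auto
  have sA: "smooth_on ?A \<alpha>" "smooth_on ?A \<beta>" "smooth_on ?A (der 1 \<beta>)"
    using rc smooth_on_der[OF open_greaterThanLessThan, of u0 u1 \<beta> 1] by (auto simp: ruled_chart_def intro: smooth_on_subset[OF _ AI])
  have swb: "smooth_on ?A (\<lambda>u. w u *\<^sub>R \<beta> u)" by (intro smooth_intros sw sA; simp)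
  have dwb: "der 1 (\<lambda>u. w u *\<^sub>R \<beta> u) u = w u *\<^sub>R der 1 \<beta> u + der 1 w u *\<^sub>R \<beta> u" if "u \<in> ?A" for u
    by (rule der_scaleR(1)[OF open_greaterThanLessThan sw sA(2) that])
  have \<beta>1: "der 1 (\<lambda>t. k (S t) *\<^sub>R \<beta> (S t)) t = der 1 \<beta> (S t) + w (S t) *\<^sub>R \<beta> (S t)" if t: "t \<in> ?T" for t
  proof -
    have skb: "smooth_on ?A (\<lambda>u. k u *\<^sub>R \<beta> u)" by (intro smooth_intros sk sA; simp)
    have "der 1 (\<lambda>t. k (S t) *\<^sub>R \<beta> (S t)) t = inverse (k (S t)) *\<^sub>R der 1 (\<lambda>u. k u *\<^sub>R \<beta> u) (S t)"
      by (rule der_1_chain[OF skb S(1)[OF t] S(2)[OF t]])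
    then show ?thesis
      using der_scaleR(1)[OF open_greaterThanLessThan sk sA(2) S(1)[OF t]] knz[OF S(1)[OF t]]
      by (simp add: w_def scaleR_add_right divide_inverse mult.commute)
  qed
  have \<beta>2: "der 2 (\<lambda>t. k (S t) *\<^sub>R \<beta> (S t)) t = inverse (k (S t)) *\<^sub>R
      (der 2 \<beta> (S t) + (w (S t) *\<^sub>R der 1 \<beta> (S t) + der 1 w (S t) *\<^sub>R \<beta> (S t)))" if t: "t \<in> ?T" for t
  proof -
    have sb: "smooth_on ?A (\<lambda>u. der 1 \<beta> u + w u *\<^sub>R \<beta> u)" by (intro smooth_intros sA sw; simp)
    have "der (Suc 1) (\<lambda>t. k (S t) *\<^sub>R \<beta> (S t)) t = der 1 (\<lambda>t. der 1 \<beta> (S t) + w (S t) *\<^sub>R \<beta> (S t)) t"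
      by (rule der_shift_on[OF open_greaterThanLessThan \<beta>1 t])
    also have "\<dots> = inverse (k (S t)) *\<^sub>R der 1 (\<lambda>u. der 1 \<beta> u + w u *\<^sub>R \<beta> u) (S t)"
      by (rule der_1_chain[OF sb S(1)[OF t] S(2)[OF t]])
    also have "\<dots> = inverse (k (S t)) *\<^sub>R (der 1 (der 1 \<beta>) (S t) + der 1 (\<lambda>u. w u *\<^sub>R \<beta> u) (S t))"
      by (simp add: der_1_add[OF sA(3) swb S(1)[OF t]])
    finally show ?thesis using dwb[OF S(1)[OF t]] by (simp add: der_1_der)
  qed
  have \<alpha>1: "der 1 (\<lambda>t. \<alpha> (S t) + w (S t) *\<^sub>R \<beta> (S t)) t = inverse (k (S t)) *\<^sub>R
      (der 1 \<alpha> (S t) + (w (S t) *\<^sub>R der 1 \<beta> (S t) + der 1 w (S t) *\<^sub>R \<beta> (S t)))" if t: "t \<in> ?T" for t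
  proof -
    have sb: "smooth_on ?A (\<lambda>u. \<alpha> u + w u *\<^sub>R \<beta> u)" by (intro smooth_intros sA sw; simp)
    show ?thesis
      using der_1_chain[OF sb S(1)[OF t] S(2)[OF t]] der_1_add[OF sA(1) swb S(1)[OF t]] dwb[OF S(1)[OF t]] by simp
  qed
  show ?thesis
  proof (rule normal_form_I2_unit[OF N(1,2), of "- d"])
    show "- d \<in> {1, -1}" using d(2) by auto
    fix t assume t: "t \<in> ?T"
    have "inverse (k (S t)) *\<^sub>R (K (S t) *\<^sub>R \<beta> (S t)) = d *\<^sub>R k (S t) *\<^sub>R \<beta> (S t)"
      using kpos(2)[OF S(1)[OF t]] knz[OF S(1)[OF t]] by simp
    note cancel = this
    have ode': "der 2 \<beta> (S t) = der 1 \<alpha> (S t) + K (S t) *\<^sub>R \<beta> (S t)" using ode S(1)[OF t] AI by blast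
    show "der 1 (\<lambda>t. \<alpha> (S t) + w (S t) *\<^sub>R \<beta> (S t)) t
        = der 2 (\<lambda>t. k (S t) *\<^sub>R \<beta> (S t)) t + - d *\<^sub>R k (S t) *\<^sub>R \<beta> (S t)"
      unfolding \<alpha>1[OF t] \<beta>2[OF t] ode' scaleR_add_right cancel by simp
  qed
qed

text \<open>Scaling \<open>\<beta>\<close> by \<open>F = 1/f\<close> makes the coefficient of \<open>\<alpha>'\<close> equal to one; adding \<open>(2 F' + F m) \<beta>\<close> to \<open>\<alpha>\<close> then absorbs the
  \<open>\<beta>'\<close> term.\<close>
lemma normalize_ruled_chart:
  assumes rc: "ruled_chart \<A> x u0 u1 v0 v1 \<psi> \<alpha> \<beta>" and uv: "u \<in> {u0<..<u1}" "v \<in> {v0<..<v1}"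
    and fmg: "smooth_on {u0<..<u1} f" "smooth_on {u0<..<u1} m" "smooth_on {u0<..<u1} g" "f u \<noteq> 0"
    and ode: "\<And>u. u \<in> {u0<..<u1} \<Longrightarrow> der 2 \<beta> u = f u *\<^sub>R der 1 \<alpha> u + m u *\<^sub>R der 1 \<beta> u + g u *\<^sub>R \<beta> u"
  obtains t0 t1 y0 y1 \<psi>' a b K where "ruled_chart \<A> x t0 t1 y0 y1 \<psi>' a b"
    "\<psi> (u, v) \<in> \<psi>' ` ({t0<..<t1} \<times> {y0<..<y1})" "smooth_on {t0<..<t1} K"
    "\<And>t. t \<in> {t0<..<t1} \<Longrightarrow> der 2 b t = der 1 a t + K t *\<^sub>R b t"
proof -
  let ?I = "{u0<..<u1}"
  define A where "A = {u \<in> ?I. f u \<noteq> 0}"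
  have A: "open A" "A \<subseteq> ?I" "u \<in> A"
    unfolding A_def using open_nonzero[OF _ smooth_on_continuous[OF fmg(1)]] fmg(4) uv by auto
  have fnz: "f u \<noteq> 0" if "u \<in> A" for u using that by (simp add: A_def)
  note sub = smooth_on_subset[OF _ A(2)]
  define F where "F u = inverse (f u)" for u
  have sF: "smooth_on A F" unfolding F_def by (intro smooth_intros A(1) sub fmg fnz)
  define w where "w u = 2 * der 1 F u + F u * m u" for u
  have sw: "smooth_on A w" unfolding w_def by (intro smooth_intros A(1) sub fmg sF)
  define K where "K u = (F u * g u + der 2 F u - der 1 w u) * f u" for u
  have sK: "smooth_on A K" unfolding K_def by (intro smooth_intros A(1) sub fmg sF sw)
  have sab: "smooth_on A \<alpha>" "smooth_on A \<beta>" using rc sub by (auto simp: ruled_chart_def)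
  have s1: "der 1 (\<lambda>u. u) u \<noteq> (0::real)" using der_1_eqI[OF has_vector_derivative_id, of u] by simp
  have Fnz: "F u \<noteq> 0" if "u \<in> A" for u using fnz[OF that] by (simp add: F_def)
  obtain t0 t1 y0 y1 \<psi>' S where N:
    "ruled_chart \<A> x t0 t1 y0 y1 \<psi>' (\<lambda>t. \<alpha> (S t) + w (S t) *\<^sub>R \<beta> (S t)) (\<lambda>t. F (S t) *\<^sub>R \<beta> (S t))"
    "\<psi> (u, v) \<in> \<psi>' ` ({t0<..<t1} \<times> {y0<..<y1})" "smooth_on {t0<..<t1} S"
    "\<And>t. t \<in> {t0<..<t1} \<Longrightarrow> S t \<in> A \<and> S t = t \<and> der 1 (\<lambda>u. u) (S t) \<noteq> (0::real) \<and>
        (S has_vector_derivative inverse (der 1 (\<lambda>u. u) (S t))) (at t)"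
    by (rule ruled_chart_reparametrize[OF surface rc A uv(2) smooth_on_id[OF A(1)] sF sw s1])
      (erule Fnz, (rule that; assumption))
  let ?T = "{t0<..<t1}"
  have S: "S t = t" "t \<in> A" if "t \<in> ?T" for t using N(4)[OF that] by auto
  have sKT: "smooth_on ?T K" by (rule smooth_on_subset[OF sK]) (use S in auto)
  show thesis
  proof (rule that[OF N(1,2) sKT])
    fix t assume t: "t \<in> ?T"
    have 1: "der 2 (\<lambda>t. F (S t) *\<^sub>R \<beta> (S t)) t = der 2 (\<lambda>t. F t *\<^sub>R \<beta> t) t"
      by (rule der_cong_open[OF open_greaterThanLessThan _ t]) (simp add: S)
    have 2: "der 1 (\<lambda>t. \<alpha> (S t) + w (S t) *\<^sub>R \<beta> (S t)) t = der 1 (\<lambda>t. \<alpha> t + w t *\<^sub>R \<beta> t) t"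
      by (rule der_cong_open[OF open_greaterThanLessThan _ t]) (simp add: S)
    have swb: "smooth_on A (\<lambda>t. w t *\<^sub>R \<beta> t)" by (intro smooth_intros A(1) sw sab)
    have 3: "der 1 (\<lambda>t. \<alpha> t + w t *\<^sub>R \<beta> t) t = der 1 \<alpha> t + (w t *\<^sub>R der 1 \<beta> t + der 1 w t *\<^sub>R \<beta> t)"
      using der_1_add[OF sab(1) swb S(2)[OF t]] der_scaleR(1)[OF A(1) sw sab(2) S(2)[OF t]] by simp
    have 4: "der 2 (\<lambda>t. F t *\<^sub>R \<beta> t) t = F t *\<^sub>R der 2 \<beta> t + (2 * der 1 F t) *\<^sub>R der 1 \<beta> t + der 2 F t *\<^sub>R \<beta> t"
      by (rule der_scaleR(2)[OF A(1) sF sab(2) S(2)[OF t]])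
    have Ff: "F t * f t = 1" using fnz[OF S(2)[OF t]] by (simp add: F_def)
    have "der 2 \<beta> t = f t *\<^sub>R der 1 \<alpha> t + m t *\<^sub>R der 1 \<beta> t + g t *\<^sub>R \<beta> t" using ode S(2)[OF t] A(2) by blast
    then have 5: "F t *\<^sub>R der 2 \<beta> t = der 1 \<alpha> t + (F t * m t) *\<^sub>R der 1 \<beta> t + (F t * g t) *\<^sub>R \<beta> t"
      using Ff by (simp add: scaleR_add_right)
    have 6: "K t * F t = F t * g t + der 2 F t - der 1 w t" unfolding K_def mult.assoc mult.commute[of "f t"] Ff by simp
    show "der 2 (\<lambda>t. F (S t) *\<^sub>R \<beta> (S t)) t
        = der 1 (\<lambda>t. \<alpha> (S t) + w (S t) *\<^sub>R \<beta> (S t)) t + K t *\<^sub>R F (S t) *\<^sub>R \<beta> (S t)"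
      unfolding 1 2 3 4 5 S(1)[OF t] scaleR_scaleR 6 w_def[of t] by (simp add: algebra_simps)
  qed
qed

text \<open>Cramer's rule along the curve \<open>v = const\<close> provides smooth coefficients; the coefficient of \<open>x\<^sub>u\<^sub>u\<close> vanishes by the structure equations.\<close>
lemma ruled_chart_ode:
  assumes rc: "ruled_chart \<A> x u0 u1 v0 v1 \<psi> \<alpha> \<beta>" and v: "v \<in> {v0<..<v1}"
  obtains f m g where "smooth_on {u0<..<u1} f" "smooth_on {u0<..<u1} m" "smooth_on {u0<..<u1} g"
    "\<And>u. u \<in> {u0<..<u1} \<Longrightarrow> der 2 \<beta> u = f u *\<^sub>R der 1 \<alpha> u + m u *\<^sub>R der 1 \<beta> u + g u *\<^sub>R \<beta> u"
proof -
  let ?I = "{u0<..<u1}"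
  note s = ruled_chart_smooth(1,2)[OF rc] and sd = ruled_chart_smooth(3,4)[OF rc]
  define X where "X u = der 1 \<alpha> u + v *\<^sub>R der 1 \<beta> u" for u
  define Y where "Y u = der 2 \<alpha> u + v *\<^sub>R der 2 \<beta> u" for u
  have sXY: "smooth_on ?I X" "smooth_on ?I Y" unfolding X_def Y_def by (intro smooth_intros sd; simp)+
  define D where "D u = det4 (X u) (\<beta> u) (der 1 \<beta> u) (Y u)" for u
  have D: "D u \<noteq> 0" if "u \<in> ?I" for u
    using ruled_chart_det[OF rc that v] by (simp only: D_def X_def Y_def not_False_eq_True)
  have sD: "smooth_on ?I D" unfolding D_def by (intro smooth_intros sXY s sd; simp)
  define f where "f u = det4 (der 2 \<beta> u) (\<beta> u) (der 1 \<beta> u) (Y u) / D u" for u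
  define g where "g u = det4 (X u) (der 2 \<beta> u) (der 1 \<beta> u) (Y u) / D u" for u
  define n where "n u = det4 (X u) (\<beta> u) (der 2 \<beta> u) (Y u) / D u" for u
  have sf: "smooth_on ?I f" "smooth_on ?I g" "smooth_on ?I n"
    unfolding f_def g_def n_def by (intro smooth_intros sXY s sd sD D; simp)+
  have "der 2 \<beta> u = f u *\<^sub>R der 1 \<alpha> u + (n u + f u * v) *\<^sub>R der 1 \<beta> u + g u *\<^sub>R \<beta> u" if u: "u \<in> ?I" for u
  proof -
    obtain p q k l where "der 2 \<beta> u = (2 * p + q) *\<^sub>R der 1 \<beta> u + k *\<^sub>R X u + l *\<^sub>R \<beta> u"
      using ruled_chart_structure[OF rc u v] unfolding ruled_structure_def Let_def X_def by blast
    then have "det4 (X u) (\<beta> u) (der 1 \<beta> u) (der 2 \<beta> u) = 0" by simp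
    then have "der 2 \<beta> u = f u *\<^sub>R X u + g u *\<^sub>R \<beta> u + n u *\<^sub>R der 1 \<beta> u"
      using det4_basis[OF D[OF u, unfolded D_def], of "der 2 \<beta> u"] unfolding f_def g_def n_def D_def by simp
    then show ?thesis by (simp add: X_def algebra_simps)
  qed
  moreover have "smooth_on ?I (\<lambda>u. n u + f u * v)" by (intro smooth_intros sf; simp)
  ultimately show thesis using that[OF sf(1) _ sf(2), of "\<lambda>u. n u + f u * v"] by blast
qed

text \<open>Either \<open>K\<close> has a non-zero value arbitrarily close to the given point, or it vanishes near that point.\<close>
lemma normal_form_dense_normalized:
  assumes rc: "ruled_chart \<A> x u0 u1 v0 v1 \<psi> \<alpha> \<beta>" and p: "p \<in> \<psi> ` ({u0<..<u1} \<times> {v0<..<v1})"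
    and K: "smooth_on {u0<..<u1} K"
    and ode: "\<And>u. u \<in> {u0<..<u1} \<Longrightarrow> der 2 \<beta> u = der 1 \<alpha> u + K u *\<^sub>R \<beta> u"
    and N: "open N" "p \<in> N"
  shows "\<exists>p'\<in>N. normal_form_at \<A> x \<sigma> p'"
proof -
  obtain u v where uv: "u \<in> {u0<..<u1}" "v \<in> {v0<..<v1}" "p = \<psi> (u, v)" using p by auto
  obtain a b where ab: "u \<in> {a<..<b}" "{a<..<b} \<subseteq> {u0<..<u1}" "\<And>u'. u' \<in> {a<..<b} \<Longrightarrow> \<psi> (u', v) \<in> N"
    by (rule ruled_chart_image_openE[OF rc uv(1,2) N(1) N(2)[unfolded uv(3)]]) (rule that; assumption)
  show ?thesis
  proof (cases "\<exists>u'\<in>{a<..<b}. K u' \<noteq> 0")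
    case True
    then obtain u' where u': "u' \<in> {a<..<b}" "K u' \<noteq> 0" by blast
    then have "u' \<in> {u0<..<u1}" using ab(2) by blast
    from normal_form_I2[OF rc this uv(2) K u'(2) ode] show ?thesis using ab(3)[OF u'(1)] by blast
  next
    case False
    have rc': "ruled_chart \<A> x a b v0 v1 \<psi> \<alpha> \<beta>" by (rule ruled_chart_restrict[OF surface rc ab(2)])
    have "normal_form_at \<A> x \<sigma> p"
    proof (rule normal_form_I1[OF rc'])
      show "p \<in> \<psi> ` ({a<..<b} \<times> {v0<..<v1})" using uv ab(1) by blast
      fix w assume w: "w \<in> {a<..<b}"
      then have "K w = 0" using False by blast
      then show "der 2 \<beta> w = der 1 \<alpha> w" using ode[of w] w ab(2) by auto
    qed
    then show ?thesis using N(2) by blast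
  qed
qed

text \<open>The same alternative, for \<open>f\<close> instead of \<open>K\<close>.\<close>
lemma normal_form_dense:
  assumes p: "p \<in> points \<A>" and N: "open N" "p \<in> N"
  shows "\<exists>p'\<in>N. normal_form_at \<A> x \<sigma> p'"
proof -
  obtain u0 u1 v0 v1 \<psi> \<alpha> \<beta> where rc: "ruled_chart \<A> x u0 u1 v0 v1 \<psi> \<alpha> \<beta>"
    and p': "p \<in> \<psi> ` ({u0<..<u1} \<times> {v0<..<v1})" by (rule ruled_chart_exists[OF p])
  obtain u v where uv: "u \<in> {u0<..<u1}" "v \<in> {v0<..<v1}" "p = \<psi> (u, v)" using p' by auto
  obtain f m g where fmg: "smooth_on {u0<..<u1} f" "smooth_on {u0<..<u1} m" "smooth_on {u0<..<u1} g"
    and ode: "\<And>u. u \<in> {u0<..<u1} \<Longrightarrow> der 2 \<beta> u = f u *\<^sub>R der 1 \<alpha> u + m u *\<^sub>R der 1 \<beta> u + g u *\<^sub>R \<beta> u"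
    by (rule ruled_chart_ode[OF rc uv(2)]) (rule that; assumption)
  obtain a b where ab: "u \<in> {a<..<b}" "{a<..<b} \<subseteq> {u0<..<u1}" "\<And>u'. u' \<in> {a<..<b} \<Longrightarrow> \<psi> (u', v) \<in> N"
    by (rule ruled_chart_image_openE[OF rc uv(1,2) N(1) N(2)[unfolded uv(3)]]) (rule that; assumption)
  show ?thesis
  proof (cases "\<exists>u'\<in>{a<..<b}. f u' \<noteq> 0")
    case True
    then obtain u' where u': "u' \<in> {a<..<b}" "f u' \<noteq> 0" by blast
    then have u'I: "u' \<in> {u0<..<u1}" using ab(2) by blast
    obtain t0 t1 y0 y1 \<psi>' a' b' K where *: "ruled_chart \<A> x t0 t1 y0 y1 \<psi>' a' b'"
      "\<psi> (u', v) \<in> \<psi>' ` ({t0<..<t1} \<times> {y0<..<y1})" "smooth_on {t0<..<t1} K"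
      "\<And>t. t \<in> {t0<..<t1} \<Longrightarrow> der 2 b' t = der 1 a' t + K t *\<^sub>R b' t"
      by (rule normalize_ruled_chart[OF rc u'I uv(2) fmg u'(2) ode]) (assumption, (rule that; assumption))
    show ?thesis by (rule normal_form_dense_normalized[OF * N(1) ab(3)[OF u'(1)]])
  next
    case False
    have rc': "ruled_chart \<A> x a b v0 v1 \<psi> \<alpha> \<beta>" by (rule ruled_chart_restrict[OF surface rc ab(2)])
    have "normal_form_at \<A> x \<sigma> (\<psi> (u, v))"
    proof (rule normal_form_II[OF rc' ab(1) uv(2)])
      fix w assume w: "w \<in> {a<..<b}"
      then have "f w = 0" using False by blast
      then show "der 2 \<beta> w = m w *\<^sub>R der 1 \<beta> w + g w *\<^sub>R \<beta> w" using ode[of w] w ab(2) by auto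
    qed
    then show ?thesis using N(2) uv(3) by blast
  qed
qed

lemma normal_form_open: "open {p \<in> points \<A>. normal_form_at \<A> x \<sigma> p}"
proof (subst open_subopen, rule ballI)
  fix p assume "p \<in> {p \<in> points \<A>. normal_form_at \<A> x \<sigma> p}"
  then have "normal_form_at \<A> x \<sigma> p" by simp
  then obtain u0 u1 v0 v1 \<psi> and B :: "real^4^4" and t where
    lc: "local_coordinates \<A> ({u0<..<u1} \<times> {v0<..<v1}, \<psi>)"
    and p: "p \<in> \<psi> ` ({u0<..<u1} \<times> {v0<..<v1})"
    and form: "invertible B" "let y = (\<lambda>q. B *v x (\<psi> q) + t);
             S = (\<lambda>q. (*v) B ` \<sigma> (\<psi> q))
         in form_I1 {u0<..<u1} {v0<..<v1} y S \<or>
            form_I2 {u0<..<u1} {v0<..<v1} y S \<or>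
            form_II {u0<..<u1} {v0<..<v1} y S"
    unfolding normal_form_at_def by blast
  let ?U = "\<psi> ` ({u0<..<u1} \<times> {v0<..<v1})"
  have "open ?U" "?U \<subseteq> points \<A>" using lc by (auto simp: local_coordinates_def is_chart_def image_of_def)
  moreover have "normal_form_at \<A> x \<sigma> p'" if "p' \<in> ?U" for p'
    unfolding normal_form_at_def using lc that form by blast
  ultimately show "\<exists>T. open T \<and> p \<in> T \<and> T \<subseteq> {p \<in> points \<A>. normal_form_at \<A> x \<sigma> p}"
    using p by (intro exI[of _ ?U]) auto
qed

end

theorem mainTheorem1:
  fixes \<A> :: "'m::{t2_space,second_countable_topology} chart set"
    and nabla :: "'m chart \<Rightarrow> christoffel"
    and x :: "'m \<Rightarrow> real^4"
    and \<sigma> :: "'m \<Rightarrow> (real^4) set"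
  assumes "smooth_surface \<A>"
    and "affine_connection \<A> nabla" and "torsion_free \<A> nabla"
    and "affine_immersion \<A> nabla x \<sigma>"
    and "one_degenerate \<A> x"
    and "parallel_immersion \<A> nabla x \<sigma>"
  shows "ruled_surface \<A> x \<and>
    (\<exists>M\<^sub>0. open M\<^sub>0 \<and> M\<^sub>0 \<subseteq> points \<A> \<and> points \<A> \<subseteq> closure M\<^sub>0 \<and>
      (\<forall>p\<in>M\<^sub>0. \<exists>u\<^sub>0 u\<^sub>1 v\<^sub>0 v\<^sub>1 \<psi> (B :: real^4^4) t.
        local_coordinates \<A> ({u\<^sub>0<..<u\<^sub>1} \<times> {v\<^sub>0<..<v\<^sub>1}, \<psi>) \<and>
        p \<in> \<psi> ` ({u\<^sub>0<..<u\<^sub>1} \<times> {v\<^sub>0<..<v\<^sub>1}) \<and>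
        invertible B \<and>
        (let y = (\<lambda>q. B *v x (\<psi> q) + t);
             S = (\<lambda>q. (*v) B ` \<sigma> (\<psi> q))
         in form_I1 {u\<^sub>0<..<u\<^sub>1} {v\<^sub>0<..<v\<^sub>1} y S \<or>
            form_I2 {u\<^sub>0<..<u\<^sub>1} {v\<^sub>0<..<v\<^sub>1} y S \<or>
            form_II {u\<^sub>0<..<u\<^sub>1} {v\<^sub>0<..<v\<^sub>1} y S)))"
proof -
  interpret parallel_surface \<A> nabla x \<sigma> by (rule parallel_surface.intro) (fact assms)+
  let ?M = "{p \<in> points \<A>. normal_form_at \<A> x \<sigma> p}"
  have "points \<A> \<subseteq> closure ?M"
  proof
    fix p assume p: "p \<in> points \<A>"
    have op: "open (points \<A>)"
      using assms(1) by (auto simp: points_def smooth_surface_def is_chart_def)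
    show "p \<in> closure ?M"
    proof (rule ccontr)
      assume "p \<notin> closure ?M"
      then have "open (points \<A> \<inter> - closure ?M)" "p \<in> points \<A> \<inter> - closure ?M" using op p by auto
      from normal_form_dense[OF p this] obtain p' where "p' \<in> points \<A> \<inter> - closure ?M" "normal_form_at \<A> x \<sigma> p'"
        by blast
      then show False using closure_subset[of ?M] by blast
    qed
  qed
  then show ?thesis
    using ruled normal_form_open unfolding normal_form_at_def
    by (intro conjI exI[of _ ?M]) (simp_all add: normal_form_at_def)
qed

end
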